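(* Let $d\ge1$, let $\phi\in\mathcal O(\mathbb D^d,\mathbb D^d)\cap\mathcal C^1(\overline{\mathbb D}^d)$ and let $\beta_1,\beta_2\ge-1$. Assume that $C_\phi$ maps $A^2_{\beta_1}(\mathbb D^d)$ compactly into $A^2_{\beta_2}(\mathbb D^d)$. Then for all $\beta_1'\ge\beta_1$, $C_\phi$ maps $A^2_{\beta_1'}(\mathbb D^d)$ compactly into $A^2_{\beta_2'}(\mathbb D^d)$, where $$\beta_2'=\frac{\beta_1'(\beta_2+2)+2(\beta_2-\beta_1)}{\beta_1+2}.$$ In particular, if $C_\phi$ is compact on $A^2_{\beta_1}(\mathbb D^d)$, then it is compact on $A^2_{\beta_1'}(\mathbb D^d)$ for all $\beta_1'\ge\beta_1$.
   Context: $\mathbb D$ is the open unit disc of $\mathbb C$, $\mathbb T$ the unit circle. $\mathcal O(\mathbb D^d,\mathbb D^d)$ is the set of holomorphic self-maps of $\mathbb D^d$; $\phi\in\mathcal C^1(\overline{\mathbb D}^d)$ means that $\phi$ and its first order partial derivatives extend continuously to $\overline{\mathbb D}^d$. For $\beta>-1$, let $dA_\beta(z)=(\beta+1)(1-|z|^2)^\beta dA(z)$ with $dA$ the normalized area measure on $\mathbb D$, and $dV_\beta(z)=dA_\beta(z_1)\cdots dA_\beta(z_d)$. $A^2_\beta(\mathbb D^d)$ is the space of holomorphic $f:\mathbb D^d\to\mathbb C$ with $\|f\|^2=\int_{\mathbb D^d}|f|^2dV_\beta<\infty$. By convention $A^2_{-1}(\mathbb D^d)=H^2(\mathbb D^d)$,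 the Hardy space of holomorphic $f:\mathbb D^d\to\mathbb C$ with $\|f\|^2=\sup_{0<r<1}\int_{\mathbb T^d}|f(r\zeta)|^2d\sigma_d(\zeta)<\infty$, $\sigma_d$ the normalized surface measure on $\mathbb T^d$. The composition operator is $C_\phi(f)=f\circ\phi$. *)

theory Defs
  imports "HOL-Probability.Probability" "HOL-Complex_Analysis.Complex_Analysis"
begin

text \<open>The dimension d \<open>\<ge>\<close> 1 is \<open>CARD('d)\<close>. Functions on the polydisc are total functions
  on \<open>complex ^ 'd\<close> whose values outside the polydisc never matter.\<close>

definition polydisc :: "(complex ^ 'd) set" where
  "polydisc = {z. \<forall>i. norm (z $ i) < 1}"

definition closed_polydisc :: "(complex ^ 'd) set" where
  "closed_polydisc = {z. \<forall>i. norm (z $ i) \<le> 1}"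

definition torus :: "(complex ^ 'd) set" where
  "torus = {z. \<forall>i. norm (z $ i) = 1}"

text \<open>Holomorphy in several variables: the real Frechet derivative exists and is complex linear.\<close>

definition holomorphic_polydisc :: "(complex ^ 'd \<Rightarrow> complex) \<Rightarrow> bool" where
  "holomorphic_polydisc f \<longleftrightarrow>
     (\<forall>z\<in>polydisc. \<exists>a :: complex ^ 'd. (f has_derivative (\<lambda>h. \<Sum>j\<in>UNIV. a $ j * h $ j)) (at z))"

definition holomorphic_self_map :: "(complex ^ 'd \<Rightarrow> complex ^ 'd) \<Rightarrow> bool" where
  "holomorphic_self_map \<phi> \<longleftrightarrow>
     (\<forall>i. holomorphic_polydisc (\<lambda>z. \<phi> z $ i)) \<and> \<phi> ` polydisc \<subseteq> polydisc"

definition partial_deriv :: "'d \<Rightarrow> (complex ^ 'd \<Rightarrow> complex) \<Rightarrow> complex ^ 'd \<Rightarrow> complex" where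
  "partial_deriv j f z = deriv (\<lambda>w. f (\<chi> k. if k = j then w else z $ k)) (z $ j)"

definition extends_continuously :: "(complex ^ 'd \<Rightarrow> complex) \<Rightarrow> bool" where
  "extends_continuously f \<longleftrightarrow>
     (\<exists>g. continuous_on closed_polydisc g \<and> (\<forall>z\<in>polydisc. g z = f z))"

text \<open>Meant for holomorphic \<open>\<phi>\<close> only: then the antiholomorphic partial derivatives vanish, so
  that the complex partial derivatives account for all first order derivatives.\<close>

definition C1_closed_polydisc :: "(complex ^ 'd \<Rightarrow> complex ^ 'd) \<Rightarrow> bool" where
  "C1_closed_polydisc \<phi> \<longleftrightarrow>
     (\<forall>i. extends_continuously (\<lambda>z. \<phi> z $ i) \<and>
          (\<forall>j. extends_continuously (partial_deriv j (\<lambda>z. \<phi> z $ i))))"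

definition disc_measure :: "real \<Rightarrow> complex measure" where
  "disc_measure \<beta> = density (uniform_measure lborel (ball 0 1))
     (\<lambda>z. ennreal ((\<beta> + 1) * (1 - (norm z)\<^sup>2) powr \<beta>))"

definition circle_measure :: "complex measure" where
  "circle_measure = distr (uniform_measure lborel {0..2 * pi}) borel cis"

text \<open>The d-fold product of a measure on the complex plane. The library's product measure lives
  on functions \<open>'d \<Rightarrow> complex\<close>, hence the transport along \<open>vec_lambda\<close>.\<close>

definition product_measure :: "complex measure \<Rightarrow> (complex ^ 'd) measure" where
  "product_measure M = distr (\<Pi>\<^sub>M i\<in>(UNIV :: 'd set). M) borel vec_lambda"

lemma measurable_vec_lambda_PiM:
  assumes "sets M = sets (borel :: complex measure)"
  shows "vec_lambda \<in> (\<Pi>\<^sub>M i\<in>(UNIV :: 'd::finite set). M) \<rightarrow>\<^sub>M borel"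
proof -
  have "(\<lambda>x. x i) \<in> (\<Pi>\<^sub>M i\<in>(UNIV :: 'd set). M) \<rightarrow>\<^sub>M borel" for i
    using measurable_component_singleton[of i UNIV "\<lambda>_. M"]
    by (simp cong: measurable_cong_sets add: assms)
  then have "(\<lambda>x. vec_lambda x \<bullet> b) \<in> borel_measurable (\<Pi>\<^sub>M i\<in>(UNIV :: 'd set). M)"
    if "b \<in> Basis" for b :: "complex ^ 'd"
    by (simp add: inner_vec_def)
  then show ?thesis
    by (subst borel_measurable_euclidean_space) blast
qed

definition bergman_sqnorm :: "real \<Rightarrow> (complex ^ 'd \<Rightarrow> complex) \<Rightarrow> ennreal" where
  "bergman_sqnorm \<beta> f =
     (if \<beta> = -1
      then \<Squnion>r\<in>{0<..<1::real}.
             \<integral>\<^sup>+\<zeta>\<in>torus. ennreal ((norm (f (r *\<^sub>R \<zeta>)))\<^sup>2) \<partial>(product_measure circle_measure)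
      else \<integral>\<^sup>+z\<in>polydisc. ennreal ((norm (f z))\<^sup>2) \<partial>(product_measure (disc_measure \<beta>)))"

definition bergman_space :: "real \<Rightarrow> (complex ^ 'd \<Rightarrow> complex) set" where
  "bergman_space \<beta> = {f. holomorphic_polydisc f \<and> bergman_sqnorm \<beta> f < \<infinity>}"

definition bergman_norm :: "real \<Rightarrow> (complex ^ 'd \<Rightarrow> complex) \<Rightarrow> real" where
  "bergman_norm \<beta> f = sqrt (enn2real (bergman_sqnorm \<beta> f))"

definition comp_operator ::
    "(complex ^ 'd \<Rightarrow> complex ^ 'd) \<Rightarrow> (complex ^ 'd \<Rightarrow> complex) \<Rightarrow> complex ^ 'd \<Rightarrow> complex" where
  "comp_operator \<phi> f = f \<circ> \<phi>"

text \<open>For a linear operator T: T maps the first space into the second, and the images of every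
  bounded sequence have a subsequence that converges in the norm of the second space.\<close>

definition maps_compactly ::
    "((complex ^ 'd \<Rightarrow> complex) \<Rightarrow> complex ^ 'd \<Rightarrow> complex) \<Rightarrow> real \<Rightarrow> real \<Rightarrow> bool" where
  "maps_compactly T \<beta> \<gamma> \<longleftrightarrow>
     (\<forall>f\<in>bergman_space \<beta>. T f \<in> bergman_space \<gamma>) \<and>
     (\<forall>F :: nat \<Rightarrow> complex ^ 'd \<Rightarrow> complex.
        (\<forall>n. F n \<in> bergman_space \<beta>) \<and> (\<exists>C. \<forall>n. bergman_norm \<beta> (F n) \<le> C) \<longrightarrow>
        (\<exists>g\<in>bergman_space \<gamma>. \<exists>r. strict_mono r \<and>
           (\<lambda>n. bergman_norm \<gamma> (\<lambda>z. T (F (r n)) z - g z)) \<longlonglongrightarrow> 0))"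

end

theory Submission
  imports Defs
begin

text \<open>In terms of Taylor coefficients \<open>A\<^sup>2\<^sub>\<beta>\<close> is a weighted \<open>\<ell>\<^sup>2\<close> space whose reproducing kernel is
  \<open>K\<^sub>\<beta>(z,w) = \<Prod> (1 - z\<^sub>i cnj w\<^sub>i) powr -(\<beta> + 2)\<close>. The claim is that compactness from the space of
  \<open>K\<^sub>\<beta>\<^sub>1\<close> to that of \<open>K\<^sub>\<beta>\<^sub>2\<close> passes to the powers \<open>s = (\<beta>1' + 2) / (\<beta>1 + 2) \<ge> 1\<close> of both kernels.
  For \<open>s = 2\<close> boundedness is inherited: functions in the space of the squared kernel are the diagonal
  restrictions of functions in the tensor square, where \<open>C\<^sub>\<phi> \<otimes> C\<^sub>\<phi>\<close> acts. For \<open>1 < s < 2\<close> the weights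
  are, up to constants, geometric means of the weights for \<open>s = 1\<close> and \<open>s = 2\<close>, so quadratic
  interpolation applies; compactness at the end \<open>s = 1\<close> says that the part of \<open>C\<^sub>\<phi> f\<close> with large
  indices is uniformly small, and the interpolated bound keeps it small. Iterating reaches every
  \<open>s \<ge> 1\<close>.\<close>

text \<open>Only the inequality at the end \<open>s = 1\<close> becomes small when the target weight
  is cut off to large indices; at \<open>s = 2\<close> mere boundedness is at hand. After
  interpolation the smallness survives with exponent \<open>1 - \<theta>\<close>, so one step
  reaches the factors \<open>1 + \<theta>\<close> with \<open>\<theta> < 1\<close> and not the
  factor 2. A given \<open>s\<close> is therefore written as \<open>a ^ k\<close> with
  \<open>a < 2\<close>, and each step takes full compactness as input and returns it. Cutting off is
  expressed by another weight, possibly zero, and not by a projection; one interpolation lemma then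
  serves boundedness and tails alike. It rests on writing
  \<open>p powr (1 - \<theta>) * q powr \<theta>\<close> as a constant times the integral of
  \<open>s powr (- \<theta>) * (p * q / (p + s * q))\<close> over \<open>s > 0\<close>. For fixed
  \<open>s\<close> the quotient is, up to a factor \<open>s\<close>, the least value of a quadratic
  splitting problem, in which the two given bounds simply add. The weights of the scale are such
  geometric means only up to constants, which is harmless because these constants do not depend on
  the cut-off.\<close>

section \<open>Quadratic interpolation of matrix bounds\<close>

text \<open>\<open>M\<close> bounds the squared operator norm between weighted l^2 spaces. Inputs
  have finite support, so that only polynomials are involved, and the output is measured in
  \<open>ennreal\<close>, so that the inequality makes sense before any convergence is known.
  \<open>comp_coeff_norm_le\<close> passes to arbitrary functions.\<close>

definition mat_bound :: "('b \<Rightarrow> 'a \<Rightarrow> complex) \<Rightarrow> ('a \<Rightarrow> real) \<Rightarrow> ('b \<Rightarrow> real) \<Rightarrow> real \<Rightarrow> bool" where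
  "mat_bound t w w' M \<longleftrightarrow> (\<forall>S x. finite S \<longrightarrow>
     (\<integral>\<^sup>+b. ennreal (w' b * (norm (\<Sum>a\<in>S. t b a * x a))\<^sup>2) \<partial>count_space UNIV)
       \<le> ennreal (M * (\<Sum>a\<in>S. w a * (norm (x a))\<^sup>2)))"

text \<open>The Beta integral with value pi / sin (pi \<theta>) for 0 < \<theta> < 1. It appears as
  a factor on both sides of the interpolation inequality and cancels there, being positive and
  finite.\<close>

definition K_const :: "real \<Rightarrow> ennreal" where
  "K_const \<theta> = (\<integral>\<^sup>+u. ennreal (indicator {0<..} u * (u powr (-\<theta>) / (1 + u))) \<partial>lborel)"

text \<open>The integrand is at most \<open>u powr (-\<theta>)\<close> up to 1, integrable because
  \<theta> < 1, and at most \<open>u powr (-\<theta> - 1)\<close> beyond 1, integrable because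
  \<theta> > 0.\<close>

lemma K_const_finite:
  assumes "0 < \<theta>" "\<theta> < 1"
  shows "K_const \<theta> < \<infinity>"
proof -
  have 1: "((\<lambda>x. x powr (-\<theta>)) has_integral (1 powr (-\<theta>+1) / (-\<theta>+1))) {0..1}"
    using has_integral_powr_from_0[of "-\<theta>" 1] assms by simp
  have 2: "((\<lambda>x. x powr (-\<theta>-1)) has_integral (- (1 powr ((-\<theta>-1)+1)) / ((-\<theta>-1)+1))) {1..}"
    by (rule has_integral_powr_to_inf) (use assms in auto)
  have I1: "(\<integral>\<^sup>+x. ennreal (x powr (-\<theta>) * indicator {0..1} x) \<partial>lborel) = ennreal (1 powr (-\<theta>+1) / (-\<theta>+1))"
    using nn_integral_has_integral_lebesgue[OF _ 1] by (simp add: nn_integral_completion mult_ac)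
  have I2: "(\<integral>\<^sup>+x. ennreal (x powr (-\<theta>-1) * indicator {1..} x) \<partial>lborel)
      = ennreal (- (1 powr ((-\<theta>-1)+1)) / ((-\<theta>-1)+1))"
    using nn_integral_has_integral_lebesgue[OF _ 2] by (simp add: nn_integral_completion mult_ac)
  have "K_const \<theta> \<le> (\<integral>\<^sup>+x. ennreal (x powr (-\<theta>) * indicator {0..1} x)
      + ennreal (x powr (-\<theta>-1) * indicator {1..} x) \<partial>lborel)"
    unfolding K_const_def
  proof (intro nn_integral_mono)
    fix u :: real
    have "u powr (-\<theta>) / (1 + u) \<le> u powr (-\<theta>)" if "u > 0" "u \<le> 1"
      using that by (simp add: divide_simps mult_left_mono)
    moreover have "u powr (-\<theta>) / (1 + u) \<le> u powr (-\<theta>-1)" if "u > 1"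
      using that by (simp add: powr_diff divide_simps mult_left_mono)
    ultimately show "ennreal (indicator {0<..} u * (u powr (-\<theta>) / (1 + u)))
        \<le> ennreal (u powr (-\<theta>) * indicator {0..1} u) + ennreal (u powr (-\<theta>-1) * indicator {1..} u)"
      by (auto simp: indicator_def ennreal_plus[symmetric] simp del: ennreal_plus intro!: ennreal_leI)
  qed
  also have "\<dots> < \<infinity>"
    by (subst nn_integral_add) (auto simp: I1 I2)
  finally show ?thesis .
qed

lemma K_const_pos: "K_const \<theta> > 0"
proof -
  have "K_const \<theta> \<noteq> 0"
  proof
    assume "K_const \<theta> = 0"
    then have "AE u in lborel. ennreal (indicator {0<..} u * (u powr (-\<theta>) / (1 + u))) = 0"
      unfolding K_const_def by (subst (asm) nn_integral_0_iff_AE) auto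
    then have "AE u in lborel. u \<notin> {0<..<1::real}"
      by (elim AE_mp) (auto simp: indicator_def ennreal_eq_0_iff divide_le_0_iff intro!: AE_I2)
    then have "emeasure lborel {0<..<1::real} = 0"
      by (subst (asm) AE_iff_measurable[OF _ refl]) (auto simp: greaterThanLessThan_def greaterThan_def lessThan_def Int_def)
    then show False by (simp add: emeasure_lborel_Ioo)
  qed
  then show ?thesis by (simp add: zero_less_iff_neq_zero)
qed

text \<open>The substitution \<open>s = (p / q) * u\<close> turns \<open>p + s * q\<close> into
  \<open>p * (1 + u)\<close> and separates the variables. If \<open>p\<close> or \<open>q\<close>
  vanishes, both sides are zero, since \<open>0 powr x = 0\<close>; this case occurs for weights
  that are cut off.\<close>

lemma K_integral:
  assumes "0 < \<theta>" "\<theta> < 1" "p \<ge> 0" "q \<ge> 0"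
  shows "(\<integral>\<^sup>+s. ennreal (indicator {0<..} s * s powr (-\<theta>) * (p * q / (p + s * q))) \<partial>lborel)
       = ennreal (p powr (1 - \<theta>) * q powr \<theta>) * K_const \<theta>"
proof (cases "p = 0 \<or> q = 0")
  case True
  then show ?thesis using assms by auto
next
  case False
  then have pq: "p > 0" "q > 0" using assms by auto
  define c where "c = p / q"
  have c: "c > 0" using pq by (simp add: c_def)
  have "(\<integral>\<^sup>+s. ennreal (indicator {0<..} s * s powr (-\<theta>) * (p * q / (p + s * q))) \<partial>lborel)
     = ennreal \<bar>c\<bar> * (\<integral>\<^sup>+u. ennreal (indicator {0<..} (0 + c * u) * (0 + c * u) powr (-\<theta>) *
          (p * q / (p + (0 + c * u) * q))) \<partial>lborel)"
    using c by (intro nn_integral_real_affine) auto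
  also have "\<dots> = (\<integral>\<^sup>+u. ennreal c * ennreal (indicator {0<..} (0 + c * u) * (0 + c * u) powr (-\<theta>) *
          (p * q / (p + (0 + c * u) * q))) \<partial>lborel)"
    using c by (subst nn_integral_cmult) auto
  also have "\<dots> = (\<integral>\<^sup>+u. ennreal (p powr (1 - \<theta>) * q powr \<theta>) *
       ennreal (indicator {0<..} u * (u powr (-\<theta>) / (1 + u))) \<partial>lborel)"
  proof (intro nn_integral_cong)
    fix u :: real
    have cc: "c powr (-\<theta>) * p = p powr (1 - \<theta>) * q powr \<theta>"
      using pq by (simp add: c_def powr_diff powr_divide powr_minus divide_simps)
    have "c * (indicator {0<..} (0 + c * u) * (0 + c * u) powr (-\<theta>) *
          (p * q / (p + (0 + c * u) * q))) = (p powr (1 - \<theta>) * q powr \<theta>) *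
       (indicator {0<..} u * (u powr (-\<theta>) / (1 + u)))"
    proof (cases "u > 0")
      case True
      have "p + c * u * q = p * (1 + u)" using pq by (simp add: c_def field_simps)
      then have "c * (p * q / (p + c * u * q)) = p / (1 + u)"
        using pq True by (simp add: c_def)
      then have "(c * u) powr (-\<theta>) * (c * (p * q / (p + c * u * q))) = (c powr (-\<theta>) * p) * (u powr (-\<theta>) / (1 + u))"
        using c True by (simp only:) (simp add: powr_mult)
      then have "c * ((c * u) powr (-\<theta>) * (p * q / (p + c * u * q)))
          = (p powr (1 - \<theta>) * q powr \<theta>) * (u powr (-\<theta>) / (1 + u))"
        unfolding cc by (simp only: mult_ac)
      then show ?thesis using c True by simp
    next
      case False
      then show ?thesis using c by (simp add: zero_less_mult_iff)
    qed
    then show "ennreal c * ennreal (indicator {0<..} (0 + c * u) * (0 + c * u) powr (-\<theta>) *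
          (p * q / (p + (0 + c * u) * q))) = ennreal (p powr (1 - \<theta>) * q powr \<theta>) *
       ennreal (indicator {0<..} u * (u powr (-\<theta>) / (1 + u)))"
      using c by (metis ennreal_mult' less_imp_le mult_nonneg_nonneg powr_ge_zero)
  qed
  also have "\<dots> = ennreal (p powr (1 - \<theta>) * q powr \<theta>) * K_const \<theta>"
    unfolding K_const_def by (subst nn_integral_cmult) auto
  finally show ?thesis .
qed

text \<open>With a = |u| and b = |v|, the difference (p a^2 + s q b^2) (p + s q) - s p q (a + b)^2
  is the square (p a - s q b)^2. The left side is the K-functional of the two weights at one index:
  the cost of the cheapest splitting.\<close>

lemma K_functional_pointwise:
  fixes u v :: complex
  assumes "p \<ge> 0" "q \<ge> 0" "s > 0"
  shows "s * (p * q / (p + s * q)) * (norm (u + v))\<^sup>2 \<le> p * (norm u)\<^sup>2 + s * q * (norm v)\<^sup>2"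
proof (cases "p + s * q = 0")
  case True
  then show ?thesis using assms by simp
next
  case False
  then have D: "p + s * q > 0" using assms by (smt (verit) mult_nonneg_nonneg)
  have "s * p * q * (norm (u + v))\<^sup>2 \<le> s * p * q * (norm u + norm v)\<^sup>2"
    using assms by (intro mult_left_mono power_mono norm_triangle_ineq) auto
  also have "\<dots> \<le> (p * (norm u)\<^sup>2 + s * q * (norm v)\<^sup>2) * (p + s * q)"
  proof -
    have "(p * (norm u)\<^sup>2 + s * q * (norm v)\<^sup>2) * (p + s * q) - s * p * q * (norm u + norm v)\<^sup>2
       = (p * norm u - s * q * norm v)\<^sup>2"
      by (simp add: power2_eq_square algebra_simps)
    then show ?thesis by (smt (verit) zero_le_power2)
  qed
  finally show ?thesis using D by (simp add: field_simps)
qed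

text \<open>The K-method of real interpolation in quadratic form. For fixed \<open>s\<close> the
  input is split, the first bound is applied to one piece and the second to the other; integration
  against \<open>s powr (-\<theta>)\<close> then produces the geometric means of the weights on both
  sides.\<close>

lemma mat_bound_interpolate:
  fixes t :: "'b::countable \<Rightarrow> 'a \<Rightarrow> complex"
  assumes b0: "mat_bound t w0 w0' M0" and b1: "mat_bound t w1 w1' M1"
    and w: "\<And>a. w0 a > 0" "\<And>a. w1 a > 0" and w': "\<And>b. w0' b \<ge> 0" "\<And>b. w1' b \<ge> 0"
    and M: "M0 > 0" "M1 > 0" and \<theta>: "0 < \<theta>" "\<theta> < 1"
  shows "mat_bound t (\<lambda>a. w0 a powr (1 - \<theta>) * w1 a powr \<theta>)
    (\<lambda>b. w0' b powr (1 - \<theta>) * w1' b powr \<theta>) (M0 powr (1 - \<theta>) * M1 powr \<theta>)"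
  unfolding mat_bound_def
proof (intro allI impI)
  fix S :: "'a set" and x :: "'a \<Rightarrow> complex"
  assume S: "finite S"
  define y where "y b = (\<Sum>a\<in>S. t b a * x a)" for b
  \<comment> \<open>The constants are absorbed into the source weights. The splitting below is then
    optimal for the two bounds together, and the factor
    \<open>M0 powr (1 - \<theta>) * M1 powr \<theta>\<close> comes out directly.\<close>
  define P where "P a = M0 * w0 a" for a
  define Q where "Q a = M1 * w1 a" for a
  have P: "P a > 0" and Q: "Q a > 0" for a using w M by (auto simp: P_def Q_def)
  have main: "(\<integral>\<^sup>+b. ennreal ((w0' b * w1' b / (w0' b + s * w1' b)) * (norm (y b))\<^sup>2) \<partial>count_space UNIV)
     \<le> ennreal (\<Sum>a\<in>S. P a * Q a / (P a + s * Q a) * (norm (x a))\<^sup>2)" if s: "s > 0" for s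
  proof -
    \<comment> \<open>These pieces minimise P |x0|^2 + s Q |x1|^2 under the constraint x0 + x1 = x.
      The minimum is s P Q / (P + s Q) |x|^2, the exact counterpart of the lower bound used for
      \<open>y\<close>.\<close>
    define x0 where "x0 a = of_real (s * Q a / (P a + s * Q a)) * x a" for a
    define x1 where "x1 a = of_real (P a / (P a + s * Q a)) * x a" for a
    have D: "P a + s * Q a > 0" for a using P Q s by (simp add: add_pos_pos)
    have sum1: "s * Q a / (P a + s * Q a) + P a / (P a + s * Q a) = 1" for a
      using D[of a] by (simp add: add_divide_distrib[symmetric] add.commute)
    have "x0 a + x1 a = of_real (s * Q a / (P a + s * Q a) + P a / (P a + s * Q a)) * x a" for a
      by (simp only: x0_def x1_def of_real_add algebra_simps)
    then have x: "x a = x0 a + x1 a" for a by (simp only: sum1) simp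
    have y: "y b = (\<Sum>a\<in>S. t b a * x0 a) + (\<Sum>a\<in>S. t b a * x1 a)" for b
      by (simp add: y_def x sum.distrib algebra_simps)
    have "ennreal s * (\<integral>\<^sup>+b. ennreal ((w0' b * w1' b / (w0' b + s * w1' b)) * (norm (y b))\<^sup>2) \<partial>count_space UNIV)
      = (\<integral>\<^sup>+b. ennreal (s * (w0' b * w1' b / (w0' b + s * w1' b)) * (norm (y b))\<^sup>2) \<partial>count_space UNIV)"
      using s by (subst nn_integral_cmult[symmetric]) (auto simp: ennreal_mult'[symmetric] mult.assoc)
    also have "\<dots> \<le> (\<integral>\<^sup>+b. ennreal (w0' b * (norm (\<Sum>a\<in>S. t b a * x0 a))\<^sup>2)
        + ennreal s * ennreal (w1' b * (norm (\<Sum>a\<in>S. t b a * x1 a))\<^sup>2) \<partial>count_space UNIV)"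
    proof (intro nn_integral_mono)
      fix b
      show "ennreal (s * (w0' b * w1' b / (w0' b + s * w1' b)) * (norm (y b))\<^sup>2)
        \<le> ennreal (w0' b * (norm (\<Sum>a\<in>S. t b a * x0 a))\<^sup>2)
        + ennreal s * ennreal (w1' b * (norm (\<Sum>a\<in>S. t b a * x1 a))\<^sup>2)"
        unfolding y using K_functional_pointwise[OF w'(1)[of b] w'(2)[of b] s] s w'[of b]
        by (simp only: ennreal_mult'[symmetric] ennreal_plus[symmetric] mult_nonneg_nonneg zero_le_power2 less_imp_le ennreal_leI mult.assoc[symmetric])
    qed
    also have "\<dots> \<le> ennreal (M0 * (\<Sum>a\<in>S. w0 a * (norm (x0 a))\<^sup>2))
          + ennreal s * ennreal (M1 * (\<Sum>a\<in>S. w1 a * (norm (x1 a))\<^sup>2))"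
      using b0 b1 S unfolding mat_bound_def
      by (subst nn_integral_add, simp, simp, subst nn_integral_cmult, simp) (intro add_mono mult_left_mono; simp)
    also have "\<dots> = ennreal (\<Sum>a\<in>S. P a * (norm (x0 a))\<^sup>2 + s * (Q a * (norm (x1 a))\<^sup>2))"
      using s M w less_imp_le[OF w(1)] less_imp_le[OF w(2)]
      by (subst ennreal_mult'[symmetric], simp, subst ennreal_plus[symmetric])
         (auto intro!: mult_nonneg_nonneg sum_nonneg simp: P_def Q_def sum.distrib sum_distrib_left algebra_simps)
    also have "(\<Sum>a\<in>S. P a * (norm (x0 a))\<^sup>2 + s * (Q a * (norm (x1 a))\<^sup>2))
       = s * (\<Sum>a\<in>S. P a * Q a / (P a + s * Q a) * (norm (x a))\<^sup>2)"
      unfolding sum_distrib_left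
    proof (intro sum.cong refl)
      fix a
      define E where "E = P a + s * Q a"
      have "P a * (norm (x0 a))\<^sup>2 + s * (Q a * (norm (x1 a))\<^sup>2)
        = (P a * (s * Q a / E)\<^sup>2 + s * Q a * (P a / E)\<^sup>2) * (norm (x a))\<^sup>2"
        by (simp only: x0_def x1_def norm_mult power_mult_distrib norm_of_real power2_abs E_def algebra_simps)
      also have "P a * (s * Q a / E)\<^sup>2 + s * Q a * (P a / E)\<^sup>2 = s * P a * Q a * (P a + s * Q a) / E\<^sup>2"
        by (simp add: power2_eq_square algebra_simps add_divide_distrib)
      also have "\<dots> = s * P a * Q a / E" using D[of a] by (simp add: E_def power2_eq_square)
      finally show "P a * (norm (x0 a))\<^sup>2 + s * (Q a * (norm (x1 a))\<^sup>2)
          = s * (P a * Q a / (P a + s * Q a) * (norm (x a))\<^sup>2)" by (simp add: E_def)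
    qed
    also have "ennreal (s * (\<Sum>a\<in>S. P a * Q a / (P a + s * Q a) * (norm (x a))\<^sup>2))
       = ennreal s * ennreal (\<Sum>a\<in>S. P a * Q a / (P a + s * Q a) * (norm (x a))\<^sup>2)"
      using s by (simp add: ennreal_mult')
    finally show ?thesis
      using s by (subst (asm) ennreal_mult_le_mult_iff) auto
  qed
  have "(\<integral>\<^sup>+b. ennreal (w0' b powr (1 - \<theta>) * w1' b powr \<theta> * (norm (y b))\<^sup>2) \<partial>count_space UNIV) * K_const \<theta>
    = (\<integral>\<^sup>+b. ennreal ((norm (y b))\<^sup>2) * (ennreal (w0' b powr (1 - \<theta>) * w1' b powr \<theta>) * K_const \<theta>) \<partial>count_space UNIV)"
    by (subst nn_integral_multc[symmetric]) (auto simp: ennreal_mult mult_ac)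
  also have "\<dots> = (\<integral>\<^sup>+b. \<integral>\<^sup>+s. ennreal ((norm (y b))\<^sup>2) * ennreal (indicator {0<..} s * s powr (-\<theta>) * (w0' b * w1' b / (w0' b + s * w1' b))) \<partial>lborel \<partial>count_space UNIV)"
    by (subst K_integral[OF \<theta> w', symmetric], subst nn_integral_cmult) auto
  \<comment> \<open>Tonelli for a counting measure and \<open>lborel\<close>; the index set must be
    countable, hence the sort of \<open>'b\<close>.\<close>
  also have "\<dots> = (\<integral>\<^sup>+s. \<integral>\<^sup>+b. ennreal ((norm (y b))\<^sup>2) * ennreal (indicator {0<..} s * s powr (-\<theta>) * (w0' b * w1' b / (w0' b + s * w1' b))) \<partial>count_space UNIV \<partial>lborel)"
    by (rule nn_integral_count_space_nn_integral[symmetric]) auto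
  also have "\<dots> \<le> (\<integral>\<^sup>+s. \<integral>\<^sup>+a. ennreal ((norm (x a))\<^sup>2) * ennreal (indicator {0<..} s * s powr (-\<theta>) * (P a * Q a / (P a + s * Q a))) \<partial>count_space S \<partial>lborel)"
  proof (intro nn_integral_mono)
    fix s :: real
    define k where "k = indicator {0<..} s * s powr (-\<theta>)"
    have k: "k \<ge> 0" by (simp add: k_def)
    show "(\<integral>\<^sup>+b. ennreal ((norm (y b))\<^sup>2) * ennreal (indicator {0<..} s * s powr (-\<theta>) * (w0' b * w1' b / (w0' b + s * w1' b))) \<partial>count_space UNIV)
      \<le> (\<integral>\<^sup>+a. ennreal ((norm (x a))\<^sup>2) * ennreal (indicator {0<..} s * s powr (-\<theta>) * (P a * Q a / (P a + s * Q a))) \<partial>count_space S)"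
    proof (cases "s > 0")
      case True
      have "(\<integral>\<^sup>+b. ennreal ((norm (y b))\<^sup>2) * ennreal (k * (w0' b * w1' b / (w0' b + s * w1' b))) \<partial>count_space UNIV)
        = ennreal k * (\<integral>\<^sup>+b. ennreal ((w0' b * w1' b / (w0' b + s * w1' b)) * (norm (y b))\<^sup>2) \<partial>count_space UNIV)"
        using k by (subst nn_integral_cmult[symmetric]) (auto simp: ennreal_mult'[symmetric] ennreal_mult''[symmetric] mult_ac intro!: nn_integral_cong)
      also have "\<dots> \<le> ennreal k * ennreal (\<Sum>a\<in>S. P a * Q a / (P a + s * Q a) * (norm (x a))\<^sup>2)"
        by (intro mult_left_mono main True) auto
      also have "\<dots> = ennreal (\<Sum>a\<in>S. (norm (x a))\<^sup>2 * (k * (P a * Q a / (P a + s * Q a))))"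
        using k by (simp add: ennreal_mult'[symmetric] sum_distrib_left mult_ac)
      also have "\<dots> = (\<Sum>a\<in>S. ennreal ((norm (x a))\<^sup>2) * ennreal (k * (P a * Q a / (P a + s * Q a))))"
        using k True less_imp_le[OF P] less_imp_le[OF Q]
        by (subst sum_ennreal[symmetric]) (auto simp: ennreal_mult'[symmetric] intro!: mult_nonneg_nonneg divide_nonneg_nonneg add_nonneg_nonneg sum.cong)
      also have "\<dots> = (\<integral>\<^sup>+a. ennreal ((norm (x a))\<^sup>2) * ennreal (k * (P a * Q a / (P a + s * Q a))) \<partial>count_space S)"
        using S by (simp add: nn_integral_count_space_finite)
      finally show ?thesis by (simp add: k_def)
    qed simp
  qed
  also have "\<dots> = (\<integral>\<^sup>+a. \<integral>\<^sup>+s. ennreal ((norm (x a))\<^sup>2) * ennreal (indicator {0<..} s * s powr (-\<theta>) * (P a * Q a / (P a + s * Q a))) \<partial>lborel \<partial>count_space S)"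
    using S by (intro nn_integral_count_space_nn_integral countable_finite) auto
  also have "\<dots> = (\<integral>\<^sup>+a. ennreal ((norm (x a))\<^sup>2) * (ennreal (P a powr (1 - \<theta>) * Q a powr \<theta>) * K_const \<theta>) \<partial>count_space S)"
    by (subst K_integral[OF \<theta> less_imp_le[OF P] less_imp_le[OF Q], symmetric], subst nn_integral_cmult) auto
  also have "\<dots> = (\<integral>\<^sup>+a. ennreal ((norm (x a))\<^sup>2 * (P a powr (1 - \<theta>) * Q a powr \<theta>)) \<partial>count_space S) * K_const \<theta>"
    by (subst nn_integral_multc[symmetric]) (auto simp: ennreal_mult mult_ac)
  also have "\<dots> = ennreal (\<Sum>a\<in>S. (norm (x a))\<^sup>2 * (P a powr (1 - \<theta>) * Q a powr \<theta>)) * K_const \<theta>"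
    using S by (simp add: nn_integral_count_space_finite sum_ennreal)
  also have "(\<Sum>a\<in>S. (norm (x a))\<^sup>2 * (P a powr (1 - \<theta>) * Q a powr \<theta>))
     = M0 powr (1 - \<theta>) * M1 powr \<theta> * (\<Sum>a\<in>S. w0 a powr (1 - \<theta>) * w1 a powr \<theta> * (norm (x a))\<^sup>2)"
    using M w by (simp add: P_def Q_def sum_distrib_left powr_mult mult_ac)
  finally have "K_const \<theta> * (\<integral>\<^sup>+b. ennreal (w0' b powr (1 - \<theta>) * w1' b powr \<theta> * (norm (y b))\<^sup>2) \<partial>count_space UNIV)
     \<le> K_const \<theta> * ennreal (M0 powr (1 - \<theta>) * M1 powr \<theta> * (\<Sum>a\<in>S. w0 a powr (1 - \<theta>) * w1 a powr \<theta> * (norm (x a))\<^sup>2))"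
    by (simp only: mult.commute)
  then show "(\<integral>\<^sup>+b. ennreal (w0' b powr (1 - \<theta>) * w1' b powr \<theta> * (norm (\<Sum>a\<in>S. t b a * x a))\<^sup>2) \<partial>count_space UNIV)
     \<le> ennreal (M0 powr (1 - \<theta>) * M1 powr \<theta> * (\<Sum>a\<in>S. w0 a powr (1 - \<theta>) * w1 a powr \<theta> * (norm (x a))\<^sup>2))"
    unfolding y_def using K_const_pos[of \<theta>] K_const_finite[OF \<theta>]
    by (subst (asm) ennreal_mult_le_mult_iff) auto
qed

section \<open>Tensor squares\<close>

type_synonym 'd multiindex = "'d \<Rightarrow> nat"

lemma finite_atMost_multiindex [simp]: "finite {..\<nu> :: 'd::finite multiindex}"
proof -
  have "{..\<nu>} = (\<Pi>\<^sub>E i\<in>UNIV. {..\<nu> i})" by (auto simp: le_fun_def PiE_def Pi_def)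
  then show ?thesis by (simp add: finite_PiE)
qed

text \<open>The pairs (\<nu>, \<beta>) with \<beta> \<le> \<nu> correspond to all pairs (\<beta>,
  \<beta>') through \<nu> = \<beta> + \<beta>'. Tonelli is applied once before this shift and once
  after it.\<close>

lemma nn_integral_splits:
  fixes k :: "'d::finite multiindex \<Rightarrow> 'd multiindex \<Rightarrow> ennreal"
  shows "(\<integral>\<^sup>+\<nu>. (\<Sum>\<beta>\<in>{..\<nu>}. k \<beta> (\<nu> - \<beta>)) \<partial>count_space UNIV)
    = (\<integral>\<^sup>+\<beta>'. \<integral>\<^sup>+\<beta>. k \<beta> \<beta>' \<partial>count_space UNIV \<partial>count_space UNIV)"
proof -
  have "(\<integral>\<^sup>+\<nu>. (\<Sum>\<beta>\<in>{..\<nu>}. k \<beta> (\<nu> - \<beta>)) \<partial>count_space UNIV)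
      = (\<integral>\<^sup>+\<nu>. \<integral>\<^sup>+\<beta>. k \<beta> (\<nu> - \<beta>) * indicator {\<beta>..} \<nu> \<partial>count_space UNIV \<partial>count_space UNIV)"
  proof (intro nn_integral_cong)
    fix \<nu> :: "'d multiindex"
    have "(\<Sum>\<beta>\<in>{..\<nu>}. k \<beta> (\<nu> - \<beta>)) = (\<integral>\<^sup>+\<beta>. k \<beta> (\<nu> - \<beta>) \<partial>count_space {..\<nu>})"
      by (simp add: nn_integral_count_space_finite)
    also have "\<dots> = (\<integral>\<^sup>+\<beta>. k \<beta> (\<nu> - \<beta>) * indicator {\<beta>..} \<nu> \<partial>count_space UNIV)"
      by (subst nn_integral_count_space_indicator) (auto intro!: nn_integral_cong simp: indicator_def)
    finally show "(\<Sum>\<beta>\<in>{..\<nu>}. k \<beta> (\<nu> - \<beta>)) = (\<integral>\<^sup>+\<beta>. k \<beta> (\<nu> - \<beta>) * indicator {\<beta>..} \<nu> \<partial>count_space UNIV)" .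
  qed
  also have "\<dots> = (\<integral>\<^sup>+\<beta>. \<integral>\<^sup>+\<nu>. k \<beta> (\<nu> - \<beta>) * indicator {\<beta>..} \<nu> \<partial>count_space UNIV \<partial>count_space UNIV)"
    by (rule nn_integral_count_space_nn_integral) auto
  also have "\<dots> = (\<integral>\<^sup>+\<beta>. \<integral>\<^sup>+\<beta>'. k \<beta> \<beta>' \<partial>count_space UNIV \<partial>count_space UNIV)"
  proof (rule nn_integral_cong)
    fix \<beta> :: "'d multiindex"
    have bij: "bij_betw (\<lambda>\<beta>' i. \<beta> i + \<beta>' i) UNIV {\<beta>..}"
      by (rule bij_betw_byWitness[where f' = "\<lambda>\<nu>. \<nu> - \<beta>"]) (auto simp: le_fun_def fun_eq_iff)
    have "(\<integral>\<^sup>+\<nu>. k \<beta> (\<nu> - \<beta>) * indicator {\<beta>..} \<nu> \<partial>count_space UNIV) = (\<integral>\<^sup>+\<nu>. k \<beta> (\<nu> - \<beta>) \<partial>count_space {\<beta>..})"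
      by (subst nn_integral_count_space_indicator[of "{\<beta>..}"]) auto
    also have "\<dots> = (\<integral>\<^sup>+\<beta>'. k \<beta> ((\<lambda>i. \<beta> i + \<beta>' i) - \<beta>) \<partial>count_space UNIV)"
      by (rule nn_integral_bij_count_space[OF bij, symmetric])
    also have "\<dots> = (\<integral>\<^sup>+\<beta>'. k \<beta> \<beta>' \<partial>count_space UNIV)"
      by (intro nn_integral_cong arg_cong[where f="k \<beta>"]) (auto simp: fun_eq_iff)
    finally show "(\<integral>\<^sup>+\<nu>. k \<beta> (\<nu> - \<beta>) * indicator {\<beta>..} \<nu> \<partial>count_space UNIV) = (\<integral>\<^sup>+\<beta>'. k \<beta> \<beta>' \<partial>count_space UNIV)" by simp
  qed
  also have "\<dots> = (\<integral>\<^sup>+\<beta>'. \<integral>\<^sup>+\<beta>. k \<beta> \<beta>' \<partial>count_space UNIV \<partial>count_space UNIV)"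
    by (rule nn_integral_count_space_nn_integral) auto
  finally show ?thesis .
qed

lemma weighted_Cauchy_Schwarz:
  fixes h :: "'a \<Rightarrow> complex"
  assumes "\<And>i. i \<in> A \<Longrightarrow> p i > 0"
  shows "(norm (\<Sum>i\<in>A. h i))\<^sup>2 \<le> (\<Sum>i\<in>A. 1 / p i) * (\<Sum>i\<in>A. p i * (norm (h i))\<^sup>2)"
proof -
  have "(norm (\<Sum>i\<in>A. h i))\<^sup>2 \<le> (\<Sum>i\<in>A. sqrt (1 / p i) * (sqrt (p i) * norm (h i)))\<^sup>2"
  proof (intro power_mono)
    have "(\<Sum>i\<in>A. sqrt (1 / p i) * (sqrt (p i) * norm (h i))) = (\<Sum>i\<in>A. norm (h i))"
      using assms by (intro sum.cong refl) (force simp: real_sqrt_divide)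
    then show "norm (\<Sum>i\<in>A. h i) \<le> (\<Sum>i\<in>A. sqrt (1 / p i) * (sqrt (p i) * norm (h i)))"
      by (simp add: norm_sum)
  qed simp
  also have "\<dots> \<le> (\<Sum>i\<in>A. (sqrt (1 / p i))\<^sup>2) * (\<Sum>i\<in>A. (sqrt (p i) * norm (h i))\<^sup>2)"
    by (rule Cauchy_Schwarz_ineq_sum)
  also have "\<dots> = (\<Sum>i\<in>A. 1 / p i) * (\<Sum>i\<in>A. p i * (norm (h i))\<^sup>2)"
    using assms by (intro arg_cong2[where f="(*)"] sum.cong refl) (auto simp: power_mult_distrib less_imp_le)
  finally show ?thesis .
qed

text \<open>The tensor square of a bounded operator, restricted to the diagonal. The hypothesis on \<open>t\<close> says
  that \<open>t\<close> is the coefficient matrix of an algebra homomorphism.\<close>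

lemma mat_bound_square:
  fixes t :: "'d::finite multiindex \<Rightarrow> 'd multiindex \<Rightarrow> complex"
  assumes b: "mat_bound t w w' M" and M: "M \<ge> 0"
    and w: "\<And>\<alpha>. w \<alpha> > 0" and w': "\<And>\<beta>. w' \<beta> > 0"
    and W: "\<And>\<mu>. 1 / W \<mu> = (\<Sum>\<alpha>\<in>{..\<mu>}. 1 / (w \<alpha> * w (\<mu> - \<alpha>)))"
    and W': "\<And>\<nu>. 1 / W' \<nu> = (\<Sum>\<beta>\<in>{..\<nu>}. 1 / (w' \<beta> * w' (\<nu> - \<beta>)))"
    and t: "\<And>\<nu> \<mu> \<alpha>. \<alpha> \<le> \<mu> \<Longrightarrow> t \<nu> \<mu> = (\<Sum>\<beta>\<in>{..\<nu>}. t \<beta> \<alpha> * t (\<nu> - \<beta>) (\<mu> - \<alpha>))"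
  shows "mat_bound t W W' (M\<^sup>2)"
  unfolding mat_bound_def
proof (intro allI impI)
  fix S :: "'d multiindex set" and x :: "'d multiindex \<Rightarrow> complex"
  assume S: "finite S"
  have pos: "(\<Sum>\<alpha>\<in>{..\<mu>}. 1 / (v \<alpha> * v (\<mu> - \<alpha>))) > 0" if "\<And>\<alpha>. v \<alpha> > 0"
    for v :: "'d multiindex \<Rightarrow> real" and \<mu>
    using that by (intro sum_pos) (auto simp: ex_in_conv[symmetric])
  have Wp: "W \<mu> > 0" for \<mu> using pos[of w \<mu>, OF w] unfolding W[symmetric] by simp
  have Wp': "W' \<mu> > 0" for \<mu> using pos[of w' \<mu>, OF w'] unfolding W'[symmetric] by simp
  \<comment> \<open>If a sum of two multi-indices lies in \<open>S\<close>, both of them lie below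
    an element of \<open>S\<close>; so \<open>A \<times> A\<close> contains every pair that
    matters.\<close>
  define A where "A = (\<Union>\<mu>\<in>S. {..\<mu>})"
  have A: "finite A" using S by (simp add: A_def)
  \<comment> \<open>Among all arrays whose sum over the splittings of \<mu> is
    \<open>x \<mu>\<close>, this one has the least norm for the product weight: its entries are
    proportional to \<open>1 / (w \<alpha> * w \<alpha>')\<close>, and \<open>W \<mu>\<close>
    normalises their sum.\<close>
  define F where "F \<alpha> \<alpha>' = (let \<mu> = (\<lambda>i. \<alpha> i + \<alpha>' i) in
     if \<mu> \<in> S then x \<mu> * of_real (W \<mu> / (w \<alpha> * w \<alpha>')) else 0)" for \<alpha> \<alpha>'
  have reidx: "(\<Sum>\<alpha>\<in>A. \<Sum>\<alpha>'\<in>A. g \<alpha> \<alpha>') = (\<Sum>\<mu>\<in>S. \<Sum>\<alpha>\<in>{..\<mu>}. g \<alpha> (\<mu> - \<alpha>))"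
    if "\<And>\<alpha> \<alpha>'. (\<lambda>i. \<alpha> i + \<alpha>' i) \<notin> S \<Longrightarrow> g \<alpha> \<alpha>' = 0" for g :: "_ \<Rightarrow> _ \<Rightarrow> 'e::comm_monoid_add"
  proof -
    have "(\<Sum>\<alpha>\<in>A. \<Sum>\<alpha>'\<in>A. g \<alpha> \<alpha>') = (\<Sum>(\<alpha>,\<alpha>')\<in>A \<times> A. g \<alpha> \<alpha>')"
      by (simp add: sum.cartesian_product)
    also have "\<dots> = (\<Sum>(\<alpha>,\<alpha>')\<in>{(\<alpha>,\<alpha>'). (\<lambda>i. \<alpha> i + \<alpha>' i) \<in> S}. g \<alpha> \<alpha>')"
    proof (rule sum.mono_neutral_right)
      show "{(\<alpha>, \<alpha>'). (\<lambda>i. \<alpha> i + \<alpha>' i) \<in> S} \<subseteq> A \<times> A"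
        by (auto simp: A_def le_fun_def)
    qed (use A that in auto)
    also have "\<dots> = (\<Sum>(\<mu>,\<alpha>)\<in>(SIGMA \<mu>:S. {..\<mu>}). g \<alpha> (\<mu> - \<alpha>))"
      by (rule sum.reindex_bij_witness[where i = "\<lambda>(\<mu>,\<alpha>). (\<alpha>, \<mu> - \<alpha>)" and
          j = "\<lambda>(\<alpha>,\<alpha>'). (\<lambda>i. \<alpha> i + \<alpha>' i, \<alpha>)"]) (auto simp: le_fun_def fun_eq_iff fun_diff_def)
    also have "\<dots> = (\<Sum>\<mu>\<in>S. \<Sum>\<alpha>\<in>{..\<mu>}. g \<alpha> (\<mu> - \<alpha>))"
      using S by (subst sum.Sigma) auto
    finally show ?thesis .
  qed
  have addsub: "(\<lambda>i. \<alpha> i + (\<mu> - \<alpha>) i) = \<mu>" if "\<alpha> \<le> \<mu>" for \<alpha> \<mu> :: "'d multiindex"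
    using that by (auto simp: le_fun_def fun_eq_iff)
  have Fval: "F \<alpha> (\<mu> - \<alpha>) = x \<mu> * of_real (W \<mu> / (w \<alpha> * w (\<mu> - \<alpha>)))" if "\<alpha> \<le> \<mu>" "\<mu> \<in> S" for \<alpha> \<mu>
    unfolding F_def Let_def addsub[OF that(1)] using that by simp
  have F0: "F \<alpha> \<alpha>' = 0" if "(\<lambda>i. \<alpha> i + \<alpha>' i) \<notin> S" for \<alpha> \<alpha>' using that by (simp add: F_def)
  have sumF: "(\<Sum>\<alpha>\<in>{..\<mu>}. F \<alpha> (\<mu> - \<alpha>)) = x \<mu>" if "\<mu> \<in> S" for \<mu>
  proof -
    have "(\<Sum>\<alpha>\<in>{..\<mu>}. F \<alpha> (\<mu> - \<alpha>)) = x \<mu> * of_real (W \<mu> * (\<Sum>\<alpha>\<in>{..\<mu>}. 1 / (w \<alpha> * w (\<mu> - \<alpha>))))"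
      using that by (simp add: Fval sum_distrib_left)
    then show ?thesis using Wp[of \<mu>] by (simp only: W[symmetric]) simp
  qed
  \<comment> \<open>The tensor square of \<open>t\<close> applied to \<open>F\<close>. The next
    identity says that its restriction to the diagonal is the image of \<open>x\<close>; this is
    where multiplicativity of \<open>t\<close> enters.\<close>
  define H where "H \<beta> \<beta>' = (\<Sum>\<alpha>\<in>A. t \<beta> \<alpha> * (\<Sum>\<alpha>'\<in>A. t \<beta>' \<alpha>' * F \<alpha> \<alpha>'))" for \<beta> \<beta>'
  have G: "(\<Sum>\<mu>\<in>S. t \<nu> \<mu> * x \<mu>) = (\<Sum>\<beta>\<in>{..\<nu>}. H \<beta> (\<nu> - \<beta>))" for \<nu>
  proof -
    have "(\<Sum>\<beta>\<in>{..\<nu>}. H \<beta> (\<nu> - \<beta>)) = (\<Sum>\<beta>\<in>{..\<nu>}. \<Sum>\<mu>\<in>S. \<Sum>\<alpha>\<in>{..\<mu>}. t \<beta> \<alpha> * t (\<nu> - \<beta>) (\<mu> - \<alpha>) * F \<alpha> (\<mu> - \<alpha>))"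
      unfolding H_def by (subst reidx[symmetric]) (auto simp: F0 sum_distrib_left mult.assoc)
    also have "\<dots> = (\<Sum>\<mu>\<in>S. \<Sum>\<alpha>\<in>{..\<mu>}. \<Sum>\<beta>\<in>{..\<nu>}. t \<beta> \<alpha> * t (\<nu> - \<beta>) (\<mu> - \<alpha>) * F \<alpha> (\<mu> - \<alpha>))"
      by (subst sum.swap, rule sum.cong[OF refl], rule sum.swap)
    also have "\<dots> = (\<Sum>\<mu>\<in>S. \<Sum>\<alpha>\<in>{..\<mu>}. t \<nu> \<mu> * F \<alpha> (\<mu> - \<alpha>))"
      by (intro sum.cong refl) (simp add: t sum_distrib_right)
    also have "\<dots> = (\<Sum>\<mu>\<in>S. t \<nu> \<mu> * x \<mu>)"
      by (intro sum.cong refl) (simp add: sum_distrib_left[symmetric] sumF)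
    finally show ?thesis by simp
  qed
  \<comment> \<open>Restriction to the diagonal is contractive: Cauchy-Schwarz with the weights
    \<open>w' \<beta> * w' (\<nu> - \<beta>)\<close>, whose reciprocals add up to exactly
    \<open>1 / W' \<nu>\<close>.\<close>
  have "(\<integral>\<^sup>+\<nu>. ennreal (W' \<nu> * (norm (\<Sum>\<mu>\<in>S. t \<nu> \<mu> * x \<mu>))\<^sup>2) \<partial>count_space UNIV)
     \<le> (\<integral>\<^sup>+\<nu>. (\<Sum>\<beta>\<in>{..\<nu>}. ennreal (w' \<beta> * w' (\<nu> - \<beta>) * (norm (H \<beta> (\<nu> - \<beta>)))\<^sup>2)) \<partial>count_space UNIV)"
  proof (intro nn_integral_mono)
    fix \<nu>
    have "W' \<nu> * (norm (\<Sum>\<mu>\<in>S. t \<nu> \<mu> * x \<mu>))\<^sup>2 \<le> W' \<nu> * ((1 / W' \<nu>) * (\<Sum>\<beta>\<in>{..\<nu>}. w' \<beta> * w' (\<nu> - \<beta>) * (norm (H \<beta> (\<nu> - \<beta>)))\<^sup>2))"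
      unfolding G W' using w' Wp'[of \<nu>] by (intro mult_left_mono weighted_Cauchy_Schwarz) (auto simp: less_imp_le)
    also have "\<dots> = (\<Sum>\<beta>\<in>{..\<nu>}. w' \<beta> * w' (\<nu> - \<beta>) * (norm (H \<beta> (\<nu> - \<beta>)))\<^sup>2)"
      using Wp'[of \<nu>] by simp
    finally show "ennreal (W' \<nu> * (norm (\<Sum>\<mu>\<in>S. t \<nu> \<mu> * x \<mu>))\<^sup>2) \<le> (\<Sum>\<beta>\<in>{..\<nu>}. ennreal (w' \<beta> * w' (\<nu> - \<beta>) * (norm (H \<beta> (\<nu> - \<beta>)))\<^sup>2))"
      using w' by (subst sum_ennreal) (auto intro!: ennreal_leI simp: less_imp_le)
  qed
  also have "\<dots> = (\<integral>\<^sup>+\<beta>'. \<integral>\<^sup>+\<beta>. ennreal (w' \<beta> * w' \<beta>' * (norm (H \<beta> \<beta>'))\<^sup>2) \<partial>count_space UNIV \<partial>count_space UNIV)"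
    by (rule nn_integral_splits)
  \<comment> \<open>The bound for \<open>t\<close> is used here in the variable \<beta> with
    \<beta>' fixed. Once the finite sum over \<alpha> is outside, it is used a second time in
    \<beta>', which explains the square of \<open>M\<close>.\<close>
  also have "\<dots> \<le> (\<integral>\<^sup>+\<beta>'. ennreal (w' \<beta>' * (M * (\<Sum>\<alpha>\<in>A. w \<alpha> * (norm (\<Sum>\<alpha>'\<in>A. t \<beta>' \<alpha>' * F \<alpha> \<alpha>'))\<^sup>2))) \<partial>count_space UNIV)"
  proof (intro nn_integral_mono)
    fix \<beta>'
    have "(\<integral>\<^sup>+\<beta>. ennreal (w' \<beta> * w' \<beta>' * (norm (H \<beta> \<beta>'))\<^sup>2) \<partial>count_space UNIV)
       = ennreal (w' \<beta>') * (\<integral>\<^sup>+\<beta>. ennreal (w' \<beta> * (norm (H \<beta> \<beta>'))\<^sup>2) \<partial>count_space UNIV)"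
      using w' by (subst nn_integral_cmult[symmetric]) (auto simp: ennreal_mult'[symmetric] mult_ac less_imp_le)
    also have "\<dots> \<le> ennreal (w' \<beta>') * ennreal (M * (\<Sum>\<alpha>\<in>A. w \<alpha> * (norm (\<Sum>\<alpha>'\<in>A. t \<beta>' \<alpha>' * F \<alpha> \<alpha>'))\<^sup>2))"
      unfolding H_def using b A unfolding mat_bound_def by (intro mult_left_mono) auto
    finally show "(\<integral>\<^sup>+\<beta>. ennreal (w' \<beta> * w' \<beta>' * (norm (H \<beta> \<beta>'))\<^sup>2) \<partial>count_space UNIV)
      \<le> ennreal (w' \<beta>' * (M * (\<Sum>\<alpha>\<in>A. w \<alpha> * (norm (\<Sum>\<alpha>'\<in>A. t \<beta>' \<alpha>' * F \<alpha> \<alpha>'))\<^sup>2)))"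
      using w'[of \<beta>'] by (simp add: ennreal_mult' less_imp_le)
  qed
  also have "\<dots> = (\<integral>\<^sup>+\<beta>'. (\<Sum>\<alpha>\<in>A. ennreal (M * w \<alpha>) * ennreal (w' \<beta>' * (norm (\<Sum>\<alpha>'\<in>A. t \<beta>' \<alpha>' * F \<alpha> \<alpha>'))\<^sup>2)) \<partial>count_space UNIV)"
  proof (intro nn_integral_cong)
    fix \<beta>'
    show "ennreal (w' \<beta>' * (M * (\<Sum>\<alpha>\<in>A. w \<alpha> * (norm (\<Sum>\<alpha>'\<in>A. t \<beta>' \<alpha>' * F \<alpha> \<alpha>'))\<^sup>2)))
      = (\<Sum>\<alpha>\<in>A. ennreal (M * w \<alpha>) * ennreal (w' \<beta>' * (norm (\<Sum>\<alpha>'\<in>A. t \<beta>' \<alpha>' * F \<alpha> \<alpha>'))\<^sup>2))"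
      using M less_imp_le[OF w] less_imp_le[OF w']
      by (simp add: ennreal_mult'[symmetric] sum_ennreal sum_distrib_left mult_ac)
  qed
  also have "\<dots> = (\<Sum>\<alpha>\<in>A. ennreal (M * w \<alpha>) * (\<integral>\<^sup>+\<beta>'. ennreal (w' \<beta>' * (norm (\<Sum>\<alpha>'\<in>A. t \<beta>' \<alpha>' * F \<alpha> \<alpha>'))\<^sup>2) \<partial>count_space UNIV))"
    by (subst nn_integral_sum) (auto simp: nn_integral_cmult)
  also have "\<dots> \<le> (\<Sum>\<alpha>\<in>A. ennreal (M * w \<alpha>) * ennreal (M * (\<Sum>\<alpha>'\<in>A. w \<alpha>' * (norm (F \<alpha> \<alpha>'))\<^sup>2)))"
    using b A unfolding mat_bound_def by (intro sum_mono mult_left_mono) auto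
  also have "\<dots> = ennreal (M\<^sup>2 * (\<Sum>\<alpha>\<in>A. \<Sum>\<alpha>'\<in>A. w \<alpha> * w \<alpha>' * (norm (F \<alpha> \<alpha>'))\<^sup>2))"
    using M less_imp_le[OF w]
    by (simp add: ennreal_mult'[symmetric] sum_ennreal sum_distrib_left sum_nonneg mult_ac power2_eq_square)
  also have "(\<Sum>\<alpha>\<in>A. \<Sum>\<alpha>'\<in>A. w \<alpha> * w \<alpha>' * (norm (F \<alpha> \<alpha>'))\<^sup>2)
      = (\<Sum>\<mu>\<in>S. \<Sum>\<alpha>\<in>{..\<mu>}. w \<alpha> * w (\<mu> - \<alpha>) * (norm (F \<alpha> (\<mu> - \<alpha>)))\<^sup>2)"
    by (rule reidx) (simp add: F0)
  \<comment> \<open>The choice of \<open>F\<close> makes the lift isometric: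
    \<open>(W \<mu>)\<^sup>2\<close> times the sum of reciprocals, which is
    \<open>1 / W \<mu>\<close>, leaves \<open>W \<mu>\<close>.\<close>
  also have "\<dots> = (\<Sum>\<mu>\<in>S. W \<mu> * (norm (x \<mu>))\<^sup>2)"
  proof (intro sum.cong refl)
    fix \<mu> assume "\<mu> \<in> S"
    then have "(\<Sum>\<alpha>\<in>{..\<mu>}. w \<alpha> * w (\<mu> - \<alpha>) * (norm (F \<alpha> (\<mu> - \<alpha>)))\<^sup>2)
       = (\<Sum>\<alpha>\<in>{..\<mu>}. (norm (x \<mu>))\<^sup>2 * (W \<mu>)\<^sup>2 * (1 / (w \<alpha> * w (\<mu> - \<alpha>))))"
    proof (intro sum.cong refl)
      fix \<alpha> assume "\<alpha> \<in> {..\<mu>}"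
      then have eq: "norm (F \<alpha> (\<mu> - \<alpha>)) = norm (x \<mu>) * (W \<mu> / (w \<alpha> * w (\<mu> - \<alpha>)))"
        using \<open>\<mu> \<in> S\<close> Wp[of \<mu>] w[of \<alpha>] w[of "\<mu> - \<alpha>"]
        by (simp add: Fval norm_mult norm_divide)
      have "p * (k * (W \<mu> / p))\<^sup>2 = k\<^sup>2 * (W \<mu>)\<^sup>2 * (1 / p)" if "p > 0" for p k :: real
        using that by (simp add: power2_eq_square)
      from this[of "w \<alpha> * w (\<mu> - \<alpha>)" "norm (x \<mu>)"]
      show "w \<alpha> * w (\<mu> - \<alpha>) * (norm (F \<alpha> (\<mu> - \<alpha>)))\<^sup>2 = (norm (x \<mu>))\<^sup>2 * (W \<mu>)\<^sup>2 * (1 / (w \<alpha> * w (\<mu> - \<alpha>)))"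
        unfolding eq using w[of \<alpha>] w[of "\<mu> - \<alpha>"] by simp
    qed
    also have "\<dots> = (norm (x \<mu>))\<^sup>2 * (W \<mu>)\<^sup>2 * (1 / W \<mu>)"
      by (simp only: W sum_distrib_left)
    also have "\<dots> = W \<mu> * (norm (x \<mu>))\<^sup>2" using Wp[of \<mu>] by (simp add: power2_eq_square)
    finally show "(\<Sum>\<alpha>\<in>{..\<mu>}. w \<alpha> * w (\<mu> - \<alpha>) * (norm (F \<alpha> (\<mu> - \<alpha>)))\<^sup>2) = W \<mu> * (norm (x \<mu>))\<^sup>2" .
  qed
  finally show "(\<integral>\<^sup>+\<nu>. ennreal (W' \<nu> * (norm (\<Sum>\<mu>\<in>S. t \<nu> \<mu> * x \<mu>))\<^sup>2) \<partial>count_space UNIV)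
     \<le> ennreal (M\<^sup>2 * (\<Sum>\<mu>\<in>S. W \<mu> * (norm (x \<mu>))\<^sup>2))" .
qed

section \<open>Weights on multi-indices\<close>

text \<open>Cubes are preferred to the sets |\<alpha>| < N because the sum over a cube of a product
  of one-variable terms is a product of sums, see \<open>sum_box_index_prod\<close>.\<close>

definition box_index :: "nat \<Rightarrow> 'd::finite multiindex set" where
  "box_index N = {\<alpha>. \<forall>i. \<alpha> i < N}"

lemma box_index_PiE: "box_index N = (\<Pi>\<^sub>E i\<in>UNIV. {..<N})"
  by (auto simp: box_index_def PiE_def Pi_def)

lemma finite_box_index [simp]: "finite (box_index N)"
  by (simp add: box_index_PiE finite_PiE)

lemma finite_subset_box_index:
  fixes S :: "'d::finite multiindex set"
  assumes "finite S"
  obtains N where "S \<subseteq> box_index N"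
proof
  let ?M = "Max (insert 0 (\<Union>\<alpha>\<in>S. range \<alpha>))"
  show "S \<subseteq> box_index (Suc ?M)"
    using assms by (auto simp: box_index_def less_Suc_eq_le intro!: Max_ge)
qed

lemma box_index_mono: "M \<le> N \<Longrightarrow> box_index M \<subseteq> box_index N"
  by (auto simp: box_index_def intro: less_le_trans)

lemma eventually_in_box_index: "\<forall>\<^sub>F N in sequentially. \<alpha> \<in> box_index N"
proof -
  obtain N where N: "{\<alpha>} \<subseteq> box_index N" using finite_subset_box_index[of "{\<alpha>}"] by auto
  show ?thesis
    using eventually_ge_at_top[of N]
  proof eventually_elim
    case (elim M)
    then show ?case using box_index_mono[OF elim] N by auto
  qed
qed

text \<open>Every finite set of multi-indices lies in a cube, so unconditional sums are limits of
  sequences, and the convergence theorems for sequences of integrals apply to them.\<close>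

lemma filterlim_box_index: "filterlim box_index (finite_subsets_at_top UNIV) sequentially"
  unfolding filterlim_def le_filter_def eventually_filtermap
proof safe
  fix P :: "'a multiindex set \<Rightarrow> bool"
  assume "eventually P (finite_subsets_at_top UNIV)"
  then obtain X where X: "finite X" "\<And>Y. finite Y \<Longrightarrow> X \<subseteq> Y \<Longrightarrow> P Y"
    by (auto simp: eventually_finite_subsets_at_top)
  obtain N where N: "X \<subseteq> box_index N" using finite_subset_box_index[OF X(1)] .
  show "\<forall>\<^sub>F n in sequentially. P (box_index n)"
    using eventually_ge_at_top[of N]
    by eventually_elim (rule X(2)[OF finite_box_index order_trans[OF N box_index_mono]])
qed

lemma has_sum_imp_box_index:
  "(f has_sum s) UNIV \<Longrightarrow> (\<lambda>N. sum f (box_index N)) \<longlonglongrightarrow> s"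
  unfolding has_sum_def by (rule filterlim_compose[OF _ filterlim_box_index])

text \<open>Absolute summability provides some sum, and the limit along cubes identifies it.
  Convergence along cubes alone would not give an unconditional sum.\<close>

lemma has_sum_box_indexI:
  fixes f :: "'d::finite multiindex \<Rightarrow> 'b::banach"
  assumes "f abs_summable_on UNIV" "(\<lambda>N. sum f (box_index N)) \<longlonglongrightarrow> s"
  shows "(f has_sum s) UNIV"
proof -
  obtain t where t: "(f has_sum t) UNIV"
    using abs_summable_summable[OF assms(1)] by (auto simp: summable_on_def)
  then show ?thesis using LIMSEQ_unique[OF has_sum_imp_box_index assms(2)] by blast
qed

lemma sum_box_index_prod:
  fixes f :: "'d::finite \<Rightarrow> nat \<Rightarrow> 'b::comm_semiring_1"
  shows "(\<Sum>\<alpha>\<in>box_index N. \<Prod>i\<in>UNIV. f i (\<alpha> i)) = (\<Prod>i\<in>UNIV. \<Sum>k<N. f i k)"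
  unfolding box_index_PiE by (subst prod_sum_PiE) auto

lemma summable_on_box_indexI:
  fixes f :: "'d::finite multiindex \<Rightarrow> real"
  assumes "\<And>\<alpha>. f \<alpha> \<ge> 0" "\<And>N. sum f (box_index N) \<le> B"
  shows "f summable_on UNIV"
proof (rule nonneg_bdd_above_summable_on)
  show "bdd_above (sum f ` {F. F \<subseteq> UNIV \<and> finite F})"
  proof (intro bdd_aboveI2[where M=B])
    fix F :: "'d multiindex set" assume "F \<in> {F. F \<subseteq> UNIV \<and> finite F}"
    then have "finite F" by simp
    then obtain N where "F \<subseteq> box_index N" by (rule finite_subset_box_index)
    then have "sum f F \<le> sum f (box_index N)" using assms(1) by (intro sum_mono2) auto
    then show "sum f F \<le> B" using assms(2)[of N] by linarith
  qed
qed (use assms in auto)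

lemma summable_on_prod_multiindex:
  fixes f :: "'d::finite \<Rightarrow> nat \<Rightarrow> real"
  assumes "\<And>i k. f i k \<ge> 0" "\<And>i. summable (f i)"
  shows "(\<lambda>\<alpha>. \<Prod>i\<in>UNIV. f i (\<alpha> i)) summable_on UNIV"
proof (rule summable_on_box_indexI)
  show "(\<Sum>\<alpha>\<in>box_index N. \<Prod>i\<in>UNIV. f i (\<alpha> i)) \<le> (\<Prod>i\<in>UNIV. suminf (f i))" for N
    unfolding sum_box_index_prod using assms
    by (intro prod_mono conjI sum_nonneg sum_le_suminf) auto
qed (use assms in \<open>auto intro: prod_nonneg\<close>)

lemma nn_integral_box_index:
  fixes f :: "'d::finite multiindex \<Rightarrow> ennreal"
  shows "(\<integral>\<^sup>+\<alpha>. f \<alpha> \<partial>count_space UNIV) = (SUP N. \<Sum>\<alpha>\<in>box_index N. f \<alpha>)"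
proof -
  have "(SUP N. f \<alpha> * indicator (box_index N) \<alpha>) = f \<alpha>" for \<alpha>
  proof (rule antisym)
    obtain N where "{\<alpha>} \<subseteq> box_index N" using finite_subset_box_index[of "{\<alpha>}"] by auto
    then show "f \<alpha> \<le> (SUP N. f \<alpha> * indicator (box_index N) \<alpha>)"
      by (intro SUP_upper2[of N]) auto
  qed (auto intro!: SUP_least simp: indicator_def)
  then have "(\<integral>\<^sup>+\<alpha>. f \<alpha> \<partial>count_space UNIV) = (\<integral>\<^sup>+\<alpha>. (SUP N. f \<alpha> * indicator (box_index N) \<alpha>) \<partial>count_space UNIV)"
    by simp
  also have "\<dots> = (SUP N. \<integral>\<^sup>+\<alpha>. f \<alpha> * indicator (box_index N) \<alpha> \<partial>count_space UNIV)"
  proof (rule nn_integral_monotone_convergence_SUP)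
    show "incseq (\<lambda>N \<alpha>. f \<alpha> * indicator (box_index N) \<alpha>)"
      using box_index_mono by (fastforce simp: incseq_def le_fun_def indicator_def)
  qed auto
  also have "\<dots> = (SUP N. \<Sum>\<alpha>\<in>box_index N. f \<alpha>)"
    by (intro SUP_cong refl)
       (simp add: nn_integral_count_space_indicator[symmetric] nn_integral_count_space_finite)
  finally show ?thesis .
qed

text \<open>The squared norm of z^k in one variable, see \<open>disc_measure_moment\<close>; its
  reciprocal is the coefficient of x^k in \<open>(1 - x) powr -(\<beta> + 2)\<close>. For \<beta> =
  -1 the value is 1, so one formula covers Hardy and Bergman spaces.\<close>

definition bergman_weight1 :: "real \<Rightarrow> nat \<Rightarrow> real" where
  "bergman_weight1 \<beta> k = fact k / pochhammer (\<beta> + 2) k"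

definition bergman_weight :: "real \<Rightarrow> 'd::finite multiindex \<Rightarrow> real" where
  "bergman_weight \<beta> \<alpha> = (\<Prod>i\<in>UNIV. bergman_weight1 \<beta> (\<alpha> i))"

lemma bergman_weight1_pos [simp]: "\<beta> \<ge> -1 \<Longrightarrow> bergman_weight1 \<beta> k > 0"
  by (simp add: bergman_weight1_def pochhammer_pos)

lemma bergman_weight_pos [simp]: "\<beta> \<ge> -1 \<Longrightarrow> bergman_weight \<beta> \<alpha> > 0"
  by (simp add: bergman_weight_def prod_pos)

text \<open>Comparison of coefficients in the square of \<open>(1 - x) powr -(\<beta> + 2)\<close>:
  doubling \<beta> + 2 gives the parameter 2 \<beta> + 2. In this form the squared kernel supplies
  the hypothesis on the weights in \<open>mat_bound_square\<close>.\<close>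

lemma bergman_weight1_Vandermonde:
  "1 / bergman_weight1 (2 * \<beta> + 2) n = (\<Sum>k\<le>n. 1 / (bergman_weight1 \<beta> k * bergman_weight1 \<beta> (n - k)))"
proof -
  define z where "z = \<beta> + 2"
  have p: "pochhammer a k / fact k = (-1) ^ k * ((- a) gchoose k)" for a :: real and k
    by (simp add: gbinomial_pochhammer)
  have "(\<Sum>k\<le>n. 1 / (bergman_weight1 \<beta> k * bergman_weight1 \<beta> (n - k)))
     = (\<Sum>k\<le>n. (pochhammer z k / fact k) * (pochhammer z (n - k) / fact (n - k)))"
    by (simp add: bergman_weight1_def z_def)
  also have "\<dots> = (\<Sum>k\<le>n. (-1) ^ n * (((- z) gchoose k) * ((- z) gchoose (n - k))))"
    by (intro sum.cong refl) (simp add: p power_add[symmetric])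
  also have "\<dots> = (-1) ^ n * ((- (2 * z)) gchoose n)"
    using gbinomial_Vandermonde[of "-z" "-z" n] by (simp add: sum_distrib_left[symmetric] atMost_atLeast0)
  also have "\<dots> = 1 / bergman_weight1 (2 * \<beta> + 2) n"
    using p[of "2 * z" n] by (simp add: bergman_weight1_def z_def algebra_simps)
  finally show ?thesis by simp
qed

lemma bergman_weight_Vandermonde:
  "1 / bergman_weight (2 * \<beta> + 2) \<nu>
    = (\<Sum>\<alpha>\<in>{..\<nu>}. 1 / (bergman_weight \<beta> \<alpha> * bergman_weight \<beta> (\<nu> - \<alpha>)))"
proof -
  have atM: "{..\<nu>} = (\<Pi>\<^sub>E i\<in>UNIV. {..\<nu> i})" by (auto simp: le_fun_def PiE_def Pi_def)
  have "1 / bergman_weight (2 * \<beta> + 2) \<nu> = (\<Prod>i\<in>UNIV. 1 / bergman_weight1 (2 * \<beta> + 2) (\<nu> i))"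
    by (simp add: bergman_weight_def prod_dividef)
  also have "\<dots> = (\<Sum>\<alpha>\<in>{..\<nu>}. \<Prod>i\<in>UNIV. 1 / (bergman_weight1 \<beta> (\<alpha> i) * bergman_weight1 \<beta> (\<nu> i - \<alpha> i)))"
    unfolding bergman_weight1_Vandermonde atM by (subst prod_sum_PiE) auto
  also have "\<dots> = (\<Sum>\<alpha>\<in>{..\<nu>}. 1 / (bergman_weight \<beta> \<alpha> * bergman_weight \<beta> (\<nu> - \<alpha>)))"
    by (simp add: bergman_weight_def prod_dividef prod.distrib)
  finally show ?thesis .
qed

lemma bergman_weight1_asymp:
  assumes "\<beta> \<ge> -1"
  shows "(\<lambda>n. bergman_weight1 \<beta> n * real n powr (\<beta> + 1)) \<longlonglongrightarrow> Gamma (\<beta> + 2)"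
proof -
  define z where "z = \<beta> + 2"
  have z: "z \<ge> 1" using assms by (simp add: z_def)
  \<comment> \<open>Euler's limit has \<open>pochhammer z (n + 1)\<close> below and n to the power z
    above. The factor (z + n) / n, which tends to 1, turns them into \<open>pochhammer z n\<close>
    and n to the power z - 1 = \<beta> + 1.\<close>
  have "(\<lambda>n. Gamma_series z n * ((z + real n) / real n)) \<longlonglongrightarrow> Gamma z * 1"
  proof (intro tendsto_mult Gamma_series_LIMSEQ)
    show "(\<lambda>n. (z + real n) / real n) \<longlonglongrightarrow> 1" by real_asymp
  qed
  moreover have "\<forall>\<^sub>F n in sequentially. Gamma_series z n * ((z + real n) / real n)
       = bergman_weight1 \<beta> n * real n powr (\<beta> + 1)"
    using eventually_gt_at_top[of 0]
  proof eventually_elim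
    case (elim n)
    have "exp (z * ln (real n)) = real n * real n powr (\<beta> + 1)"
    proof -
      have "exp (z * ln (real n)) = real n powr (1 + (\<beta> + 1))"
        using elim by (simp add: z_def powr_def algebra_simps)
      then show ?thesis using elim by (simp only: powr_add) simp
    qed
    moreover have "pochhammer z (n + 1) = pochhammer z n * (z + n)" by (simp add: pochhammer_Suc)
    moreover have "pochhammer z n > 0" "z + n > 0" using z by (auto intro!: pochhammer_pos)
    ultimately show ?case
      using elim by (simp add: Gamma_series_def bergman_weight1_def z_def[symmetric] del: of_nat_add)
  qed
  ultimately show ?thesis by (simp add: z_def tendsto_cong)
qed

lemma pos_seq_bounded_both:
  fixes f :: "nat \<Rightarrow> real"
  assumes "f \<longlonglongrightarrow> L" "L > 0" "\<And>n. f n > 0"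
  obtains C where "C > 0" "\<And>n. f n \<le> C" "\<And>n. 1 \<le> C * f n"
proof -
  have "Bseq f" using assms(1) by (intro convergent_imp_Bseq) (auto simp: convergent_def)
  then obtain A where A: "A > 0" "\<And>n. norm (f n) \<le> A" by (auto simp: Bseq_def)
  have "(\<lambda>n. inverse (f n)) \<longlonglongrightarrow> inverse L" using assms by (intro tendsto_inverse) auto
  then have "Bseq (\<lambda>n. inverse (f n))" by (intro convergent_imp_Bseq) (auto simp: convergent_def)
  then obtain B where B: "B > 0" "\<And>n. norm (inverse (f n)) \<le> B" by (auto simp: Bseq_def)
  show ?thesis
  proof (rule that[of "max A B"])
    show "f n \<le> max A B" for n using A(2)[of n] by (simp add: le_max_iff_disj abs_le_iff)
    show "1 \<le> max A B * f n" for n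
    proof -
      have "inverse (f n) \<le> max A B" using B(2)[of n] assms(3)[of n] by (simp add: le_max_iff_disj)
      then have "inverse (f n) * f n \<le> max A B * f n" using assms(3)[of n] by (intro mult_right_mono) auto
      then show ?thesis using assms(3)[of n] by simp
    qed
  qed (use A B in auto)
qed

text \<open>In one variable the three weights behave like powers of n with exponents -(\<beta> + 1),
  -(2 \<beta> + 3) and -(\<beta>' + 1). The hypothesis on \<beta>' makes these match, so the ratio
  \<open>f\<close> has a positive limit and is bounded above and away from 0. Over multi-indices one
  ratio occurs per coordinate, whence the power of the constant.\<close>

lemma bergman_weight_interpolate:
  assumes b: "\<beta> \<ge> -1" and \<theta>: "0 < \<theta>" "\<theta> < 1" and b': "\<beta>' + 2 = (1 + \<theta>) * (\<beta> + 2)"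
  obtains C where "C > 0"
    "\<And>\<alpha>::'d::finite multiindex. bergman_weight \<beta> \<alpha> powr (1 - \<theta>) * bergman_weight (2 * \<beta> + 2) \<alpha> powr \<theta> \<le> C * bergman_weight \<beta>' \<alpha>"
    "\<And>\<alpha>::'d::finite multiindex. bergman_weight \<beta>' \<alpha> \<le> C * (bergman_weight \<beta> \<alpha> powr (1 - \<theta>) * bergman_weight (2 * \<beta> + 2) \<alpha> powr \<theta>)"
proof -
  have "0 \<le> \<theta> * (\<beta> + 2)" using b \<theta> by simp
  then have b'1: "\<beta>' \<ge> -1" and b2: "2 * \<beta> + 2 \<ge> -1" using b b' by (auto simp: algebra_simps)
  define f where "f n = bergman_weight1 \<beta> n powr (1 - \<theta>) * bergman_weight1 (2 * \<beta> + 2) n powr \<theta> / bergman_weight1 \<beta>' n" for n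
  define g where "g \<gamma> n = bergman_weight1 \<gamma> n * real n powr (\<gamma> + 1)" for \<gamma> n
  have g: "g \<gamma> \<longlonglongrightarrow> Gamma (\<gamma> + 2)" "Gamma (\<gamma> + 2) > 0" if "\<gamma> \<ge> -1" for \<gamma>
    using bergman_weight1_asymp[OF that] that by (auto simp: g_def[abs_def] Gamma_real_pos)
  have "(\<lambda>n. g \<beta> n powr (1 - \<theta>) * g (2 * \<beta> + 2) n powr \<theta> / g \<beta>' n) \<longlonglongrightarrow>
     Gamma (\<beta> + 2) powr (1 - \<theta>) * Gamma (2 * \<beta> + 2 + 2) powr \<theta> / Gamma (\<beta>' + 2)"
    using g[OF b] g[OF b2] g[OF b'1] by (intro tendsto_intros) auto
  moreover have "\<forall>\<^sub>F n in sequentially. g \<beta> n powr (1 - \<theta>) * g (2 * \<beta> + 2) n powr \<theta> / g \<beta>' n = f n"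
    using eventually_gt_at_top[of 0]
  proof eventually_elim
    case (elim n)
    have "real n powr ((\<beta> + 1) * (1 - \<theta>)) * real n powr ((2 * \<beta> + 2 + 1) * \<theta>) = real n powr (\<beta>' + 1)"
      using b' by (simp add: powr_add[symmetric] algebra_simps)
    then show ?case
      using elim b b2 b'1 by (simp add: f_def g_def powr_mult powr_powr less_imp_le mult_ac)
  qed
  ultimately have lim: "f \<longlonglongrightarrow> Gamma (\<beta> + 2) powr (1 - \<theta>) * Gamma (2 * \<beta> + 2 + 2) powr \<theta> / Gamma (\<beta>' + 2)"
    by (simp add: tendsto_cong)
  have fp: "f n > 0" for n using bergman_weight1_pos[OF b, of n] bergman_weight1_pos[OF b2, of n] bergman_weight1_pos[OF b'1, of n]
    unfolding f_def by (intro divide_pos_pos mult_pos_pos) auto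
  obtain C where C: "C > 0" "\<And>n. f n \<le> C" "\<And>n. 1 \<le> C * f n"
    using pos_seq_bounded_both[OF lim _ fp] g(2)[OF b] g(2)[OF b2] g(2)[OF b'1] by (auto simp: zero_less_divide_iff zero_less_mult_iff)
  have prodf: "bergman_weight \<beta> \<alpha> powr (1 - \<theta>) * bergman_weight (2 * \<beta> + 2) \<alpha> powr \<theta> = (\<Prod>i\<in>UNIV. f (\<alpha> i)) * bergman_weight \<beta>' \<alpha>"
    for \<alpha> :: "'d multiindex"
  proof -
    have "bergman_weight1 \<beta>' n \<noteq> 0" for n using bergman_weight1_pos[OF b'1, of n] by simp
    then have "bergman_weight1 \<beta> n powr (1 - \<theta>) * bergman_weight1 (2 * \<beta> + 2) n powr \<theta> = f n * bergman_weight1 \<beta>' n" for n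
      by (simp add: f_def)
    then show ?thesis
      using less_imp_le[OF bergman_weight1_pos[OF b]] less_imp_le[OF bergman_weight1_pos[OF b2]]
      by (simp add: bergman_weight_def prod_powr_distrib prod.distrib[symmetric])
  qed
  show ?thesis
  proof (rule that[of "C ^ CARD('d)"])
    fix \<alpha> :: "'d multiindex"
    have "(\<Prod>i\<in>UNIV. f (\<alpha> i)) \<le> (\<Prod>i\<in>(UNIV::'d set). C)"
      using C fp by (intro prod_mono) (auto simp: less_imp_le)
    then show "bergman_weight \<beta> \<alpha> powr (1 - \<theta>) * bergman_weight (2 * \<beta> + 2) \<alpha> powr \<theta> \<le> C ^ CARD('d) * bergman_weight \<beta>' \<alpha>"
      unfolding prodf using bergman_weight_pos[OF b'1, of \<alpha>] by (intro mult_right_mono) auto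
    have "(\<Prod>i\<in>(UNIV::'d set). 1) \<le> (\<Prod>i\<in>UNIV. C * f (\<alpha> i))"
      using C by (intro prod_mono) auto
    then have "1 \<le> C ^ CARD('d) * (\<Prod>i\<in>UNIV. f (\<alpha> i))" by (simp add: prod.distrib)
    then have "1 * bergman_weight \<beta>' \<alpha> \<le> C ^ CARD('d) * (\<Prod>i\<in>UNIV. f (\<alpha> i)) * bergman_weight \<beta>' \<alpha>"
      using bergman_weight_pos[OF b'1, of \<alpha>] by (intro mult_right_mono) auto
    then show "bergman_weight \<beta>' \<alpha> \<le> C ^ CARD('d) * (bergman_weight \<beta> \<alpha> powr (1 - \<theta>) * bergman_weight (2 * \<beta> + 2) \<alpha> powr \<theta>)"
      unfolding prodf by simp
  qed (use C in simp)
qed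

text \<open>Ratio test: the quotient of consecutive terms tends to \<rho>. Such series dominate, on
  the polydisc of radius \<rho>, the Taylor series of all functions in a bounded set, see
  \<open>coefficient_bound\<close>.\<close>

lemma summable_power_over_weight1:
  assumes b: "\<beta> \<ge> -1" and \<rho>: "0 \<le> \<rho>" "\<rho> < 1"
  shows "summable (\<lambda>k. \<rho> ^ k / sqrt (bergman_weight1 \<beta> k))"
proof (cases "\<rho> = 0")
  case True
  show ?thesis
    by (rule summable_finite[of "{0}"]) (auto simp: True)
next
  case False
  define u where "u k = \<rho> ^ k / sqrt (bergman_weight1 \<beta> k)" for k
  obtain c where c: "\<rho> < c" "c < 1" using \<rho> dense by blast
  have "(\<lambda>k. \<rho> * sqrt ((\<beta> + 2 + real k) / (real k + 1))) \<longlonglongrightarrow> \<rho> * sqrt 1"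
    by (intro tendsto_intros) real_asymp
  then have "\<forall>\<^sub>F k in sequentially. \<rho> * sqrt ((\<beta> + 2 + real k) / (real k + 1)) < c"
    using c by (intro order_tendstoD(2)) auto
  then obtain N where N: "\<And>k. k \<ge> N \<Longrightarrow> \<rho> * sqrt ((\<beta> + 2 + real k) / (real k + 1)) < c"
    by (auto simp: eventually_sequentially)
  have "summable u"
  proof (rule summable_ratio_test[of c N])
    fix k assume "k \<ge> N"
    have "u (Suc k) = \<rho> * sqrt ((\<beta> + 2 + real k) / (real k + 1)) * u k"
    proof -
      have "bergman_weight1 \<beta> (Suc k) = bergman_weight1 \<beta> k / ((\<beta> + 2 + real k) / (real k + 1))"
        by (simp add: bergman_weight1_def pochhammer_Suc field_simps)
      then have "sqrt (bergman_weight1 \<beta> (Suc k)) = sqrt (bergman_weight1 \<beta> k) / sqrt ((\<beta> + 2 + real k) / (real k + 1))"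
        by (simp only: real_sqrt_divide)
      then show ?thesis by (simp only: u_def) simp
    qed
    moreover have "u k \<ge> 0" using b \<rho> by (simp add: u_def less_imp_le)
    ultimately show "norm (u (Suc k)) \<le> c * norm (u k)"
      using N[OF \<open>k \<ge> N\<close>] b \<rho> by (simp add: abs_mult mult_right_mono)
  qed (use c in auto)
  then show ?thesis by (simp add: u_def[abs_def])
qed

section \<open>Parseval identities\<close>

text \<open>Both sides become the same double integral of \<open>f (u * x) * g (y - u * x)\<close>, with \<open>g\<close> the indicator
  of the unit ball.\<close>

lemma nn_integral_lborel_rotate:
  fixes f :: "complex \<Rightarrow> ennreal"
  assumes [measurable]: "f \<in> borel_measurable borel" and u: "norm u = 1"
  shows "(\<integral>\<^sup>+x. f (u * x) \<partial>lborel) = (\<integral>\<^sup>+x. f x \<partial>lborel)"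
proof -
  define g :: "complex \<Rightarrow> ennreal" where "g = indicator (ball 0 1)"
  have [measurable]: "g \<in> borel_measurable borel" unfolding g_def by (rule borel_measurable_indicator) simp
  have u0: "u \<noteq> 0" using u by auto
  have tr: "(\<integral>\<^sup>+x. h (c + x) \<partial>lborel) = (\<integral>\<^sup>+x. h x \<partial>lborel)"
    if [measurable]: "h \<in> borel_measurable borel" for h :: "complex \<Rightarrow> ennreal" and c
    by (subst (2) lborel_distr_plus[of c, symmetric]) (simp add: nn_integral_distr)
  define p where "p = (\<integral>\<^sup>+y. g y \<partial>lborel)"
  have p: "p = ennreal pi"
    by (simp add: p_def g_def emeasure_ball unit_ball_vol_2)
  have "(\<integral>\<^sup>+x. f (u * x) \<partial>lborel) * p = (\<integral>\<^sup>+x. \<integral>\<^sup>+y. f (u * x) * g (- (u * x) + y) \<partial>lborel \<partial>lborel)"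
  proof -
    have "(\<integral>\<^sup>+y. f (u * x) * g (- (u * x) + y) \<partial>lborel) = f (u * x) * p" for x
      unfolding p_def by (subst nn_integral_cmult, measurable) (rule arg_cong[OF tr], measurable)
    then show ?thesis by (simp only:) (rule nn_integral_multc[symmetric], measurable)
  qed
  also have "\<dots> = (\<integral>\<^sup>+y. \<integral>\<^sup>+x. f (u * x) * g (- (u * x) + y) \<partial>lborel \<partial>lborel)"
    by (rule lborel_pair.Fubini') measurable
  \<comment> \<open>Translating x by y / u moves y into \<open>f\<close>. The integral over y is
    then that of a translate of \<open>f\<close>, and the rotation survives only inside the rotation
    invariant \<open>g\<close>.\<close>
  also have "\<dots> = (\<integral>\<^sup>+y. \<integral>\<^sup>+x. f (u * x + y) * g (- (u * x)) \<partial>lborel \<partial>lborel)"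
  proof (rule nn_integral_cong)
    fix y
    have "(\<integral>\<^sup>+x. f (u * x) * g (- (u * x) + y) \<partial>lborel)
       = (\<integral>\<^sup>+x. f (u * (y / u + x)) * g (- (u * (y / u + x)) + y) \<partial>lborel)"
      by (rule tr[symmetric]) measurable
    also have "\<dots> = (\<integral>\<^sup>+x. f (u * x + y) * g (- (u * x)) \<partial>lborel)"
      using u0 by (simp add: algebra_simps)
    finally show "(\<integral>\<^sup>+x. f (u * x) * g (- (u * x) + y) \<partial>lborel) = (\<integral>\<^sup>+x. f (u * x + y) * g (- (u * x)) \<partial>lborel)" .
  qed
  also have "\<dots> = (\<integral>\<^sup>+x. \<integral>\<^sup>+y. f (u * x + y) * g (- (u * x)) \<partial>lborel \<partial>lborel)"
    by (rule lborel_pair.Fubini') measurable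
  also have "\<dots> = (\<integral>\<^sup>+x. (\<integral>\<^sup>+y. f y \<partial>lborel) * g (- (u * x)) \<partial>lborel)"
    by (simp add: nn_integral_multc tr)
  also have "\<dots> = (\<integral>\<^sup>+y. f y \<partial>lborel) * (\<integral>\<^sup>+x. g (- (u * x)) \<partial>lborel)"
    by (rule nn_integral_cmult) measurable
  also have "(\<lambda>x. g (- (u * x))) = g"
    using u by (auto simp: g_def fun_eq_iff indicator_def norm_mult)
  finally have "p * (\<integral>\<^sup>+x. f (u * x) \<partial>lborel) = p * (\<integral>\<^sup>+y. f y \<partial>lborel)"
    by (simp add: p_def mult.commute)
  then show ?thesis
    by (subst (asm) ennreal_mult_cancel_left) (simp add: p)
qed

section \<open>The disc measure: rotation invariance, moments, orthogonality of powers\<close>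

lemma sets_disc_measure [simp, measurable_cong]: "sets (disc_measure \<beta>) = sets borel"
  by (simp add: disc_measure_def)

lemma space_disc_measure [simp]: "space (disc_measure \<beta>) = UNIV"
  by (simp add: disc_measure_def)

lemma emeasure_unit_disc: "emeasure lborel (ball (0::complex) 1) = ennreal pi"
  by (simp add: emeasure_ball unit_ball_vol_2)

lemma nn_integral_disc_measure:
  assumes [measurable]: "f \<in> borel_measurable borel"
  shows "(\<integral>\<^sup>+z. f z \<partial>disc_measure \<beta>) =
    (\<integral>\<^sup>+z. ennreal ((\<beta> + 1) * (1 - (norm z)\<^sup>2) powr \<beta>) * f z * indicator (ball 0 1) z \<partial>lborel) / ennreal pi"
  unfolding disc_measure_def
  by (simp add: nn_integral_density nn_integral_uniform_measure emeasure_unit_disc)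

lemma disc_measure_rotate:
  assumes u: "norm u = 1"
  shows "distr (disc_measure \<beta>) borel ((*) u) = disc_measure \<beta>"
proof (rule measure_eqI)
  fix A assume "A \<in> sets (distr (disc_measure \<beta>) borel ((*) u))"
  then have A [measurable]: "A \<in> sets borel" by simp
  define F where "F z = ennreal ((\<beta> + 1) * (1 - (norm z)\<^sup>2) powr \<beta>) * indicator A z * indicator (ball 0 1) z" for z
  have [measurable]: "indicator (ball (0::complex) 1) \<in> borel_measurable borel"
    by (rule borel_measurable_indicator) simp
  have F [measurable]: "F \<in> borel_measurable borel" unfolding F_def by measurable
  have "emeasure (distr (disc_measure \<beta>) borel ((*) u)) A = (\<integral>\<^sup>+z. indicator A (u * z) \<partial>disc_measure \<beta>)"
    by (subst nn_integral_indicator[symmetric], simp, subst nn_integral_distr) auto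
  also have "\<dots> = (\<integral>\<^sup>+z. F (u * z) \<partial>lborel) / ennreal pi"
    using u by (subst nn_integral_disc_measure) (auto simp: F_def norm_mult indicator_def cong: if_cong)
  also have "\<dots> = (\<integral>\<^sup>+z. F z \<partial>lborel) / ennreal pi"
    by (simp only: nn_integral_lborel_rotate[OF F u])
  also have "\<dots> = (\<integral>\<^sup>+z. indicator A z \<partial>disc_measure \<beta>)"
    by (subst nn_integral_disc_measure) (simp_all add: F_def[abs_def])
  finally show "emeasure (distr (disc_measure \<beta>) borel ((*) u)) A = emeasure (disc_measure \<beta>) A"
    by simp
qed simp

text \<open>A substitute for polar coordinates: the disc of radius sqrt x has area pi x, so |z|^2
  has the distribution function of the uniform law, and radial integrals over the disc become
  integrals over the unit interval.\<close>

lemma uniform_unit_disc_norm_sq: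
  "distr (uniform_measure lborel (ball (0::complex) 1)) borel (\<lambda>z. (norm z)\<^sup>2) = uniform_measure lborel {0..1}"
proof -
  have p1: "prob_space (uniform_measure lborel (ball (0::complex) 1))"
    by (rule prob_space_uniform_measure) (auto simp: emeasure_unit_disc)
  have p2: "prob_space (uniform_measure lborel {0..1::real})"
    by (rule prob_space_uniform_measure) auto
  interpret p1: prob_space "uniform_measure lborel (ball (0::complex) 1)" by (rule p1)
  interpret p2: prob_space "uniform_measure lborel {0..1::real}" by (rule p2)
  show ?thesis
  proof (rule cdf_unique)
    show "real_distribution (distr (uniform_measure lborel (ball (0::complex) 1)) borel (\<lambda>z. (norm z)\<^sup>2))"
      by (rule p1.real_distribution_distr) simp
    show "real_distribution (uniform_measure lborel {0..1})"
      by unfold_locales auto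
    show "cdf (distr (uniform_measure lborel (ball (0::complex) 1)) borel (\<lambda>z. (norm z)\<^sup>2)) = cdf (uniform_measure lborel {0..1})"
    proof
      fix x :: real
      have "emeasure (distr (uniform_measure lborel (ball (0::complex) 1)) borel (\<lambda>z. (norm z)\<^sup>2)) {..x}
        = emeasure lborel (ball (0::complex) 1 \<inter> {z. (norm z)\<^sup>2 \<le> x}) / ennreal pi"
        by (subst emeasure_distr) (simp_all add: emeasure_unit_disc emeasure_uniform_measure vimage_def)
      also have "\<dots> = emeasure lborel ({0..1} \<inter> {..x})"
      proof -
        consider "x < 0" | "0 \<le> x" "x < 1" | "1 \<le> x" by linarith
        then show ?thesis
        proof cases
          case 1
          then have "\<not> (norm z)\<^sup>2 \<le> x" for z :: complex using zero_le_power2[of "norm z"] by linarith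
          moreover have "{0..1} \<inter> {..x} = {}" using 1 by auto
          ultimately have "{z::complex. (norm z)\<^sup>2 \<le> x} = {}" "{0..1} \<inter> {..x} = {}" by auto
          then show ?thesis by simp
        next
          case 2
          have sq: "(norm z)\<^sup>2 \<le> x \<longleftrightarrow> norm z \<le> sqrt x" for z :: complex
          proof
            show "(norm z)\<^sup>2 \<le> x \<Longrightarrow> norm z \<le> sqrt x" by (rule real_le_rsqrt)
            show "norm z \<le> sqrt x \<Longrightarrow> (norm z)\<^sup>2 \<le> x"
              using 2 power_mono[of "norm z" "sqrt x" 2] by simp
          qed
          have "sqrt x < 1" using 2 by simp
          then have "norm z < 1 \<and> (norm z)\<^sup>2 \<le> x \<longleftrightarrow> norm z \<le> sqrt x" for z :: complex
            using sq[of z] by linarith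
          then have "ball (0::complex) 1 \<inter> {z. (norm z)\<^sup>2 \<le> x} = cball 0 (sqrt x)"
            by (simp only: set_eq_iff Int_iff mem_ball mem_cball mem_Collect_eq dist_0_norm) simp
          moreover have "{0..1} \<inter> {..x} = {0..x}" using 2 by auto
          ultimately show ?thesis
            using 2 by (simp add: emeasure_cball unit_ball_vol_2 divide_ennreal)
        next
          case 3
          have "(norm z)\<^sup>2 \<le> x" if "norm z < 1" for z :: complex
            using 3 power_le_one[of "norm z" 2] less_imp_le[OF that] by simp
          then have "ball (0::complex) 1 \<inter> {z. (norm z)\<^sup>2 \<le> x} = ball 0 1" "{0..1} \<inter> {..x} = {0..1}"
            using 3 by (auto simp: dist_norm)
          then show ?thesis by (simp add: emeasure_unit_disc)
        qed
      qed
      also have "\<dots> = emeasure (uniform_measure lborel {0..1}) {..x}"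
        by (subst emeasure_uniform_measure) (simp_all add: divide_ennreal_def)
      finally show "cdf (distr (uniform_measure lborel (ball (0::complex) 1)) borel (\<lambda>z. (norm z)\<^sup>2)) x = cdf (uniform_measure lborel {0..1}) x"
        by (simp add: cdf_def measure_def)
    qed
  qed
qed

lemma disc_measure_moment:
  assumes b: "\<beta> > -1"
  shows "(\<integral>\<^sup>+z. ennreal ((norm z) ^ (2 * k)) \<partial>disc_measure \<beta>) = ennreal (bergman_weight1 \<beta> k)"
proof -
  define h where "h u = ennreal ((\<beta> + 1) * (1 - u) powr \<beta>) * ennreal (u ^ k)" for u :: real
  have [measurable]: "h \<in> borel_measurable borel" by (simp add: h_def[abs_def])
  have "(\<integral>\<^sup>+z. ennreal ((norm z) ^ (2 * k)) \<partial>disc_measure \<beta>) =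
     (\<integral>\<^sup>+z. h ((norm z)\<^sup>2) \<partial>uniform_measure lborel (ball (0::complex) 1))"
    unfolding disc_measure_def h_def by (subst nn_integral_density) (auto simp: power_mult[symmetric])
  also have "\<dots> = (\<integral>\<^sup>+u. h u \<partial>distr (uniform_measure lborel (ball (0::complex) 1)) borel (\<lambda>z. (norm z)\<^sup>2))"
    by (subst nn_integral_distr) auto
  also have "\<dots> = (\<integral>\<^sup>+u. h u * indicator {0..1} u \<partial>lborel)"
    unfolding uniform_unit_disc_norm_sq by (subst nn_integral_uniform_measure) (auto simp: divide_ennreal_def)
  also have "\<dots> = (\<integral>\<^sup>+u. ennreal (\<beta> + 1) * ennreal (indicator {0..1} u * (u powr (real k + 1 - 1) * (1 - u) powr (\<beta> + 1 - 1))) \<partial>lborel)"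
  proof (rule nn_integral_cong_AE)
    \<comment> \<open>The point 0 is excluded because for \<open>k = 0\<close> the integrands differ
      there: \<open>0 ^ 0 = 1\<close>, but \<open>0 powr 0 = 0\<close>.\<close>
    have "AE u in lborel. u \<noteq> (0::real)" by (simp add: AE_lborel_singleton)
    then show "AE u in lborel. h u * indicator {0..1} u = ennreal (\<beta> + 1) * ennreal (indicator {0..1} u * (u powr (real k + 1 - 1) * (1 - u) powr (\<beta> + 1 - 1)))"
    proof eventually_elim
      case (elim u)
      show ?case
        using b elim by (auto simp: h_def indicator_def powr_realpow ennreal_mult' mult_ac)
    qed
  qed
  also have "\<dots> = ennreal (\<beta> + 1) * ennreal (Beta (real k + 1) (\<beta> + 1))"
    using has_integral_Beta_real[of "real k + 1" "\<beta> + 1"] b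
    by (subst nn_integral_cmult, simp, subst nn_integral_has_integral_lebesgue[where I = "Beta (real k + 1) (\<beta> + 1)"]) auto
  also have "\<dots> = ennreal (bergman_weight1 \<beta> k)"
  proof -
    have G1: "Gamma (\<beta> + 2) = (\<beta> + 1) * Gamma (\<beta> + 1)"
      using Gamma_plus1[of "\<beta> + 1"] b by (simp add: add.assoc nonpos_Ints_def)
    have "\<beta> + 2 \<notin> \<int>\<^sub>\<le>\<^sub>0" using b by (auto simp: nonpos_Ints_def)
    then have G2: "pochhammer (\<beta> + 2) k = Gamma (\<beta> + 2 + real k) / Gamma (\<beta> + 2)"
      by (rule pochhammer_Gamma)
    have "Gamma (real k + 1) = fact k" using Gamma_fact[of k, where 'a=real] by (simp add: add.commute)
    then have "(\<beta> + 1) * Beta (real k + 1) (\<beta> + 1) = bergman_weight1 \<beta> k"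
      by (simp add: Beta_def bergman_weight1_def G2 G1 add_ac)
    then show ?thesis using b by (simp add: ennreal_mult'[symmetric])
  qed
  finally show ?thesis .
qed

lemma prob_space_disc_measure:
  assumes "\<beta> > -1"
  shows "prob_space (disc_measure \<beta>)"
proof
  show "emeasure (disc_measure \<beta>) (space (disc_measure \<beta>)) = 1"
    using disc_measure_moment[OF assms, of 0] by (simp add: bergman_weight1_def)
qed

text \<open>The rotation by the angle pi / (j - k) preserves the measure and the ball and multiplies
  the integrand by -1, so the integral equals its own negative.\<close>

lemma disc_measure_orthogonal:
  assumes b: "\<beta> > -1" and "j \<noteq> k"
  shows "(\<integral>z. indicator (ball 0 \<rho>) z *\<^sub>R (z ^ j * cnj z ^ k) \<partial>disc_measure \<beta>) = 0"
proof -
  define n where "n = real j - real k"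
  have n: "n \<noteq> 0" using assms by (simp add: n_def)
  define u where "u = cis (pi / n)"
  have u: "norm u = 1" by (simp add: u_def)
  have "u ^ j * cnj u ^ k = cis (real j * (pi / n)) * cis (- (real k * (pi / n)))"
    by (simp only: u_def cis_cnj Complex.DeMoivre) simp
  also have "\<dots> = cis (n * (pi / n))" by (simp add: cis_mult n_def left_diff_distrib del: times_divide_eq_right)
  finally have uu: "u ^ j * cnj u ^ k = -1" using n by simp
  let ?I = "\<integral>z. indicator (ball 0 \<rho>) z *\<^sub>R (z ^ j * cnj z ^ k) \<partial>disc_measure \<beta>"
  have "?I = (\<integral>z. indicator (ball 0 \<rho>) z *\<^sub>R (z ^ j * cnj z ^ k) \<partial>distr (disc_measure \<beta>) borel ((*) u))"
    by (simp add: disc_measure_rotate[OF u])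
  also have "\<dots> = (\<integral>z. indicator (ball 0 \<rho>) (u * z) *\<^sub>R ((u * z) ^ j * cnj (u * z) ^ k) \<partial>disc_measure \<beta>)"
  proof (rule integral_distr)
    show "(\<lambda>z. indicat_real (ball 0 \<rho>) z *\<^sub>R (z ^ j * cnj z ^ k)) \<in> borel_measurable borel"
      by (intro borel_measurable_scaleR borel_measurable_indicator borel_measurable_continuous_onI continuous_intros) simp
  qed simp
  also have "\<dots> = (\<integral>z. (u ^ j * cnj u ^ k) * (indicator (ball 0 \<rho>) z *\<^sub>R (z ^ j * cnj z ^ k)) \<partial>disc_measure \<beta>)"
    using u by (intro Bochner_Integration.integral_cong refl)
       (auto simp: power_mult_distrib norm_mult indicator_def)
  also have "\<dots> = - ?I" by (simp add: uu)
  finally show ?thesis by simp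
qed

section \<open>Monomials in several variables and Parseval's identity for product measures\<close>

definition mpow :: "complex ^ 'd::finite \<Rightarrow> 'd multiindex \<Rightarrow> complex" where
  "mpow z \<alpha> = (\<Prod>i\<in>UNIV. (z $ i) ^ \<alpha> i)"

lemma norm_mpow: "norm (mpow z \<alpha>) = (\<Prod>i\<in>UNIV. norm (z $ i) ^ \<alpha> i)"
  by (simp add: mpow_def prod_norm[symmetric] norm_power)

lemma norm_mpow_le:
  fixes z :: "complex ^ 'd::finite"
  assumes "\<And>i. norm (z $ i) \<le> \<rho>"
  shows "norm (mpow z \<alpha>) \<le> (\<Prod>i\<in>UNIV. \<rho> ^ \<alpha> i)"
  unfolding norm_mpow using assms by (intro prod_mono) (auto intro: power_mono)

text \<open>This is \<rho> to the power |\<alpha>|; the product form matches \<open>mpow\<close>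
  factor by factor.\<close>

definition rpow :: "real \<Rightarrow> 'd::finite multiindex \<Rightarrow> real" where
  "rpow \<rho> \<alpha> = (\<Prod>i\<in>UNIV. \<rho> ^ \<alpha> i)"

lemma rpow_nonneg [simp]: "\<rho> \<ge> 0 \<Longrightarrow> rpow \<rho> \<alpha> \<ge> 0"
  by (simp add: rpow_def prod_nonneg)

text \<open>The expanded square consists of integrals that factor over the coordinates, and for
  \<alpha> \<noteq> \<alpha>' one factor vanishes by orthogonality. Boundedness of \<open>B\<close>
  makes all terms integrable. \<open>B\<close> will be the unit circle for the Hardy norm and a
  smaller disc for the Bergman norms.\<close>

lemma integral_sq_norm_sum:
  fixes c :: "'d::finite multiindex \<Rightarrow> complex"
  assumes \<mu>: "prob_space \<mu>" "sets \<mu> = sets borel" and B: "B \<in> sets borel" "B \<subseteq> cball 0 \<rho>"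
    and orth: "\<And>j k. j \<noteq> k \<Longrightarrow> (\<integral>z. indicator B z *\<^sub>R (z ^ j * cnj z ^ k) \<partial>\<mu>) = 0"
    and S: "finite S"
  defines "m \<equiv> \<lambda>k. \<integral>z. indicator B z * norm z ^ (2 * k) \<partial>\<mu>"
  defines "g \<equiv> \<lambda>x. \<Sum>\<alpha>\<in>S. c \<alpha> * (\<Prod>i\<in>UNIV. indicator B (x i) *\<^sub>R x i ^ \<alpha> i)"
  shows "(\<integral>\<^sup>+x. ennreal ((norm (g x))\<^sup>2) \<partial>(\<Pi>\<^sub>M i\<in>(UNIV::'d set). \<mu>))
     = ennreal (\<Sum>\<alpha>\<in>S. (\<Prod>i\<in>UNIV. m (\<alpha> i)) * (norm (c \<alpha>))\<^sup>2)"
    and "g \<in> borel_measurable (\<Pi>\<^sub>M i\<in>(UNIV::'d set). \<mu>)"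
proof -
  interpret \<mu>: prob_space \<mu> by (rule \<mu>)
  interpret P: product_prob_space "\<lambda>_::'d. \<mu>" UNIV by unfold_locales
  let ?P = "\<Pi>\<^sub>M i\<in>(UNIV::'d set). \<mu>"
  define h where "h j k z = indicator B z *\<^sub>R (z ^ j * cnj z ^ k)" for j k and z :: complex
  have hm: "h j k \<in> borel_measurable \<mu>" for j k
    unfolding h_def measurable_cong_sets[OF \<mu>(2) refl] using B
    by (intro borel_measurable_scaleR borel_measurable_indicator borel_measurable_continuous_onI continuous_intros)
  have hb: "norm (h j k z) \<le> \<bar>\<rho>\<bar> ^ (j + k)" for j k z
  proof (cases "z \<in> B")
    case True
    then have "norm z \<le> \<bar>\<rho>\<bar>" using B by force
    then have "norm z ^ (j + k) \<le> \<bar>\<rho>\<bar> ^ (j + k)" by (intro power_mono) auto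
    then show ?thesis using True by (simp add: h_def norm_mult norm_power power_add)
  qed (simp add: h_def)
  have hi: "integrable \<mu> (h j k)" for j k
    using hb hm by (intro \<mu>.integrable_const_bound[where B = "\<bar>\<rho>\<bar> ^ (j + k)"]) auto
  have hval: "integral\<^sup>L \<mu> (h j k) = (if j = k then of_real (m k) else 0)" for j k
  proof (cases "j = k")
    case True
    have hk: "h k k = (\<lambda>z. complex_of_real (indicator B z * norm z ^ (2 * k)))"
      by (rule ext) (simp add: h_def complex_norm_square[symmetric] power_mult_distrib[symmetric] power_mult scaleR_conv_of_real)
    have "integral\<^sup>L \<mu> (h k k) = of_real (m k)"
      unfolding m_def hk by (rule integral_complex_of_real)
    then show ?thesis using True by simp
  qed (simp add: h_def[abs_def] orth)
  have Hi: "integrable ?P (\<lambda>x. \<Prod>i\<in>UNIV. h (\<alpha> i) (\<alpha>' i) (x i))" for \<alpha> \<alpha>' :: "'d multiindex"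
    by (rule P.product_integrable_prod) (auto simp: hi)
  have sqr: "of_real ((norm (g x))\<^sup>2) = (\<Sum>\<alpha>\<in>S. \<Sum>\<alpha>'\<in>S. c \<alpha> * cnj (c \<alpha>') * (\<Prod>i\<in>UNIV. h (\<alpha> i) (\<alpha>' i) (x i)))" for x
  proof -
    have "(\<Prod>i\<in>UNIV. indicator B (x i) *\<^sub>R x i ^ \<alpha> i) * cnj (\<Prod>i\<in>UNIV. indicator B (x i) *\<^sub>R x i ^ \<alpha>' i)
       = (\<Prod>i\<in>UNIV. h (\<alpha> i) (\<alpha>' i) (x i))" for \<alpha> \<alpha>' :: "'d multiindex"
      unfolding cnj_prod prod.distrib[symmetric]
      by (intro prod.cong refl) (auto simp: h_def indicator_def)
    then show ?thesis
      by (simp only: complex_norm_square g_def cnj_sum sum_product complex_cnj_mult) (simp add: mult_ac)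
  qed
  show gm: "g \<in> borel_measurable ?P"
  proof -
    have 1: "(\<lambda>z. indicator B z *\<^sub>R z ^ k) \<in> borel_measurable \<mu>" for k
      unfolding measurable_cong_sets[OF \<mu>(2) refl] using B
      by (intro borel_measurable_scaleR borel_measurable_indicator borel_measurable_continuous_onI continuous_intros)
    have "(\<lambda>x. indicator B (x i) *\<^sub>R x i ^ k) \<in> borel_measurable ?P" for i k
      by (rule measurable_compose[OF measurable_component_singleton[OF UNIV_I, where M = "\<lambda>_. \<mu>"] 1])
    then show ?thesis unfolding g_def
      by (intro borel_measurable_sum borel_measurable_times borel_measurable_prod borel_measurable_const)
  qed
  have gi: "integrable ?P (\<lambda>x. complex_of_real ((norm (g x))\<^sup>2))"
    unfolding sqr using Hi by (intro Bochner_Integration.integrable_sum integrable_mult_right)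
  have gi': "integrable ?P (\<lambda>x. (norm (g x))\<^sup>2)"
    using integrable_Re[OF gi] by (simp only: Re_complex_of_real)
  have "complex_of_real (\<integral>x. (norm (g x))\<^sup>2 \<partial>?P) = (\<integral>x. complex_of_real ((norm (g x))\<^sup>2) \<partial>?P)"
    by (rule integral_complex_of_real[symmetric])
  also have "\<dots> = (\<Sum>\<alpha>\<in>S. \<Sum>\<alpha>'\<in>S. c \<alpha> * cnj (c \<alpha>') * (\<Prod>i\<in>UNIV. integral\<^sup>L \<mu> (h (\<alpha> i) (\<alpha>' i))))"
  proof -
    have "(\<integral>x. (\<Prod>i\<in>UNIV. h (\<alpha> i) (\<alpha>' i) (x i)) \<partial>?P) = (\<Prod>i\<in>UNIV. integral\<^sup>L \<mu> (h (\<alpha> i) (\<alpha>' i)))"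
      for \<alpha> \<alpha>' :: "'d multiindex"
      by (rule P.product_integral_prod) (auto simp: hi)
    then show ?thesis unfolding sqr using Hi by (simp add: integrable_mult_right)
  qed
  also have "\<dots> = (\<Sum>\<alpha>\<in>S. \<Sum>\<alpha>'\<in>S. if \<alpha> = \<alpha>' then of_real ((\<Prod>i\<in>UNIV. m (\<alpha> i)) * (norm (c \<alpha>))\<^sup>2) else 0)"
  proof (intro sum.cong refl)
    fix \<alpha> \<alpha>' :: "'d multiindex"
    show "c \<alpha> * cnj (c \<alpha>') * (\<Prod>i\<in>UNIV. integral\<^sup>L \<mu> (h (\<alpha> i) (\<alpha>' i)))
       = (if \<alpha> = \<alpha>' then of_real ((\<Prod>i\<in>UNIV. m (\<alpha> i)) * (norm (c \<alpha>))\<^sup>2) else 0)"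
    proof (cases "\<alpha> = \<alpha>'")
      case True
      then show ?thesis by (simp add: hval complex_norm_square mult_ac del: of_real_power)
    next
      case False
      then obtain i where "\<alpha> i \<noteq> \<alpha>' i" by auto
      then have "(\<Prod>i\<in>UNIV. integral\<^sup>L \<mu> (h (\<alpha> i) (\<alpha>' i))) = 0"
        by (intro prod_zero) (auto simp: hval)
      then show ?thesis using False by simp
    qed
  qed
  also have "\<dots> = of_real (\<Sum>\<alpha>\<in>S. (\<Prod>i\<in>UNIV. m (\<alpha> i)) * (norm (c \<alpha>))\<^sup>2)"
    using S by simp
  finally have "(\<integral>x. (norm (g x))\<^sup>2 \<partial>?P) = (\<Sum>\<alpha>\<in>S. (\<Prod>i\<in>UNIV. m (\<alpha> i)) * (norm (c \<alpha>))\<^sup>2)"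
    by (simp only: of_real_eq_iff)
  then show "(\<integral>\<^sup>+x. ennreal ((norm (g x))\<^sup>2) \<partial>?P) = ennreal (\<Sum>\<alpha>\<in>S. (\<Prod>i\<in>UNIV. m (\<alpha> i)) * (norm (c \<alpha>))\<^sup>2)"
    by (subst nn_integral_eq_integral[OF gi']) auto
qed

text \<open>Cube sums satisfy the identity by orthogonality. On the left the limit is taken by
  dominated convergence, with the absolutely convergent series at radius \<rho> as a bound; on the
  right the sums increase.\<close>

lemma Parseval_product_measure:
  fixes c :: "'d::finite multiindex \<Rightarrow> complex" and f :: "complex ^ 'd \<Rightarrow> complex"
  assumes \<mu>: "prob_space \<mu>" "sets \<mu> = sets borel" and B: "B \<in> sets borel" "B \<subseteq> cball 0 \<rho>"
    and \<rho>: "\<rho> \<ge> 0"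
    and orth: "\<And>j k. j \<noteq> k \<Longrightarrow> (\<integral>z. indicator B z *\<^sub>R (z ^ j * cnj z ^ k) \<partial>\<mu>) = 0"
    and f: "\<And>z. (\<And>i. z $ i \<in> B) \<Longrightarrow> ((\<lambda>\<alpha>. c \<alpha> * mpow z \<alpha>) has_sum f z) UNIV"
    and sm: "(\<lambda>\<alpha>. norm (c \<alpha>) * rpow \<rho> \<alpha>) summable_on UNIV"
  defines "m \<equiv> \<lambda>k. \<integral>z. indicator B z * norm z ^ (2 * k) \<partial>\<mu>"
  shows "(\<integral>\<^sup>+z. ennreal ((norm (f z))\<^sup>2) * indicator {z. \<forall>i. z $ i \<in> B} z \<partial>product_measure \<mu>)
     = (\<integral>\<^sup>+\<alpha>. ennreal ((\<Prod>i\<in>UNIV. m (\<alpha> i)) * (norm (c \<alpha>))\<^sup>2) \<partial>count_space UNIV)"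
proof -
  interpret \<mu>: prob_space \<mu> by (rule \<mu>)
  interpret P: product_prob_space "\<lambda>_::'d. \<mu>" UNIV by unfold_locales
  let ?P = "\<Pi>\<^sub>M i\<in>(UNIV::'d set). \<mu>"
  let ?Q = "{z :: complex ^ 'd. \<forall>i. z $ i \<in> B}"
  define g where "g N x = (\<Sum>\<alpha>\<in>box_index N. c \<alpha> * (\<Prod>i\<in>UNIV. indicator B (x i) *\<^sub>R x i ^ \<alpha> i))"
    for N and x :: "'d \<Rightarrow> complex"
  define F where "F z = indicator ?Q z *\<^sub>R f z" for z
  have ind: "(\<Prod>i\<in>UNIV. indicator B (x i) *\<^sub>R x i ^ \<alpha> i) = indicator ?Q (vec_lambda x) *\<^sub>R mpow (vec_lambda x) \<alpha>"
    for x :: "'d \<Rightarrow> complex" and \<alpha>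
  proof (cases "vec_lambda x \<in> ?Q")
    case False
    then obtain i where "x i \<notin> B" by auto
    then have "(\<Prod>i\<in>UNIV. indicator B (x i) *\<^sub>R x i ^ \<alpha> i) = 0"
      by (intro prod_zero bexI[of _ i]) auto
    then show ?thesis using False by simp
  qed (simp add: mpow_def)
  have lim: "(\<lambda>N. g N x) \<longlonglongrightarrow> F (vec_lambda x)" for x
  proof (cases "vec_lambda x \<in> ?Q")
    case True
    then have "((\<lambda>\<alpha>. c \<alpha> * mpow (vec_lambda x) \<alpha>) has_sum f (vec_lambda x)) UNIV"
      by (intro f) auto
    from has_sum_imp_box_index[OF this] show ?thesis
      using True by (simp add: g_def ind F_def del: mem_Collect_eq)
  qed (simp add: g_def ind F_def)
  have gm: "g N \<in> borel_measurable ?P" for N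
    unfolding g_def by (rule integral_sq_norm_sum(2)[OF \<mu> B orth]) auto
  have gint: "(\<integral>\<^sup>+x. ennreal ((norm (g N x))\<^sup>2) \<partial>?P)
     = ennreal (\<Sum>\<alpha>\<in>box_index N. (\<Prod>i\<in>UNIV. m (\<alpha> i)) * (norm (c \<alpha>))\<^sup>2)" for N
    unfolding g_def m_def by (rule integral_sq_norm_sum(1)[OF \<mu> B orth]) auto
  define K where "K = (\<Sum>\<^sub>\<infinity>\<alpha>. norm (c \<alpha>) * rpow \<rho> \<alpha>)"
  have gb: "norm (g N x) \<le> K" for N x
  proof (cases "vec_lambda x \<in> ?Q")
    case True
    then have xr: "norm (x i) \<le> \<rho>" for i using B by force
    have "norm (g N x) \<le> (\<Sum>\<alpha>\<in>box_index N. norm (c \<alpha>) * rpow \<rho> \<alpha>)"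
      unfolding g_def
    proof (intro sum_norm_le)
      fix \<alpha> show "norm (c \<alpha> * (\<Prod>i\<in>UNIV. indicator B (x i) *\<^sub>R x i ^ \<alpha> i)) \<le> norm (c \<alpha>) * rpow \<rho> \<alpha>"
        unfolding ind using True xr
        by (simp add: norm_mult rpow_def mult_left_mono norm_mpow_le)
    qed
    also have "\<dots> \<le> K"
      unfolding K_def using sm \<rho> by (intro finite_sum_le_infsum) auto
    finally show ?thesis .
  next
    case False
    have "K \<ge> 0" unfolding K_def using \<rho> by (intro infsum_nonneg) auto
    then show ?thesis using False by (simp add: g_def ind)
  qed
  \<comment> \<open>Nothing is known about \<open>f\<close> off the set, so measurability is shown
    for its cut-off \<open>F\<close>, which is a pointwise limit of cut-off polynomials.\<close>
  have Fm: "F \<in> borel_measurable borel"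
  proof (rule borel_measurable_LIMSEQ_metric)
    fix N show "(\<lambda>z. g N (vec_nth z)) \<in> borel_measurable borel"
      unfolding g_def
    proof (intro borel_measurable_sum borel_measurable_times borel_measurable_prod borel_measurable_const)
      fix \<alpha> i
      have 1: "(\<lambda>z. indicator B z *\<^sub>R z ^ \<alpha> i) \<in> borel_measurable borel" for \<alpha> :: "'d multiindex" and i
        using B by (intro borel_measurable_scaleR borel_measurable_indicator borel_measurable_continuous_onI continuous_intros)
      have "(\<lambda>z::complex^'d. z $ i) \<in> borel_measurable borel"
        by (intro borel_measurable_continuous_onI continuous_intros)
      from measurable_compose[OF this 1]
      show "(\<lambda>z::complex^'d. indicat_real B (z $ i) *\<^sub>R (z $ i) ^ \<alpha> i) \<in> borel_measurable borel" .
    qed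
  next
    fix z :: "complex ^ 'd" show "(\<lambda>N. g N (vec_nth z)) \<longlonglongrightarrow> F z"
      using lim[of "vec_nth z"] by simp
  qed
  have "(\<integral>\<^sup>+z. ennreal ((norm (f z))\<^sup>2) * indicator ?Q z \<partial>product_measure \<mu>)
     = (\<integral>\<^sup>+z. ennreal ((norm (F z))\<^sup>2) \<partial>product_measure \<mu>)"
    by (intro nn_integral_cong) (auto simp: F_def indicator_def)
  also have "\<dots> = (\<integral>\<^sup>+x. ennreal ((norm (F (vec_lambda x)))\<^sup>2) \<partial>?P)"
    unfolding product_measure_def using Fm
    by (intro nn_integral_distr measurable_vec_lambda_PiM \<mu>(2)) measurable
  finally have L: "(\<integral>\<^sup>+z. ennreal ((norm (f z))\<^sup>2) * indicator ?Q z \<partial>product_measure \<mu>)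
    = (\<integral>\<^sup>+x. ennreal ((norm (F (vec_lambda x)))\<^sup>2) \<partial>?P)" .
  have Fm': "(\<lambda>x. F (vec_lambda x)) \<in> borel_measurable ?P"
    by (rule measurable_compose[OF measurable_vec_lambda_PiM[OF \<mu>(2)] Fm])
  have "(\<lambda>N. \<integral>\<^sup>+x. ennreal ((norm (g N x))\<^sup>2) \<partial>?P) \<longlonglongrightarrow> (\<integral>\<^sup>+x. ennreal ((norm (F (vec_lambda x)))\<^sup>2) \<partial>?P)"
  proof (rule nn_integral_dominated_convergence[where w = "\<lambda>_. ennreal (K\<^sup>2)"])
    show "AE x in ?P. (\<lambda>N. ennreal ((norm (g N x))\<^sup>2)) \<longlonglongrightarrow> ennreal ((norm (F (vec_lambda x)))\<^sup>2)"
      by (intro AE_I2 tendsto_intros lim)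
    show "AE x in ?P. ennreal ((norm (g N x))\<^sup>2) \<le> ennreal (K\<^sup>2)" for N
      by (intro AE_I2 ennreal_leI power_mono gb) auto
    show "(\<integral>\<^sup>+x. ennreal (K\<^sup>2) \<partial>?P) < \<infinity>"
      by (simp add: P.emeasure_space_1)
    show "(\<lambda>x. ennreal ((norm (g N x))\<^sup>2)) \<in> borel_measurable ?P" for N using gm[of N] by measurable
    show "(\<lambda>x. ennreal ((norm (F (vec_lambda x)))\<^sup>2)) \<in> borel_measurable ?P" using Fm' by measurable
  qed simp
  moreover have "(\<lambda>N. \<integral>\<^sup>+x. ennreal ((norm (g N x))\<^sup>2) \<partial>?P) \<longlonglongrightarrow>
     (\<integral>\<^sup>+\<alpha>. ennreal ((\<Prod>i\<in>UNIV. m (\<alpha> i)) * (norm (c \<alpha>))\<^sup>2) \<partial>count_space UNIV)"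
  proof -
    have m0: "m k \<ge> 0" for k by (simp add: m_def)
    have "ennreal (\<Sum>\<alpha>\<in>box_index N. (\<Prod>i\<in>UNIV. m (\<alpha> i)) * (norm (c \<alpha>))\<^sup>2)
       = (\<Sum>\<alpha>\<in>box_index N. ennreal ((\<Prod>i\<in>UNIV. m (\<alpha> i)) * (norm (c \<alpha>))\<^sup>2))" for N
      using m0 by (simp add: sum_ennreal prod_nonneg)
    then show ?thesis unfolding gint nn_integral_box_index
      by (simp only:) (intro LIMSEQ_SUP incseq_SucI sum_mono2; simp add: box_index_mono)
  qed
  ultimately show ?thesis unfolding L by (rule LIMSEQ_unique)
qed

section \<open>Taylor coefficients and weighted coefficient norms\<close>

lemma torus_altdef: "torus = {z. \<forall>i. z $ i \<in> sphere 0 1}"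
  by (simp add: torus_def)

text \<open>A relation rather than a function of \<open>f\<close>, so that the coefficients of sums,
  products and polynomials can be exhibited directly; uniqueness follows later from Parseval's
  identity.\<close>

definition has_coeffs :: "(complex ^ 'd::finite \<Rightarrow> complex) \<Rightarrow> ('d multiindex \<Rightarrow> complex) \<Rightarrow> bool" where
  "has_coeffs f c \<longleftrightarrow> (\<forall>z\<in>polydisc. ((\<lambda>\<alpha>. c \<alpha> * mpow z \<alpha>) has_sum f z) UNIV)"

text \<open>Despite its name this is the square of a norm; the value infinity marks the sequences
  outside the weighted space.\<close>

definition coeff_norm :: "('d::finite multiindex \<Rightarrow> real) \<Rightarrow> ('d multiindex \<Rightarrow> complex) \<Rightarrow> ennreal" where
  "coeff_norm w c = (\<integral>\<^sup>+\<alpha>. ennreal (w \<alpha> * (norm (c \<alpha>))\<^sup>2) \<partial>count_space UNIV)"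

lemma rpow_mono: "0 \<le> r \<Longrightarrow> r \<le> s \<Longrightarrow> rpow r \<alpha> \<le> rpow s \<alpha>"
  unfolding rpow_def by (intro prod_mono) (auto intro: power_mono)

lemma rpow_1 [simp]: "rpow 1 \<alpha> = 1"
  by (simp add: rpow_def)

lemma mpow_scaleR: "mpow (r *\<^sub>R z) \<alpha> = of_real (rpow r \<alpha>) * mpow z \<alpha>"
  unfolding mpow_def rpow_def vector_scaleR_component
  by (simp add: scaleR_conv_of_real power_mult_distrib prod.distrib)

lemma norm_polydisc_obtain_radius:
  fixes z :: "complex ^ 'd::finite"
  assumes "z \<in> polydisc"
  obtains \<rho> where "0 < \<rho>" "\<rho> < 1" "\<And>i. norm (z $ i) < \<rho>"
proof -
  define x where "x = Max (range (\<lambda>i. norm (z $ i)))"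
  have x1: "x < 1" using assms by (simp add: x_def polydisc_def)
  have xi: "norm (z $ i) \<le> x" for i by (simp add: x_def)
  have "0 \<le> x" using norm_ge_zero xi order_trans by blast
  moreover have "norm (z $ i) < (x + 1) / 2" for i using xi[of i] x1 by (simp add: field_simps)
  ultimately show ?thesis
    using x1 by (intro that[of "(x + 1) / 2"]) auto
qed

lemma open_polydisc_radius: "open {z :: complex ^ 'd::finite. \<forall>i. norm (z $ i) < \<rho>}"
proof -
  have "{z :: complex ^ 'd. \<forall>i. norm (z $ i) < \<rho>} = (\<Inter>i. (\<lambda>z. z $ i) -` ball 0 \<rho>)" by auto
  then show ?thesis by (auto intro!: open_INT open_vimage continuous_intros)
qed

lemma open_polydisc: "open (polydisc :: (complex ^ 'd::finite) set)"
  using open_polydisc_radius[of 1] by (simp add: polydisc_def)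

lemma holomorphic_polydisc_continuous: "holomorphic_polydisc f \<Longrightarrow> continuous_on polydisc f"
  unfolding holomorphic_polydisc_def continuous_on_eq_continuous_within
  by (meson continuous_at_imp_continuous_at_within has_derivative_continuous)

text \<open>Evaluation at the point with all coordinates \<rho>, where unconditional convergence of
  complex terms means absolute convergence.\<close>

lemma has_coeffs_summable:
  assumes "has_coeffs f c" "0 \<le> \<rho>" "\<rho> < 1"
  shows "(\<lambda>\<alpha>. norm (c \<alpha>) * rpow \<rho> \<alpha>) summable_on UNIV"
proof -
  define z :: "complex ^ 'a" where "z = (\<chi> i. of_real \<rho>)"
  have "z \<in> polydisc" using assms by (simp add: z_def polydisc_def)
  then have "(\<lambda>\<alpha>. c \<alpha> * mpow z \<alpha>) summable_on UNIV"
    using assms by (auto simp: has_coeffs_def summable_on_def)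
  then have "(\<lambda>\<alpha>. norm (c \<alpha> * mpow z \<alpha>)) summable_on UNIV"
    by (simp add: summable_on_iff_abs_summable_on_complex)
  then show ?thesis
    using assms by (simp add: norm_mult norm_mpow z_def rpow_def)
qed

section \<open>The circle measure and the Hardy norm\<close>

lemma integral_uniform_Icc:
  fixes f :: "real \<Rightarrow> complex"
  assumes f: "f \<in> borel_measurable borel"
  shows "(\<integral>t. f t \<partial>uniform_measure lborel {0..2 * pi})
     = (1 / (2 * pi)) *\<^sub>R (\<integral>t. indicator {0..2 * pi} t *\<^sub>R f t \<partial>lborel)"
proof -
  have "(indicator {0..2 * pi} t :: ennreal) / emeasure lborel {0..2 * pi} = ennreal (indicator {0..2 * pi} t / (2 * pi))" for t
    by (auto simp: indicator_def divide_ennreal[symmetric] ennreal_1[symmetric] simp del: ennreal_1)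
  then have eq: "uniform_measure lborel {0..2 * pi} = density lborel (\<lambda>t. ennreal (indicator {0..2 * pi} t / (2 * pi)))"
    by (simp add: uniform_measure_def)
  have "(\<integral>t. f t \<partial>uniform_measure lborel {0..2 * pi}) = (\<integral>t. (indicator {0..2 * pi} t / (2 * pi)) *\<^sub>R f t \<partial>lborel)"
    unfolding eq using f by (intro integral_density) auto
  also have "\<dots> = (\<integral>t. (1 / (2 * pi)) *\<^sub>R (indicator {0..2 * pi} t *\<^sub>R f t) \<partial>lborel)"
    by (intro Bochner_Integration.integral_cong) auto
  also have "\<dots> = (1 / (2 * pi)) *\<^sub>R (\<integral>t. indicator {0..2 * pi} t *\<^sub>R f t \<partial>lborel)"
    by (rule integral_scaleR_right)
  finally show ?thesis .
qed

lemma prob_space_uniform_Icc: "prob_space (uniform_measure lborel {0..2 * pi})"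
  by (rule prob_space_uniform_measure) auto

lemma integral_cis_uniform:
  assumes "n \<noteq> (0::int)"
  shows "(\<integral>t. cis (of_int n * t) \<partial>uniform_measure lborel {0..2 * pi}) = 0"
proof -
  have "(\<integral>t. indicator {0..2 * pi} t *\<^sub>R cis (of_int n * t) \<partial>lborel)
    = cis (of_int n * (2 * pi)) / (\<i> * of_int n) - cis (of_int n * 0) / (\<i> * of_int n)"
  proof (rule integral_FTC_atLeastAtMost)
    fix t :: real
    show "((\<lambda>t. cis (of_int n * t) / (\<i> * of_int n)) has_vector_derivative cis (of_int n * t)) (at t within {0..2 * pi})"
    proof -
      have "((\<lambda>w. exp (\<i> * of_int n * w) / (\<i> * of_int n)) has_field_derivative exp (\<i> * of_int n * of_real t)) (at (of_real t))"
        using assms by (auto intro!: derivative_eq_intros)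
      from has_vector_derivative_real_field[OF this] show ?thesis
        by (simp add: cis_conv_exp mult.assoc)
    qed
  qed (auto intro!: continuous_intros)
  also have "cis (of_int n * (2 * pi)) = 1"
    using cis_multiple_2pi[of "of_int n"] by (simp add: mult_ac)
  finally show ?thesis
    by (subst integral_uniform_Icc) (auto intro!: borel_measurable_continuous_onI continuous_intros)
qed

lemma sets_circle_measure [simp, measurable_cong]: "sets circle_measure = sets borel"
  by (simp add: circle_measure_def)

lemma cis_measurable [measurable]: "cis \<in> borel_measurable borel"
  by (auto intro!: borel_measurable_continuous_onI continuous_intros)

lemma prob_space_circle_measure: "prob_space circle_measure"
  unfolding circle_measure_def by (rule prob_space.prob_space_distr[OF prob_space_uniform_Icc]) simp

lemma integral_circle_measure:
  fixes f :: "complex \<Rightarrow> 'b::{banach,second_countable_topology}"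
  assumes "f \<in> borel_measurable borel"
  shows "(\<integral>z. f z \<partial>circle_measure) = (\<integral>t. f (cis t) \<partial>uniform_measure lborel {0..2 * pi})"
  unfolding circle_measure_def using assms by (intro integral_distr) auto

lemma circle_measure_orthogonal:
  assumes "j \<noteq> k"
  shows "(\<integral>z. indicator (sphere 0 1) z *\<^sub>R (z ^ j * cnj z ^ k) \<partial>circle_measure) = 0"
proof -
  have "(\<integral>z. indicator (sphere 0 1) z *\<^sub>R (z ^ j * cnj z ^ k) \<partial>circle_measure)
     = (\<integral>t. indicator (sphere 0 1) (cis t) *\<^sub>R (cis t ^ j * cnj (cis t) ^ k) \<partial>uniform_measure lborel {0..2 * pi})"
    by (rule integral_circle_measure)
       (intro borel_measurable_scaleR borel_measurable_indicator borel_measurable_continuous_onI continuous_intros, simp)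
  also have "\<dots> = (\<integral>t. cis (of_int (int j - int k) * t) \<partial>uniform_measure lborel {0..2 * pi})"
    by (intro Bochner_Integration.integral_cong refl)
       (simp add: cis_cnj Complex.DeMoivre cis_mult left_diff_distrib)
  finally show ?thesis using integral_cis_uniform[of "int j - int k"] assms by simp
qed

lemma circle_measure_moment:
  "(\<integral>z. indicator (sphere 0 1) z * norm z ^ (2 * k) \<partial>circle_measure) = 1"
proof -
  interpret prob_space "uniform_measure lborel {0..2 * pi}" by (rule prob_space_uniform_Icc)
  have "(\<integral>z. indicator (sphere 0 1) z * norm z ^ (2 * k) \<partial>circle_measure)
     = (\<integral>t. indicator (sphere 0 1) (cis t) * norm (cis t) ^ (2 * k) \<partial>uniform_measure lborel {0..2 * pi})"
    by (rule integral_circle_measure)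
       (intro borel_measurable_times borel_measurable_indicator borel_measurable_continuous_onI continuous_intros, simp)
  also have "\<dots> = 1" using prob_space by simp
  finally show ?thesis .
qed

text \<open>The dilated function \<zeta> \<mapsto> f(r \<zeta>) has the coefficients
  \<open>c \<alpha> * rpow r \<alpha>\<close>, which are absolutely summable, so the general
  identity applies on the unit torus with radius bound 1.\<close>

lemma hardy_Parseval:
  assumes f: "has_coeffs f c" and r: "0 < r" "r < 1"
  shows "(\<integral>\<^sup>+\<zeta>\<in>torus. ennreal ((norm (f (r *\<^sub>R \<zeta>)))\<^sup>2) \<partial>product_measure circle_measure)
     = coeff_norm (\<lambda>\<alpha>. (rpow r \<alpha>)\<^sup>2) c"
proof -
  have "(\<integral>\<^sup>+\<zeta>. ennreal ((norm (f (r *\<^sub>R \<zeta>)))\<^sup>2) * indicator {z. \<forall>i. z $ i \<in> sphere 0 1} \<zeta> \<partial>product_measure circle_measure)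
    = (\<integral>\<^sup>+\<alpha>. ennreal ((\<Prod>i\<in>UNIV. \<integral>z. indicator (sphere 0 1) z * norm z ^ (2 * \<alpha> i) \<partial>circle_measure) * (norm (c \<alpha> * of_real (rpow r \<alpha>)))\<^sup>2) \<partial>count_space UNIV)"
  proof (rule Parseval_product_measure[OF prob_space_circle_measure sets_circle_measure, of "sphere 0 1" 1])
    fix z :: "complex ^ 'a" assume "\<And>i. z $ i \<in> sphere 0 1"
    then have "r *\<^sub>R z \<in> polydisc" using r by (simp add: polydisc_def)
    then show "((\<lambda>\<alpha>. c \<alpha> * of_real (rpow r \<alpha>) * mpow z \<alpha>) has_sum f (r *\<^sub>R z)) UNIV"
      using f by (auto simp: has_coeffs_def mpow_scaleR mult.assoc)
  next
    show "(\<lambda>\<alpha>. norm (c \<alpha> * of_real (rpow r \<alpha>)) * rpow 1 \<alpha>) summable_on UNIV"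
      using has_coeffs_summable[OF f, of r] r by (simp add: norm_mult)
  qed (auto simp: circle_measure_orthogonal)
  then show ?thesis
    unfolding torus_altdef coeff_norm_def circle_measure_moment
    using r by (simp add: norm_mult power_mult_distrib mult.commute)
qed

lemma nn_integral_count_space_LIMSEQ:
  fixes f :: "nat \<Rightarrow> 'a \<Rightarrow> real"
  assumes mono: "\<And>n a. f n a \<le> f (Suc n) a" and lim: "\<And>a. (\<lambda>n. f n a) \<longlonglongrightarrow> g a"
  shows "(SUP n. \<integral>\<^sup>+a. ennreal (f n a) \<partial>count_space UNIV) = (\<integral>\<^sup>+a. ennreal (g a) \<partial>count_space UNIV)"
proof -
  have inc: "incseq (\<lambda>n a. ennreal (f n a))"
    using mono by (intro incseq_SucI le_funI ennreal_leI) auto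
  then have "(SUP n. \<integral>\<^sup>+a. ennreal (f n a) \<partial>count_space UNIV) = (\<integral>\<^sup>+a. (SUP n. ennreal (f n a)) \<partial>count_space UNIV)"
    by (intro nn_integral_monotone_convergence_SUP[symmetric]) auto
  moreover have "(SUP n. ennreal (f n a)) = ennreal (g a)" for a
  proof (rule LIMSEQ_unique)
    show "(\<lambda>n. ennreal (f n a)) \<longlonglongrightarrow> (SUP n. ennreal (f n a))"
      using mono by (intro LIMSEQ_SUP incseq_SucI ennreal_leI)
    show "(\<lambda>n. ennreal (f n a)) \<longlonglongrightarrow> ennreal (g a)" by (intro tendsto_ennrealI lim)
  qed
  ultimately show ?thesis by simp
qed

text \<open>A sequence exhausting the unit interval, for use with monotone convergence. The shift by
  2 keeps the radii strictly positive from \<open>n = 0\<close> on.\<close>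

definition radius :: "nat \<Rightarrow> real" where
  "radius n = 1 - 1 / (real n + 2)"

lemma radius_bounds: "0 < radius n" "radius n < 1" "radius n \<le> radius (Suc n)"
  by (auto simp: radius_def field_simps)

lemma radius_LIMSEQ: "radius \<longlonglongrightarrow> 1"
  unfolding radius_def by real_asymp

lemma radius_eventually_gt: "x < 1 \<Longrightarrow> \<exists>n. x < radius n"
  using order_tendstoD(1)[OF radius_LIMSEQ, of x] by (auto simp: eventually_sequentially)

lemma bergman_weight_minus1 [simp]: "bergman_weight (-1) \<alpha> = 1"
  by (simp add: bergman_weight_def bergman_weight1_def pochhammer_fact[symmetric])

text \<open>Dilation only decreases each term, which gives one inequality. Along
  \<open>radius n\<close> the terms increase to the full ones, and monotone convergence gives the
  other.\<close>

lemma hardy_sqnorm: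
  assumes f: "has_coeffs f c"
  shows "bergman_sqnorm (-1) f = coeff_norm (bergman_weight (-1)) c"
proof -
  have "bergman_sqnorm (-1) f = (SUP r\<in>{0<..<1}. coeff_norm (\<lambda>\<alpha>. (rpow r \<alpha>)\<^sup>2) c)"
    unfolding bergman_sqnorm_def by (simp add: hardy_Parseval[OF f] cong: SUP_cong_simp)
  also have "\<dots> = coeff_norm (bergman_weight (-1)) c"
  proof (rule antisym)
    show "(SUP r\<in>{0<..<1}. coeff_norm (\<lambda>\<alpha>. (rpow r \<alpha>)\<^sup>2) c) \<le> coeff_norm (bergman_weight (-1)) c"
    proof (intro SUP_least)
      fix r :: real assume "r \<in> {0<..<1}"
      then have "(rpow r \<alpha>)\<^sup>2 \<le> 1" for \<alpha> :: "'a multiindex"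
        using rpow_mono[of r 1 \<alpha>] by (intro power_le_one) auto
      then show "coeff_norm (\<lambda>\<alpha>. (rpow r \<alpha>)\<^sup>2) c \<le> coeff_norm (bergman_weight (-1)) c"
        unfolding coeff_norm_def by (intro nn_integral_mono ennreal_leI mult_right_mono) auto
    qed
    have "coeff_norm (bergman_weight (-1)) c = (SUP n. coeff_norm (\<lambda>\<alpha>. (rpow (radius n) \<alpha>)\<^sup>2) c)"
      unfolding coeff_norm_def
    proof (rule nn_integral_count_space_LIMSEQ[symmetric])
      fix n and \<alpha> :: "'a multiindex"
      show "(rpow (radius n) \<alpha>)\<^sup>2 * (norm (c \<alpha>))\<^sup>2 \<le> (rpow (radius (Suc n)) \<alpha>)\<^sup>2 * (norm (c \<alpha>))\<^sup>2"
        using radius_bounds[of n] by (intro mult_right_mono power_mono rpow_mono) auto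
      have "(\<lambda>n. (rpow (radius n) \<alpha>)\<^sup>2 * (norm (c \<alpha>))\<^sup>2) \<longlonglongrightarrow> (rpow 1 \<alpha>)\<^sup>2 * (norm (c \<alpha>))\<^sup>2"
        unfolding rpow_def by (intro tendsto_intros radius_LIMSEQ)
      then show "(\<lambda>n. (rpow (radius n) \<alpha>)\<^sup>2 * (norm (c \<alpha>))\<^sup>2) \<longlonglongrightarrow> bergman_weight (-1) \<alpha> * (norm (c \<alpha>))\<^sup>2"
        by simp
    qed
    also have "\<dots> \<le> (SUP r\<in>{0<..<1}. coeff_norm (\<lambda>\<alpha>. (rpow r \<alpha>)\<^sup>2) c)"
      using radius_bounds by (intro SUP_least SUP_upper) auto
    finally show "coeff_norm (bergman_weight (-1)) c \<le> (SUP r\<in>{0<..<1}. coeff_norm (\<lambda>\<alpha>. (rpow r \<alpha>)\<^sup>2) c)" .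
  qed
  finally show ?thesis .
qed

text \<open>Parseval's identity needs one absolutely convergent majorant for the whole domain, which
  a Taylor series offers only on smaller polydiscs. The moments over the smaller discs increase to
  the full moments, by dominated convergence.\<close>

lemma disc_measure_truncated_moment:
  assumes b: "\<beta> > -1"
  defines "m \<equiv> \<lambda>n k. \<integral>z. indicator (ball 0 (radius n)) z * norm z ^ (2 * k) \<partial>disc_measure \<beta>"
  shows "m n k \<ge> 0" "m n k \<le> m (Suc n) k" "(\<lambda>n. m n k) \<longlonglongrightarrow> bergman_weight1 \<beta> k"
proof -
  interpret prob_space "disc_measure \<beta>" by (rule prob_space_disc_measure[OF b])
  define h where "h n z = indicator (ball 0 (radius n)) z * norm z ^ (2 * k)" for n and z :: complex
  have [measurable]: "(\<lambda>z. indicator (ball 0 r) z * norm z ^ (2 * k)) \<in> borel_measurable (borel :: complex measure)" for r :: real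
    by (intro borel_measurable_times borel_measurable_indicator borel_measurable_continuous_onI continuous_intros) simp
  have meas: "h n \<in> borel_measurable (disc_measure \<beta>)" for n
    unfolding h_def[abs_def] by measurable
  have hb: "norm (h n z) \<le> 1" for n z
  proof (cases "z \<in> ball 0 (radius n)")
    case True
    then have "norm z \<le> 1" using radius_bounds(2)[of n] by simp
    then show ?thesis by (simp add: h_def indicator_def power_le_one)
  qed (simp add: h_def)
  have hi: "integrable (disc_measure \<beta>) (h n)" for n
    using hb meas by (intro integrable_const_bound[where B = 1]) auto
  have hmono: "h n z \<le> h (Suc n) z" for n z
    using radius_bounds(3)[of n] by (auto simp: h_def indicator_def)
  show "m n k \<ge> 0" by (simp add: m_def)
  show "m n k \<le> m (Suc n) k"
    using integral_mono[OF hi hi hmono] by (simp add: m_def h_def[abs_def])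
  define g where "g z = indicator (ball 0 1) z * norm z ^ (2 * k)" for z :: complex
  have meas_g: "g \<in> borel_measurable (disc_measure \<beta>)" unfolding g_def[abs_def] by measurable
  have "(\<lambda>n. integral\<^sup>L (disc_measure \<beta>) (h n)) \<longlonglongrightarrow> integral\<^sup>L (disc_measure \<beta>) g"
  proof (rule integral_dominated_convergence[where w = "\<lambda>_. 1"])
    show "AE z in disc_measure \<beta>. (\<lambda>n. h n z) \<longlonglongrightarrow> g z"
    proof (rule AE_I2)
      fix z :: complex
      show "(\<lambda>n. h n z) \<longlonglongrightarrow> g z"
      proof (cases "norm z < 1")
        case True
        then have "\<forall>\<^sub>F n in sequentially. norm z < radius n"
          using order_tendstoD(1)[OF radius_LIMSEQ] by blast
        then have "\<forall>\<^sub>F n in sequentially. h n z = g z"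
          by eventually_elim (use True in \<open>simp add: h_def g_def\<close>)
        then show ?thesis by (rule tendsto_eventually)
      next
        case False
        then have "h n z = 0" "g z = 0" for n using radius_bounds(2)[of n] by (auto simp: h_def g_def)
        then show ?thesis by simp
      qed
    qed
  qed (use hb meas meas_g in auto)
  moreover have "integral\<^sup>L (disc_measure \<beta>) g = bergman_weight1 \<beta> k"
  proof -
    have "(\<integral>\<^sup>+z. ennreal (g z) \<partial>disc_measure \<beta>) = (\<integral>\<^sup>+z. ennreal ((norm z) ^ (2 * k)) \<partial>disc_measure \<beta>)"
      using meas_g by (subst (1 2) nn_integral_disc_measure)
        (auto simp: g_def indicator_def measurable_cong_sets[OF sets_disc_measure refl] intro!: arg_cong2[where f="(/)"] nn_integral_cong)
    then have "(\<integral>\<^sup>+z. ennreal (g z) \<partial>disc_measure \<beta>) = ennreal (bergman_weight1 \<beta> k)"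
      using disc_measure_moment[OF b] by simp
    then show ?thesis
      using b meas_g by (subst integral_eq_nn_integral) (auto simp: g_def less_imp_le)
  qed
  ultimately show "(\<lambda>n. m n k) \<longlonglongrightarrow> bergman_weight1 \<beta> k"
    by (simp add: m_def h_def[abs_def])
qed

text \<open>Parseval on the polydiscs of radius \<open>radius n\<close>, then monotone convergence
  on both sides. Holomorphy enters as continuity, which makes the cut-off integrands
  measurable.\<close>

lemma bergman_sqnorm_gt:
  assumes b: "\<beta> > -1" and f: "has_coeffs f c" and fm: "holomorphic_polydisc f"
  shows "bergman_sqnorm \<beta> f = coeff_norm (bergman_weight \<beta>) c"
proof -
  define m where "m n k = (\<integral>z. indicator (ball 0 (radius n)) z * norm z ^ (2 * k) \<partial>disc_measure \<beta>)" for n k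
  note m = disc_measure_truncated_moment[OF b, folded m_def]
  let ?M = "product_measure (disc_measure \<beta>) :: (complex ^ 'a) measure"
  let ?Q = "\<lambda>n. {z :: complex ^ 'a. \<forall>i. z $ i \<in> ball 0 (radius n)}"
  have Un: "(\<Union>n. ?Q n) = polydisc"
  proof safe
    fix z n assume "\<forall>i. (z::complex ^ 'a) $ i \<in> ball 0 (radius n)"
    then have "norm (z $ i) < radius n" for i by simp
    then show "z \<in> polydisc" using radius_bounds(2)[of n] by (auto simp: polydisc_def intro: less_trans)
  next
    fix z :: "complex ^ 'a" assume z: "z \<in> polydisc"
    obtain x where "0 < x" and x: "x < 1" "\<And>i. norm (z $ i) < x"
      by (rule norm_polydisc_obtain_radius[OF z]) (rule that)
    then obtain n where n: "x < radius n" using radius_eventually_gt by blast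
    then have "z \<in> ?Q n" using x(2) by (auto intro: less_trans)
    then show "z \<in> (\<Union>n. ?Q n)" by blast
  qed
  have Qinc: "?Q n \<subseteq> ?Q (Suc n)" for n
    using radius_bounds(3)[of n] by (auto intro: less_le_trans)
  have Qopen: "open (?Q n)" for n using open_polydisc_radius[of "radius n"] by simp
  have Fm: "(\<lambda>z. ennreal ((norm (f z))\<^sup>2) * indicator (?Q n) z) \<in> borel_measurable ?M" for n
  proof -
    have "continuous_on (?Q n) (\<lambda>z. (norm (f z))\<^sup>2)"
      using Un by (intro continuous_intros continuous_on_subset[OF holomorphic_polydisc_continuous[OF fm]]) blast
    then have "(\<lambda>z. indicator (?Q n) z *\<^sub>R (norm (f z))\<^sup>2) \<in> borel_measurable borel"
      using Qopen by (intro borel_measurable_continuous_on_indicator) auto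
    then have "(\<lambda>z. ennreal (indicator (?Q n) z *\<^sub>R (norm (f z))\<^sup>2)) \<in> borel_measurable borel"
      by measurable
    moreover have "(\<lambda>z. ennreal (indicator (?Q n) z *\<^sub>R (norm (f z))\<^sup>2)) = (\<lambda>z. ennreal ((norm (f z))\<^sup>2) * indicator (?Q n) z)"
      by (auto simp: indicator_def)
    ultimately show ?thesis by (simp only: product_measure_def measurable_distr_eq1)
  qed
  have ind: "indicator polydisc z = (SUP n. indicator (?Q n) z :: ennreal)" for z
  proof (cases "z \<in> polydisc")
    case True
    then obtain n where "z \<in> ?Q n" unfolding Un[symmetric] by blast
    then show ?thesis using True by (intro antisym SUP_upper2[of n] SUP_least) (auto simp: indicator_def)
  next
    case False
    then have "z \<notin> ?Q n" for n unfolding Un[symmetric] by blast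
    then have "(\<lambda>n. indicator (?Q n) z :: ennreal) = (\<lambda>_. 0)" by (auto simp: indicator_def)
    then show ?thesis using False by (simp only:) simp
  qed
  have "bergman_sqnorm \<beta> f = (\<integral>\<^sup>+z. (SUP n. ennreal ((norm (f z))\<^sup>2) * indicator (?Q n) z) \<partial>?M)"
    using b unfolding bergman_sqnorm_def by (simp add: ind SUP_mult_left_ennreal)
  also have "\<dots> = (SUP n. \<integral>\<^sup>+z. ennreal ((norm (f z))\<^sup>2) * indicator (?Q n) z \<partial>?M)"
  proof (rule nn_integral_monotone_convergence_SUP)
    show "incseq (\<lambda>n z. ennreal ((norm (f z))\<^sup>2) * indicator (?Q n) z)"
      using Qinc by (intro incseq_SucI le_funI mult_left_mono) (auto simp: indicator_def)
  qed (rule Fm)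
  also have "\<dots> = (SUP n. \<integral>\<^sup>+\<alpha>. ennreal ((\<Prod>i\<in>UNIV. m n (\<alpha> i)) * (norm (c \<alpha>))\<^sup>2) \<partial>count_space UNIV)"
  proof (intro SUP_cong refl)
    fix n
    show "(\<integral>\<^sup>+z. ennreal ((norm (f z))\<^sup>2) * indicator (?Q n) z \<partial>?M)
      = (\<integral>\<^sup>+\<alpha>. ennreal ((\<Prod>i\<in>UNIV. m n (\<alpha> i)) * (norm (c \<alpha>))\<^sup>2) \<partial>count_space UNIV)"
      unfolding m_def
    proof (rule Parseval_product_measure[OF prob_space_disc_measure[OF b] sets_disc_measure])
      fix z :: "complex ^ 'a" assume "\<And>i. z $ i \<in> ball 0 (radius n)"
      then have "z \<in> polydisc" using Un by blast
      then show "((\<lambda>\<alpha>. c \<alpha> * mpow z \<alpha>) has_sum f z) UNIV"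
        using f by (auto simp: has_coeffs_def)
    next
      show "(\<lambda>\<alpha>. norm (c \<alpha>) * rpow (radius n) \<alpha>) summable_on UNIV"
        using has_coeffs_summable[OF f, of "radius n"] radius_bounds[of n] by simp
    qed (use radius_bounds[of n] in \<open>auto simp: disc_measure_orthogonal[OF b]\<close>)
  qed
  also have "\<dots> = coeff_norm (bergman_weight \<beta>) c"
    unfolding coeff_norm_def
  proof (rule nn_integral_count_space_LIMSEQ)
    fix n and \<alpha> :: "'a multiindex"
    show "(\<Prod>i\<in>UNIV. m n (\<alpha> i)) * (norm (c \<alpha>))\<^sup>2 \<le> (\<Prod>i\<in>UNIV. m (Suc n) (\<alpha> i)) * (norm (c \<alpha>))\<^sup>2"
      using m by (intro mult_right_mono prod_mono) auto
    show "(\<lambda>n. (\<Prod>i\<in>UNIV. m n (\<alpha> i)) * (norm (c \<alpha>))\<^sup>2) \<longlonglongrightarrow> bergman_weight \<beta> \<alpha> * (norm (c \<alpha>))\<^sup>2"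
      unfolding bergman_weight_def by (intro tendsto_intros m(3))
  qed
  finally show ?thesis .
qed

lemma bergman_sqnorm_eq_coeff_norm:
  assumes "\<beta> \<ge> -1" "has_coeffs f c" "holomorphic_polydisc f"
  shows "bergman_sqnorm \<beta> f = coeff_norm (bergman_weight \<beta>) c"
proof (cases "\<beta> = -1")
  case True
  then show ?thesis using hardy_sqnorm[OF assms(2)] by simp
next
  case False
  then have "\<beta> > -1" using assms(1) by simp
  then show ?thesis using assms by (intro bergman_sqnorm_gt)
qed

section \<open>Power series on the polydisc\<close>

text \<open>The Weierstrass M-test along cubes: the bound depends on \<open>b\<close> alone and is
  therefore uniform over every family of series that \<open>b\<close> dominates.\<close>

lemma box_index_tail_bound:
  fixes f :: "'d::finite multiindex \<Rightarrow> 'b::banach"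
  assumes b: "b summable_on UNIV" and fb: "\<And>\<alpha>. norm (f \<alpha>) \<le> b \<alpha>"
  shows "norm (infsum f UNIV - sum f (box_index N)) \<le> infsum b UNIV - sum b (box_index N)"
proof -
  have b0: "b \<alpha> \<ge> 0" for \<alpha> using fb[of \<alpha>] norm_ge_zero order_trans by blast
  have "f summable_on UNIV"
    by (rule abs_summable_summable[OF summable_on_comparison_test[OF b]]) (use fb in auto)
  then have lim: "(\<lambda>M. sum f (box_index M) - sum f (box_index N)) \<longlonglongrightarrow> infsum f UNIV - sum f (box_index N)"
    by (intro tendsto_diff tendsto_const has_sum_imp_box_index has_sum_infsum)
  show ?thesis
  proof (rule LIMSEQ_le_const2[OF tendsto_norm[OF lim]], intro exI allI impI)
    fix M assume "N \<le> M"
    then have sub: "box_index N \<subseteq> box_index M" by (rule box_index_mono)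
    have "norm (sum f (box_index M) - sum f (box_index N)) = norm (sum f (box_index M - box_index N))"
      by (simp only: sum_diff[OF finite_box_index sub])
    also have "\<dots> \<le> sum b (box_index M - box_index N)" by (intro sum_norm_le fb)
    also have "\<dots> = sum b (box_index M) - sum b (box_index N)" by (simp only: sum_diff[OF finite_box_index sub])
    also have "\<dots> \<le> infsum b UNIV - sum b (box_index N)"
      using b b0 by (intro diff_right_mono finite_sum_le_infsum) auto
    finally show "norm (sum f (box_index M) - sum f (box_index N)) \<le> infsum b UNIV - sum b (box_index N)" .
  qed
qed

lemma convex_polydisc_radius: "convex {z :: complex ^ 'd::finite. \<forall>i. norm (z $ i) < \<rho>}"
proof -
  have "{z :: complex ^ 'd. \<forall>i. norm (z $ i) < \<rho>} = (\<Inter>i. (\<lambda>z. z $ i) -` ball 0 \<rho>)" by auto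
  moreover have "linear (\<lambda>z :: complex ^ 'd. z $ i)" for i
    by (simp add: linear_iff)
  ultimately show ?thesis by (auto intro!: convex_INT convex_linear_vimage)
qed

text \<open>Differentiation costs a factor k, which is absorbed by the decay of (\<rho> /
  \<rho>')^k.\<close>

lemma power_deriv_bound:
  assumes "0 < \<rho>" "\<rho> < \<rho>'"
  obtains K :: real where "K \<ge> 0" "\<And>k. real k * \<rho> ^ (k - 1) \<le> K * \<rho>' ^ k"
proof -
  define q where "q = \<rho> / \<rho>'"
  have q: "0 < q" "q < 1" using assms by (auto simp: q_def)
  have "(\<lambda>n. real n * q ^ n) \<longlonglongrightarrow> 0" using q powser_times_n_limit_0[of q] by simp
  then have "Bseq (\<lambda>n. real n * q ^ n)" by (intro convergent_imp_Bseq) (auto simp: convergent_def)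
  then obtain A where A: "A > 0" "\<And>n. norm (real n * q ^ n) \<le> A" by (auto simp: Bseq_def)
  show ?thesis
  proof (rule that[of "A / \<rho>"])
    fix k
    show "real k * \<rho> ^ (k - 1) \<le> A / \<rho> * \<rho>' ^ k"
    proof (cases k)
      case 0 then show ?thesis using A assms by simp
    next
      case (Suc n)
      have "real k * \<rho> ^ (k - 1) = (real k * q ^ k) * \<rho>' ^ k / \<rho>"
        using assms Suc by (simp add: q_def power_divide)
      also have "\<dots> \<le> A * \<rho>' ^ k / \<rho>"
        using A(2)[of k] assms q by (intro divide_right_mono mult_right_mono) auto
      finally show ?thesis by simp
    qed
  qed (use A assms in auto)
qed

definition mpow_deriv :: "'d::finite multiindex \<Rightarrow> 'd \<Rightarrow> complex ^ 'd \<Rightarrow> complex" where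
  "mpow_deriv \<alpha> j z = of_nat (\<alpha> j) * (z $ j) ^ (\<alpha> j - 1) * (\<Prod>i\<in>UNIV - {j}. (z $ i) ^ \<alpha> i)"

lemma has_derivative_mpow:
  "((\<lambda>z. mpow z \<alpha>) has_derivative (\<lambda>h. \<Sum>j\<in>UNIV. mpow_deriv \<alpha> j z * h $ j)) (at z within S)"
proof -
  have "((\<lambda>z :: complex ^ 'a. (z $ i) ^ \<alpha> i) has_derivative (\<lambda>h. of_nat (\<alpha> i) * h $ i * (z $ i) ^ (\<alpha> i - 1))) (at z within S)" for i
    by (auto intro!: derivative_eq_intros bounded_linear.has_derivative[OF bounded_linear_vec_nth] simp: fun_eq_iff)
  then have "((\<lambda>z. \<Prod>i\<in>UNIV. (z $ i) ^ \<alpha> i) has_derivative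
     (\<lambda>h. \<Sum>i\<in>UNIV. (of_nat (\<alpha> i) * h $ i * (z $ i) ^ (\<alpha> i - 1)) * (\<Prod>j\<in>UNIV - {i}. (z $ j) ^ \<alpha> j))) (at z within S)"
    by (intro has_derivative_prod)
  then show ?thesis by (simp add: mpow_def mpow_deriv_def mult_ac)
qed

text \<open>Termwise differentiation. On the convex polydisc of radius \<rho> the differentiated
  terms are dominated by a multiple of the series at a slightly larger radius \<rho>' < 1, so the
  derivatives of the cube sums converge uniformly there.\<close>

lemma has_coeffs_imp_holomorphic:
  fixes f :: "complex ^ 'd::finite \<Rightarrow> complex"
  assumes f: "has_coeffs f c"
  shows "holomorphic_polydisc f"
  unfolding holomorphic_polydisc_def
proof
  fix z0 :: "complex ^ 'd" assume z0_disc: "z0 \<in> polydisc"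
  then obtain \<rho> where \<rho>: "0 < \<rho>" "\<rho> < 1" "\<And>i. norm (z0 $ i) < \<rho>"
    by (rule norm_polydisc_obtain_radius) blast
  define \<rho>' where "\<rho>' = (\<rho> + 1) / 2"
  have \<rho>': "\<rho> < \<rho>'" "\<rho>' < 1" using \<rho> by (auto simp: \<rho>'_def)
  obtain K where K: "K \<ge> 0" "\<And>k. real k * \<rho> ^ (k - 1) \<le> K * \<rho>' ^ k"
    using power_deriv_bound[OF \<rho>(1) \<rho>'(1)] by blast
  define S where "S = {z :: complex ^ 'd. \<forall>i. norm (z $ i) < \<rho>}"
  define b where "b \<alpha> = K * (norm (c \<alpha>) * rpow \<rho>' \<alpha>)" for \<alpha>
  have bs: "b summable_on UNIV"
    unfolding b_def using has_coeffs_summable[OF f, of \<rho>'] \<rho> \<rho>' by (intro summable_on_cmult_right) auto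
  have Db: "norm (c \<alpha> * mpow_deriv \<alpha> j z) \<le> b \<alpha>" if "z \<in> S" for \<alpha> j z
  proof -
    have zi: "norm (z $ i) \<le> \<rho>" for i using that by (auto simp: S_def less_imp_le)
    then have zi': "norm (z $ i) \<le> \<rho>'" for i using \<rho>' by (meson less_imp_le order_trans)
    have "norm (mpow_deriv \<alpha> j z) = real (\<alpha> j) * norm (z $ j) ^ (\<alpha> j - 1) * (\<Prod>i\<in>UNIV - {j}. norm (z $ i) ^ \<alpha> i)"
      by (simp add: mpow_deriv_def norm_mult norm_power prod_norm[symmetric])
    also have "\<dots> \<le> real (\<alpha> j) * \<rho> ^ (\<alpha> j - 1) * (\<Prod>i\<in>UNIV - {j}. \<rho>' ^ \<alpha> i)"
      using zi zi' \<rho> \<rho>' by (intro mult_mono prod_mono conjI power_mono order_refl)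
        (auto intro!: prod_nonneg mult_nonneg_nonneg intro: order_trans)
    also have "\<dots> \<le> K * \<rho>' ^ \<alpha> j * (\<Prod>i\<in>UNIV - {j}. \<rho>' ^ \<alpha> i)"
      using \<rho> \<rho>' by (intro mult_right_mono K(2)) (auto intro!: prod_nonneg)
    also have "\<dots> = K * rpow \<rho>' \<alpha>"
      by (simp add: rpow_def prod.remove[of UNIV j])
    finally have "norm (c \<alpha>) * norm (mpow_deriv \<alpha> j z) \<le> norm (c \<alpha>) * (K * rpow \<rho>' \<alpha>)"
      by (intro mult_left_mono) auto
    then show ?thesis by (simp add: b_def norm_mult mult_ac)
  qed
  define F where "F N z = (\<Sum>\<alpha>\<in>box_index N. c \<alpha> * mpow z \<alpha>)" for N and z :: "complex ^ 'd"
  define F' where "F' N z h = (\<Sum>j\<in>UNIV. (\<Sum>\<alpha>\<in>box_index N. c \<alpha> * mpow_deriv \<alpha> j z) * h $ j)"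
    for N and z h :: "complex ^ 'd"
  define a where "a z = (\<chi> j. \<Sum>\<^sub>\<infinity>\<alpha>. c \<alpha> * mpow_deriv \<alpha> j z)" for z
  define G' where "G' z h = (\<Sum>j\<in>UNIV. a z $ j * h $ j)" for z and h :: "complex ^ 'd"
  define T where "T N = infsum b UNIV - sum b (box_index N)" for N
  have T: "T \<longlonglongrightarrow> 0"
    using tendsto_diff[OF tendsto_const has_sum_imp_box_index[OF has_sum_infsum[OF bs]], of "infsum b UNIV"]
    by (simp add: T_def[abs_def])
  have der: "(F N has_derivative F' N z) (at z within S)" for N z
  proof -
    have "(F N has_derivative (\<lambda>h. \<Sum>\<alpha>\<in>box_index N. c \<alpha> * (\<Sum>j\<in>UNIV. mpow_deriv \<alpha> j z * h $ j))) (at z within S)"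
      unfolding F_def[abs_def]
      by (rule has_derivative_sum, rule has_derivative_mult_right, rule has_derivative_mpow)
    moreover have "(\<lambda>h. \<Sum>\<alpha>\<in>box_index N. c \<alpha> * (\<Sum>j\<in>UNIV. mpow_deriv \<alpha> j z * h $ j)) = F' N z"
    proof
      fix h
      have "(\<Sum>\<alpha>\<in>box_index N. c \<alpha> * (\<Sum>j\<in>UNIV. mpow_deriv \<alpha> j z * h $ j))
        = (\<Sum>\<alpha>\<in>box_index N. \<Sum>j\<in>UNIV. c \<alpha> * mpow_deriv \<alpha> j z * h $ j)"
        by (simp only: sum_distrib_left mult.assoc)
      also have "\<dots> = (\<Sum>j\<in>UNIV. \<Sum>\<alpha>\<in>box_index N. c \<alpha> * mpow_deriv \<alpha> j z * h $ j)"
        by (rule sum.swap)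
      also have "\<dots> = F' N z h" by (simp only: F'_def sum_distrib_right)
      finally show "(\<Sum>\<alpha>\<in>box_index N. c \<alpha> * (\<Sum>j\<in>UNIV. mpow_deriv \<alpha> j z * h $ j)) = F' N z h" .
    qed
    ultimately show ?thesis by simp
  qed
  have diff: "norm (F' N z h - G' z h) \<le> (real CARD('d) * T N) * norm h" if "z \<in> S" for N z h
  proof -
    have "norm (F' N z h - G' z h) = norm (\<Sum>j\<in>UNIV. ((\<Sum>\<alpha>\<in>box_index N. c \<alpha> * mpow_deriv \<alpha> j z) - a z $ j) * h $ j)"
      by (simp add: F'_def G'_def sum_subtractf left_diff_distrib)
    also have "\<dots> \<le> (\<Sum>j\<in>(UNIV::'d set). T N * norm h)"
    proof (intro sum_norm_le)
      fix j
      have "norm ((\<Sum>\<alpha>\<in>box_index N. c \<alpha> * mpow_deriv \<alpha> j z) - a z $ j) \<le> T N"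
        using box_index_tail_bound[OF bs, of "\<lambda>\<alpha>. c \<alpha> * mpow_deriv \<alpha> j z" N] Db[OF that] by (simp add: a_def T_def norm_minus_commute)
      then show "norm (((\<Sum>\<alpha>\<in>box_index N. c \<alpha> * mpow_deriv \<alpha> j z) - a z $ j) * h $ j) \<le> T N * norm h"
        unfolding norm_mult by (intro mult_mono Finite_Cartesian_Product.norm_nth_le) (auto intro: order_trans[OF norm_ge_zero])
    qed
    also have "\<dots> = (real CARD('d) * T N) * norm h" by simp
    finally show ?thesis .
  qed
  have "\<exists>g. \<forall>z\<in>S. (\<lambda>N. F N z) \<longlonglongrightarrow> g z \<and> (g has_derivative G' z) (at z within S)"
  proof (rule has_derivative_sequence)
    show "convex S" unfolding S_def by (rule convex_polydisc_radius)
    show "(F N has_derivative F' N z) (at z within S)" for N z by (rule der)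
    show "\<forall>\<^sub>F N in sequentially. \<forall>z\<in>S. \<forall>h. norm (F' N z h - G' z h) \<le> e * norm h" if "e > 0" for e
    proof -
      have "(\<lambda>N. real CARD('d) * T N) \<longlonglongrightarrow> real CARD('d) * 0" by (intro tendsto_intros T)
      then have "\<forall>\<^sub>F N in sequentially. real CARD('d) * T N < e"
        using that by (intro order_tendstoD(2)) auto
      then show ?thesis
      proof eventually_elim
        case (elim N)
        show ?case
        proof (intro ballI allI)
          fix z h assume "z \<in> S"
          from diff[OF this, of N h] show "norm (F' N z h - G' z h) \<le> e * norm h"
            by (rule order_trans) (use elim in \<open>simp add: mult_right_mono\<close>)
        qed
      qed
    qed
    show "z0 \<in> S" using \<rho> by (simp add: S_def)
    show "(\<lambda>N. F N z0) \<longlonglongrightarrow> f z0"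
      unfolding F_def by (rule has_sum_imp_box_index[OF f[unfolded has_coeffs_def, rule_format, OF z0_disc]])
  qed
  then obtain g where "\<forall>z\<in>S. (\<lambda>N. F N z) \<longlonglongrightarrow> g z \<and> (g has_derivative G' z) (at z within S)"
    by (rule exE)
  then have g: "(\<lambda>N. F N z) \<longlonglongrightarrow> g z" "(g has_derivative G' z) (at z within S)" if "z \<in> S" for z
    using that bspec by auto
  have gf: "g z = f z" if "z \<in> S" for z
  proof -
    have "norm (z $ i) < \<rho>" for i using that by (simp add: S_def)
    then have "norm (z $ i) < 1" for i using \<rho>(2) less_trans[of "norm (z $ i)" \<rho> 1] by simp
    then have "z \<in> polydisc" by (simp add: polydisc_def)
    from has_sum_imp_box_index[OF f[unfolded has_coeffs_def, rule_format, OF this]]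
    have "(\<lambda>N. F N z) \<longlonglongrightarrow> f z" unfolding F_def .
    then show ?thesis by (rule LIMSEQ_unique[OF g(1)[OF that]])
  qed
  have z0: "z0 \<in> S" using \<rho> by (simp add: S_def)
  have oS: "open S" unfolding S_def by (rule open_polydisc_radius)
  have "(g has_derivative G' z0) (at z0)"
    using g(2)[OF z0] by (simp only: at_within_open[OF z0 oS])
  then have "(f has_derivative G' z0) (at z0)"
    by (rule has_derivative_transform_within_open[OF _ oS z0]) (rule gf)
  then have "(f has_derivative (\<lambda>h. \<Sum>j\<in>UNIV. a z0 $ j * h $ j)) (at z0)"
    unfolding G'_def[abs_def] .
  then show "\<exists>a. (f has_derivative (\<lambda>h. \<Sum>j\<in>UNIV. a $ j * h $ j)) (at z0)"
    by (rule exI[of _ "a z0"])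
qed

section \<open>Cauchy's formula on the polydisc\<close>

lemma Cauchy_circle_average:
  assumes h: "h holomorphic_on ball 0 1" and r: "0 < r" "r < 1" and w: "norm w < r"
  shows "(\<integral>t. h (of_real r * cis t) * (1 / (1 - w * cis (- t) / of_real r)) \<partial>uniform_measure lborel {0..2 * pi}) = h w"
proof -
  let ?g = "\<lambda>t. h (of_real r * cis t) * (1 / (1 - w * cis (- t) / of_real r))"
  have sub: "cball 0 r \<subseteq> ball 0 (1::real)" "cball 0 r \<subseteq> ball (0::complex) 1" using r by auto
  have hc: "continuous_on (cball 0 r) h"
    using sub by (intro holomorphic_on_imp_continuous_on holomorphic_on_subset[OF h]) auto
  have "((\<lambda>u. h u / (u - w)) has_contour_integral (2 * of_real pi * \<i> * h w)) (circlepath 0 r)"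
    using sub r w hc by (intro Cauchy_integral_circlepath holomorphic_on_subset[OF h]) auto
  then have "((\<lambda>t. h (0 + of_real r * cis t) / (0 + of_real r * cis t - w) * of_real r * \<i> * cis t) has_integral (2 * of_real pi * \<i> * h w)) {0..2 * pi}"
    unfolding circlepath_def by (subst (asm) has_contour_integral_part_circlepath_iff) auto
  moreover have nz: "of_real r * cis t - w \<noteq> 0" for t
  proof
    assume "of_real r * cis t - w = 0"
    then have "norm (of_real r * cis t) = norm w" by simp
    then show False using r w by (simp add: norm_mult)
  qed
  \<comment> \<open>Taking \<open>r * cis t\<close> out of the denominator leaves the kernel
    \<open>1 / (1 - w * cis (- t) / r)\<close>, the form that later expands into a geometric series
    in \<open>w\<close>.\<close>
  have "h (0 + of_real r * cis t) / (0 + of_real r * cis t - w) * of_real r * \<i> * cis t = \<i> * ?g t" for t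
  proof -
    have "of_real r * cis t - w = of_real r * cis t * (1 - w * cis (- t) / of_real r)"
      using r by (simp add: field_simps cis_mult)
    then show ?thesis using nz[of t] r by simp
  qed
  ultimately have "((\<lambda>t. \<i> * ?g t) has_integral (2 * of_real pi * \<i> * h w)) {0..2 * pi}" by simp
  from has_integral_mult_right[OF this, of "-\<i>"]
  have I: "(?g has_integral (2 * of_real pi * h w)) {0..2 * pi}"
    by (simp add: algebra_simps)
  have nz': "1 - w * cis (- t) / of_real r \<noteq> 0" for t
  proof
    assume "1 - w * cis (- t) / of_real r = 0"
    then have "norm (w * cis (- t) / of_real r) = 1" by simp
    then show False using r w by (simp add: norm_mult norm_divide)
  qed
  have "continuous_on UNIV (\<lambda>t. h (of_real r * cis t))"
    by (rule continuous_on_compose2[OF hc]) (use r in \<open>auto intro!: continuous_intros simp: norm_mult\<close>)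
  then have gc: "continuous_on UNIV ?g"
    using nz' r by (auto intro!: continuous_intros)
  have gc': "continuous_on {0..2 * pi} ?g" by (rule continuous_on_subset[OF gc]) simp
  have "(LINT t:{0..2 * pi}|lborel. ?g t) = 2 * of_real pi * h w"
    using set_borel_integral_eq_integral(2)[OF borel_integrable_atLeastAtMost'[OF gc']] integral_unique[OF I]
    by (simp only:)
  then show ?thesis
    using gc by (subst integral_uniform_Icc)
      (auto intro: borel_measurable_continuous_onI simp: set_lebesgue_integral_def scaleR_conv_of_real)
qed

lemma borel_measurable_vec_lambda:
  fixes g :: "'a \<Rightarrow> 'd::finite \<Rightarrow> complex"
  assumes "\<And>i. (\<lambda>x. g x i) \<in> borel_measurable M"
  shows "(\<lambda>x. \<chi> i. g x i) \<in> borel_measurable M"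
proof -
  have "(\<lambda>x. (\<chi> i. g x i) \<bullet> b) \<in> borel_measurable M" if "b \<in> Basis" for b :: "complex ^ 'd"
    using assms by (simp add: inner_vec_def)
  then show ?thesis by (subst borel_measurable_euclidean_space) blast
qed

lemma holomorphic_slice:
  fixes f :: "complex ^ 'd::finite \<Rightarrow> complex"
  assumes f: "holomorphic_polydisc f" and v: "\<And>i. norm (v i) < 1"
  shows "(\<lambda>w. f (\<chi> i. if i = j then w else v i)) holomorphic_on ball 0 1"
proof (rule holomorphic_onI)
  fix w :: complex assume "w \<in> ball 0 1"
  then have "(\<chi> i. if i = j then w else v i) \<in> polydisc" using v by (auto simp: polydisc_def)
  then obtain a :: "complex ^ 'd" where a:
    "(f has_derivative (\<lambda>h. \<Sum>j\<in>UNIV. a $ j * h $ j)) (at (\<chi> i. if i = j then w else v i))"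
    using f unfolding holomorphic_polydisc_def by blast
  have "((\<lambda>w. \<chi> i. if i = j then w else v i) has_derivative (\<lambda>h. \<chi> i. if i = j then h else 0)) (at w within ball 0 1)"
  proof -
    let ?L = "\<lambda>h::complex. (\<chi> i. if i = j then h else 0) :: complex ^ 'd"
    have "linear ?L" by (intro linearI) (auto simp: vec_eq_iff)
    then have "((\<lambda>w. ?L w + (\<chi> i. if i = j then 0 else v i)) has_derivative ?L) (at w within ball 0 1)"
      by (intro has_derivative_add_const bounded_linear_imp_has_derivative) (simp add: linear_conv_bounded_linear)
    moreover have "(\<lambda>w. ?L w + (\<chi> i. if i = j then 0 else v i)) = (\<lambda>w. \<chi> i. if i = j then w else v i)"
      by (auto simp: vec_eq_iff fun_eq_iff)
    ultimately show ?thesis by simp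
  qed
  from has_derivative_compose[OF this a]
  have "((\<lambda>w. f (\<chi> i. if i = j then w else v i)) has_derivative (\<lambda>h. a $ j * h)) (at w within ball 0 1)"
    by (simp add: if_distrib cong: if_cong)
  then show "(\<lambda>w. f (\<chi> i. if i = j then w else v i)) field_differentiable (at w within ball 0 1)"
    by (auto simp: field_differentiable_def has_field_derivative_def)
qed

lemma compact_polydisc_radius: "compact {z :: complex ^ 'd::finite. \<forall>i. norm (z $ i) \<le> \<rho>}"
proof -
  have "{z :: complex ^ 'd. \<forall>i. norm (z $ i) \<le> \<rho>} = (\<Inter>i. (\<lambda>z. z $ i) -` cball 0 \<rho>)" by auto
  moreover have "closed (\<Inter>i. (\<lambda>z. z $ i) -` cball 0 \<rho> :: (complex ^ 'd) set)"
    by (auto intro!: closed_INT closed_vimage continuous_intros)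
  moreover have "bounded {z :: complex ^ 'd. \<forall>i. norm (z $ i) \<le> \<rho>}"
    unfolding bounded_iff
  proof (intro exI ballI)
    fix z :: "complex ^ 'd" assume "z \<in> {z. \<forall>i. norm (z $ i) \<le> \<rho>}"
    then have "(\<Sum>i\<in>UNIV. norm (z $ i)) \<le> (\<Sum>i\<in>(UNIV :: 'd set). \<rho>)" by (intro sum_mono) auto
    then show "norm z \<le> (\<Sum>i\<in>(UNIV :: 'd set). \<rho>)" using L2_set_le_sum[of UNIV "\<lambda>i. norm (z $ i)"]
      by (simp add: norm_vec_def)
  qed
  ultimately show ?thesis by (simp add: compact_eq_bounded_closed)
qed

text \<open>The torus of integration has radius \<open>r < 1\<close>, inside the domain of
  holomorphy. \<open>F\<close> is \<open>f\<close> set to 0 off the polydisc, which makes it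
  measurable everywhere. \<open>pt S z x\<close> places the coordinates in \<open>S\<close> on the
  circle of radius \<open>r\<close> and leaves the others at \<open>z\<close>: the empty
  \<open>S\<close> gives evaluation at \<open>z\<close>, and \<open>S = UNIV\<close> the full
  torus.\<close>

locale Cauchy_polydisc =
  fixes f :: "complex ^ 'd::finite \<Rightarrow> complex" and r :: real
  assumes f: "holomorphic_polydisc f" and r: "0 < r" "r < 1"
begin

definition "U = uniform_measure lborel {0..2 * pi}"
definition "F z = (if z \<in> polydisc then f z else 0)"
definition "ckernel w t = 1 / (1 - w * cis (- t) / complex_of_real r)"
definition pt :: "'d set \<Rightarrow> complex ^ 'd \<Rightarrow> ('d \<Rightarrow> real) \<Rightarrow> complex ^ 'd" where
  "pt S z x = (\<chi> i. if i \<in> S then complex_of_real r * cis (x i) else z $ i)"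

lemma prob_space_U: "prob_space U" unfolding U_def by (rule prob_space_uniform_Icc)

lemma sets_U [simp, measurable_cong]: "sets U = sets borel" by (simp add: U_def)

sublocale U: prob_space U by (rule prob_space_U)

sublocale P: product_prob_space "\<lambda>_::'d. U" UNIV by unfold_locales

lemma F_measurable: "F \<in> borel_measurable borel"
proof -
  have "(\<lambda>z. indicator polydisc z *\<^sub>R f z) \<in> borel_measurable borel"
    using holomorphic_polydisc_continuous[OF f] open_polydisc by (intro borel_measurable_continuous_on_indicator) (auto intro: borel_open)
  moreover have "(\<lambda>z. indicator polydisc z *\<^sub>R f z) = F" by (auto simp: F_def fun_eq_iff indicator_def)
  ultimately show ?thesis by simp
qed

lemma F_bounded: "\<exists>B\<ge>0. \<forall>z :: complex ^ 'd. (\<forall>i. norm (z $ i) \<le> r) \<longrightarrow> norm (F z) \<le> B"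
proof -
  let ?C = "{z :: complex ^ 'd. \<forall>i. norm (z $ i) \<le> r}"
  have sub: "?C \<subseteq> polydisc" using r by (auto simp: polydisc_def intro: le_less_trans)
  have "compact (f ` ?C)"
    by (intro compact_continuous_image compact_polydisc_radius continuous_on_subset[OF holomorphic_polydisc_continuous[OF f] sub])
  then have "bounded (f ` ?C)" by (rule compact_imp_bounded)
  then obtain B where B: "\<forall>w\<in>f ` ?C. norm w \<le> B" unfolding bounded_iff by (rule exE)
  have "norm (F z) \<le> max B 0" if "\<forall>i. norm (z $ i) \<le> r" for z :: "complex ^ 'd"
  proof -
    have "norm (f z) \<le> B" using B that by simp
    then show ?thesis by (simp add: F_def le_max_iff_disj)
  qed
  then show ?thesis by (intro exI[of _ "max B 0"]) simp
qed

lemma norm_pt: "(\<And>i. norm (z $ i) \<le> r) \<Longrightarrow> norm (pt S z x $ i) \<le> r" for z :: "complex ^ 'd"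
  using r by (simp add: pt_def norm_mult)

lemma ckernel_bound: "norm w < r \<Longrightarrow> norm (ckernel w t) \<le> 1 / (1 - norm w / r)"
proof -
  assume w: "norm w < r"
  have "1 - norm w / r \<le> norm (1 - w * cis (- t) / complex_of_real r)"
    using norm_triangle_ineq2[of 1 "w * cis (- t) / complex_of_real r"] r by (simp add: norm_mult norm_divide)
  moreover have "1 - norm w / r > 0" using w r by simp
  ultimately have "1 / norm (1 - w * cis (- t) / complex_of_real r) \<le> 1 / (1 - norm w / r)"
    by (intro divide_left_mono mult_pos_pos) auto
  then show ?thesis by (simp add: ckernel_def norm_divide)
qed

lemma ckernel_measurable: "(\<lambda>t. ckernel w t) \<in> borel_measurable borel"
proof -
  have "(\<lambda>t. cis (- t)) \<in> borel_measurable borel"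
    by (auto intro!: borel_measurable_continuous_onI continuous_intros)
  then have "(\<lambda>t. 1 / (1 - w * cis (- t) / complex_of_real r)) \<in> borel_measurable borel" by measurable
  then show ?thesis by (simp add: ckernel_def)
qed

lemma component_measurable: "i \<in> S \<Longrightarrow> g \<in> borel_measurable borel \<Longrightarrow> (\<lambda>x. g (x i)) \<in> borel_measurable (\<Pi>\<^sub>M i\<in>S. U)"
  for g :: "real \<Rightarrow> complex"
  by (rule measurable_compose[OF measurable_component_singleton[where M = "\<lambda>_. U"]]) (simp_all cong: measurable_cong_sets)

lemma F_pt_measurable: "(\<lambda>x. F (pt S z x)) \<in> borel_measurable (\<Pi>\<^sub>M i\<in>S. U)"
proof (rule measurable_compose[OF _ F_measurable])
  have "(\<lambda>x. if i \<in> S then complex_of_real r * cis (x i) else z $ i) \<in> borel_measurable (\<Pi>\<^sub>M i\<in>S. U)" for i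
    by (cases "i \<in> S") (auto intro!: component_measurable[of i S "\<lambda>t. complex_of_real r * cis t"])
  then show "pt S z \<in> borel_measurable (\<Pi>\<^sub>M i\<in>S. U)"
    unfolding pt_def by (rule borel_measurable_vec_lambda)
qed

text \<open>Induction on \<open>S\<close>. Fubini isolates the new coordinate \<open>j\<close>; with
  the others frozen, the one-variable formula for the slice \<open>h\<close> evaluates the inner
  integral at \<open>z $ j\<close>, which leaves the formula for the smaller set.\<close>

lemma iterated_Cauchy:
  fixes z :: "complex ^ 'd"
  assumes z: "\<And>i. norm (z $ i) < r"
  shows "f z = (\<integral>x. F (pt S z x) * (\<Prod>i\<in>S. ckernel (z $ i) (x i)) \<partial>(\<Pi>\<^sub>M i\<in>S. U))"
proof -
  have "finite S" by simp
  then show ?thesis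
  proof induction
    case empty
    have "z \<in> polydisc" using z r by (auto simp: polydisc_def intro: less_trans)
    then show ?case by (simp add: PiM_empty lebesgue_integral_count_space_finite F_def pt_def)
  next
    case (insert j S)
    obtain B where B0: "B \<ge> 0" and B1: "\<forall>z :: complex ^ 'd. (\<forall>i. norm (z $ i) \<le> r) \<longrightarrow> norm (F z) \<le> B"
      using F_bounded by auto
    have B: "norm (F z) \<le> B" if "\<And>i. norm (z $ i) \<le> r" for z :: "complex ^ 'd" using B1 that by simp
    let ?G = "\<lambda>x. F (pt (insert j S) z x) * (\<Prod>i\<in>insert j S. ckernel (z $ i) (x i))"
    interpret I: prob_space "\<Pi>\<^sub>M i\<in>insert j S. U" by (rule prob_space_PiM) (rule prob_space_U)
    have "integrable (\<Pi>\<^sub>M i\<in>insert j S. U) ?G"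
    proof (rule I.integrable_const_bound[where B = "B * (\<Prod>i\<in>insert j S. 1 / (1 - norm (z $ i) / r))"])
      show "AE x in \<Pi>\<^sub>M i\<in>insert j S. U. norm (?G x) \<le> B * (\<Prod>i\<in>insert j S. 1 / (1 - norm (z $ i) / r))"
        unfolding norm_mult prod_norm[symmetric] using z B0
        by (intro AE_I2 mult_mono prod_mono conjI B ckernel_bound norm_pt prod_nonneg) (auto simp: less_imp_le)
      show "?G \<in> borel_measurable (\<Pi>\<^sub>M i\<in>insert j S. U)"
        by (intro borel_measurable_times borel_measurable_prod F_pt_measurable component_measurable ckernel_measurable)
    qed
    then have "integral\<^sup>L (\<Pi>\<^sub>M i\<in>insert j S. U) ?G = (\<integral>x. (\<integral>y. ?G (x(j := y)) \<partial>U) \<partial>(\<Pi>\<^sub>M i\<in>S. U))"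
      using insert by (intro P.product_integral_insert) auto
    also have "\<dots> = (\<integral>x. F (pt S z x) * (\<Prod>i\<in>S. ckernel (z $ i) (x i)) \<partial>(\<Pi>\<^sub>M i\<in>S. U))"
    proof (intro Bochner_Integration.integral_cong refl)
      fix x :: "'d \<Rightarrow> real"
      define h where "h w = f (\<chi> i. if i = j then w else pt S z x $ i)" for w
      have ptn: "norm (pt S z x $ i) \<le> r" for i using norm_pt z less_imp_le by blast
      have hol: "h holomorphic_on ball 0 1"
        unfolding h_def using ptn r by (intro holomorphic_slice[OF f]) (auto intro: le_less_trans)
      have Fh: "F (\<chi> i. if i = j then w else pt S z x $ i) = h w" if "norm w < 1" for w
      proof -
        have "(\<chi> i. if i = j then w else pt S z x $ i) \<in> polydisc"
          using that ptn r by (auto simp: polydisc_def intro: le_less_trans)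
        then show ?thesis by (simp add: F_def h_def)
      qed
      have "?G (x(j := y)) = (\<Prod>i\<in>S. ckernel (z $ i) (x i)) * (h (of_real r * cis y) * ckernel (z $ j) y)" for y
      proof -
        have "pt (insert j S) z (x(j := y)) = (\<chi> i. if i = j then of_real r * cis y else pt S z x $ i)"
          by (auto simp: pt_def vec_eq_iff)
        moreover have "(\<Prod>i\<in>insert j S. ckernel (z $ i) ((x(j := y)) i)) = ckernel (z $ j) y * (\<Prod>i\<in>S. ckernel (z $ i) (x i))"
          using insert by (auto intro!: prod.cong)
        ultimately show ?thesis using Fh[of "of_real r * cis y"] r by (simp add: norm_mult)
      qed
      then have "(\<integral>y. ?G (x(j := y)) \<partial>U) = (\<Prod>i\<in>S. ckernel (z $ i) (x i)) * (\<integral>y. h (of_real r * cis y) * ckernel (z $ j) y \<partial>U)"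
        by simp
      also have "(\<integral>y. h (of_real r * cis y) * ckernel (z $ j) y \<partial>U) = h (z $ j)"
        unfolding U_def ckernel_def by (rule Cauchy_circle_average[OF hol r z])
      also have "h (z $ j) = F (pt S z x)"
      proof -
        have "(\<chi> i. if i = j then z $ j else pt S z x $ i) = pt S z x"
          using insert by (auto simp: pt_def vec_eq_iff)
        moreover have "norm (z $ j) < 1" using z[of j] r by linarith
        ultimately show ?thesis using Fh[of "z $ j"] by simp
      qed
      also have "(\<Prod>i\<in>S. ckernel (z $ i) (x i)) * F (pt S z x) = F (pt S z x) * (\<Prod>i\<in>S. ckernel (z $ i) (x i))"
        by (rule mult.commute)
      finally show "(\<integral>y. ?G (x(j := y)) \<partial>U) = F (pt S z x) * (\<Prod>i\<in>S. ckernel (z $ i) (x i))" .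
    qed
    also have "\<dots> = f z" using insert by simp
    finally show ?case by simp
  qed
qed

text \<open>Cauchy's integral for the Taylor coefficient at the origin. It depends on
  \<open>r\<close> by definition; \<open>holomorphic_imp_has_coeffs\<close> shows that different
  radii give the same value.\<close>

definition "Cauchy_coeff \<alpha> = (\<integral>x. F (pt UNIV 0 x) * (\<Prod>i\<in>UNIV. (cis (- x i) / of_real r) ^ \<alpha> i) \<partial>(\<Pi>\<^sub>M i\<in>UNIV. U))"

text \<open>Each kernel is a geometric series. Truncating all of them at \<open>N\<close> and
  multiplying out gives exactly a cube sum, and dominated convergence leads to the integral formula
  for \<open>f z\<close>. Cauchy's estimates \<open>cb\<close> supply the absolute summability that
  turns the cube limit into an unconditional sum.\<close>

lemma has_sum_Cauchy_coeff:
  fixes z :: "complex ^ 'd"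
  assumes z: "\<And>i. norm (z $ i) < r"
  shows "((\<lambda>\<alpha>. Cauchy_coeff \<alpha> * mpow z \<alpha>) has_sum f z) UNIV"
proof -
  obtain B where B0: "B \<ge> 0" and B1: "\<forall>z :: complex ^ 'd. (\<forall>i. norm (z $ i) \<le> r) \<longrightarrow> norm (F z) \<le> B"
      using F_bounded by auto
    have B: "norm (F z) \<le> B" if "\<And>i. norm (z $ i) \<le> r" for z :: "complex ^ 'd" using B1 that by simp
  let ?P = "\<Pi>\<^sub>M i\<in>(UNIV::'d set). U"
  have Fb: "norm (F (pt UNIV 0 x)) \<le> B" for x using r by (intro B norm_pt) auto
  have ptz: "pt UNIV z = pt UNIV 0" by (auto simp: pt_def)
  define u where "u i t = z $ i * (cis (- t) / of_real r)" for i t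
  have un: "norm (u i t) = norm (z $ i) / r" for i t using r by (simp add: u_def norm_mult norm_divide)
  have q1: "norm (z $ i) / r < 1" for i using z r by simp
  have powm: "(\<lambda>x. \<Prod>i\<in>UNIV. (cis (- x i) / of_real r) ^ \<alpha> i) \<in> borel_measurable ?P" for \<alpha> :: "'d multiindex"
    using r by (intro borel_measurable_prod component_measurable borel_measurable_continuous_onI continuous_intros) auto
  have ci: "integrable ?P (\<lambda>x. F (pt UNIV 0 x) * (\<Prod>i\<in>UNIV. (cis (- x i) / of_real r) ^ \<alpha> i))" for \<alpha>
  proof (rule P.integrable_const_bound[where B = "B * (\<Prod>i\<in>UNIV. (1 / r) ^ \<alpha> i)"])
    show "AE x in ?P. norm (F (pt UNIV 0 x) * (\<Prod>i\<in>UNIV. (cis (- x i) / of_real r) ^ \<alpha> i)) \<le> B * (\<Prod>i\<in>UNIV. (1 / r) ^ \<alpha> i)"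
      using r Fb by (simp add: norm_mult norm_divide norm_power prod_norm[symmetric] mult_right_mono prod_nonneg)
  qed (intro borel_measurable_times F_pt_measurable powm)
  have cb: "norm (Cauchy_coeff \<alpha>) \<le> B * (\<Prod>i\<in>UNIV. (1 / r) ^ \<alpha> i)" for \<alpha>
  proof -
    have "norm (Cauchy_coeff \<alpha>) \<le> (\<integral>x. norm (F (pt UNIV 0 x) * (\<Prod>i\<in>UNIV. (cis (- x i) / of_real r) ^ \<alpha> i)) \<partial>?P)"
      unfolding Cauchy_coeff_def by (rule integral_norm_bound)
    also have "\<dots> \<le> (\<integral>x. B * (\<Prod>i\<in>UNIV. (1 / r) ^ \<alpha> i) \<partial>?P)"
      using r Fb by (intro integral_mono integrable_norm ci)
        (auto simp: norm_mult norm_divide norm_power prod_norm[symmetric] intro!: mult_right_mono prod_nonneg)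
    finally show ?thesis by (simp add: measure_def P.emeasure_space_1)
  qed
  define g where "g N x = F (pt UNIV 0 x) * (\<Prod>i\<in>UNIV. \<Sum>k<N. u i (x i) ^ k)" for N and x :: "'d \<Rightarrow> real"
  have gsum: "g N x = (\<Sum>\<alpha>\<in>box_index N. (F (pt UNIV 0 x) * (\<Prod>i\<in>UNIV. (cis (- x i) / of_real r) ^ \<alpha> i)) * mpow z \<alpha>)" for N x
  proof -
    have "(\<Prod>i\<in>UNIV. u i (x i) ^ \<alpha> i) = mpow z \<alpha> * (\<Prod>i\<in>UNIV. (cis (- x i) / of_real r) ^ \<alpha> i)" for \<alpha>
      by (simp only: u_def mpow_def power_mult_distrib prod.distrib)
    then show ?thesis
      unfolding g_def sum_box_index_prod[symmetric] sum_distrib_left by (simp only: mult_ac)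
  qed
  have gint: "integral\<^sup>L ?P (g N) = (\<Sum>\<alpha>\<in>box_index N. Cauchy_coeff \<alpha> * mpow z \<alpha>)" for N
    unfolding gsum[abs_def] Cauchy_coeff_def using ci by simp
  have gm: "g N \<in> borel_measurable ?P" for N
    unfolding gsum[abs_def] by (intro borel_measurable_sum borel_measurable_times F_pt_measurable powm borel_measurable_const)
  have "(\<lambda>N. integral\<^sup>L ?P (g N)) \<longlonglongrightarrow> (\<integral>x. F (pt UNIV z x) * (\<Prod>i\<in>UNIV. ckernel (z $ i) (x i)) \<partial>?P)"
  proof (rule integral_dominated_convergence[where w = "\<lambda>_. B * (\<Prod>i\<in>UNIV. 1 / (1 - norm (z $ i) / r))"])
    show "(\<lambda>x. F (pt UNIV z x) * (\<Prod>i\<in>UNIV. ckernel (z $ i) (x i))) \<in> borel_measurable ?P"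
      by (intro borel_measurable_times borel_measurable_prod F_pt_measurable component_measurable ckernel_measurable UNIV_I)
    show "g N \<in> borel_measurable ?P" for N by (rule gm)
    show "AE x in ?P. (\<lambda>N. g N x) \<longlonglongrightarrow> F (pt UNIV z x) * (\<Prod>i\<in>UNIV. ckernel (z $ i) (x i))"
    proof (rule AE_I2)
      fix x
      have "(\<lambda>N. \<Sum>k<N. u i (x i) ^ k) \<longlonglongrightarrow> 1 / (1 - u i (x i))" for i
        using geometric_sums[of "u i (x i)"] un q1 by (simp add: sums_def)
      moreover have "ckernel (z $ i) (x i) = 1 / (1 - u i (x i))" for i by (simp add: ckernel_def u_def)
      ultimately show "(\<lambda>N. g N x) \<longlonglongrightarrow> F (pt UNIV z x) * (\<Prod>i\<in>UNIV. ckernel (z $ i) (x i))"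
        unfolding g_def ptz by (intro tendsto_intros) auto
    qed
    show "AE x in ?P. norm (g N x) \<le> B * (\<Prod>i\<in>UNIV. 1 / (1 - norm (z $ i) / r))" for N
    proof (rule AE_I2)
      fix x
      have "norm (\<Sum>k<N. u i (x i) ^ k) \<le> 1 / (1 - norm (z $ i) / r)" for i
      proof -
        have "norm (\<Sum>k<N. u i (x i) ^ k) \<le> (\<Sum>k<N. (norm (z $ i) / r) ^ k)"
          by (intro sum_norm_le) (simp add: norm_power un)
        also have "\<dots> \<le> (\<Sum>k. (norm (z $ i) / r) ^ k)"
          using r q1[of i] by (intro sum_le_suminf summable_geometric) auto
        also have "\<dots> = 1 / (1 - norm (z $ i) / r)"
          using r q1[of i] by (intro suminf_geometric) auto
        finally show ?thesis .
      qed
      then show "norm (g N x) \<le> B * (\<Prod>i\<in>UNIV. 1 / (1 - norm (z $ i) / r))"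
        unfolding g_def norm_mult prod_norm[symmetric] using Fb B0
        by (intro mult_mono prod_mono prod_nonneg) auto
    qed
  qed simp
  then have lim: "(\<lambda>N. \<Sum>\<alpha>\<in>box_index N. Cauchy_coeff \<alpha> * mpow z \<alpha>) \<longlonglongrightarrow> f z"
    unfolding gint iterated_Cauchy[OF z, of UNIV, symmetric] .
  have "(\<lambda>\<alpha>. norm (Cauchy_coeff \<alpha> * mpow z \<alpha>)) summable_on UNIV"
  proof (rule summable_on_comparison_test)
    show "(\<lambda>\<alpha>. B * (\<Prod>i\<in>UNIV. (norm (z $ i) / r) ^ \<alpha> i)) summable_on UNIV"
      using r q1 by (intro summable_on_cmult_right summable_on_prod_multiindex summable_geometric) auto
    fix \<alpha>
    have "norm (Cauchy_coeff \<alpha>) * norm (mpow z \<alpha>) \<le> (B * (\<Prod>i\<in>UNIV. (1 / r) ^ \<alpha> i)) * (\<Prod>i\<in>UNIV. norm (z $ i) ^ \<alpha> i)"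
      unfolding norm_mpow by (intro mult_right_mono cb prod_nonneg) auto
    also have "\<dots> = B * (\<Prod>i\<in>UNIV. (norm (z $ i) / r) ^ \<alpha> i)"
      by (simp add: power_divide prod.distrib[symmetric])
    finally show "norm (Cauchy_coeff \<alpha> * mpow z \<alpha>) \<le> B * (\<Prod>i\<in>UNIV. (norm (z $ i) / r) ^ \<alpha> i)"
      by (simp add: norm_mult)
  qed auto
  then show ?thesis using lim by (rule has_sum_box_indexI)
qed

end

section \<open>Uniqueness and existence of Taylor coefficients\<close>

lemma nn_integral_count_space_eq_0:
  "(\<integral>\<^sup>+a. f a \<partial>count_space UNIV) = 0 \<Longrightarrow> f a = 0"
  by (subst (asm) nn_integral_0_iff_AE) (auto simp: AE_count_space)

lemma has_coeffs_diff:
  assumes "has_coeffs f c" "has_coeffs g d"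
  shows "has_coeffs (\<lambda>z. f z - g z) (\<lambda>\<alpha>. c \<alpha> - d \<alpha>)"
  unfolding has_coeffs_def
proof
  fix z :: "complex ^ 'a" assume "z \<in> polydisc"
  then have "((\<lambda>\<alpha>. c \<alpha> * mpow z \<alpha> + - (d \<alpha> * mpow z \<alpha>)) has_sum (f z + - g z)) UNIV"
    using assms unfolding has_coeffs_def by (intro has_sum_add has_sum_uminusI) auto
  then show "((\<lambda>\<alpha>. (c \<alpha> - d \<alpha>) * mpow z \<alpha>) has_sum (f z - g z)) UNIV"
    by (simp add: left_diff_distrib)
qed

text \<open>The difference of the two sequences represents the zero function, whose Hardy norm is 0,
  so Parseval's identity makes each of its terms vanish.\<close>

lemma has_coeffs_unique:
  assumes "has_coeffs f c" "has_coeffs f d"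
  shows "c = d"
proof
  fix \<alpha>
  have "has_coeffs (\<lambda>_ :: complex ^ 'a. 0) (\<lambda>\<alpha>. c \<alpha> - d \<alpha>)"
    using has_coeffs_diff[OF assms] by simp
  then have "coeff_norm (bergman_weight (-1)) (\<lambda>\<alpha>. c \<alpha> - d \<alpha>) = bergman_sqnorm (-1) (\<lambda>_ :: complex ^ 'a. 0)"
    by (rule hardy_sqnorm[symmetric])
  also have "\<dots> = 0" by (simp add: bergman_sqnorm_def)
  finally have "ennreal (bergman_weight (-1) \<alpha> * (norm (c \<alpha> - d \<alpha>))\<^sup>2) = 0"
    unfolding coeff_norm_def by (rule nn_integral_count_space_eq_0)
  then show "c \<alpha> = d \<alpha>" by simp
qed

lemma rpow_pos: "r > 0 \<Longrightarrow> rpow r \<alpha> > 0"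
  by (simp add: rpow_def prod_pos)

text \<open>Each radius yields its own sequence \<open>d n\<close>, valid on the polydisc of that
  radius. The dilate of \<open>f\<close> by the smallest radius is represented on the whole polydisc
  by all of them, so uniqueness makes them equal, and large \<open>n\<close> reach every
  point.\<close>

lemma holomorphic_imp_has_coeffs:
  fixes f :: "complex ^ 'd::finite \<Rightarrow> complex"
  assumes f: "holomorphic_polydisc f"
  obtains c where "has_coeffs f c"
proof -
  have loc: "Cauchy_polydisc f (radius n)" for n
    using f radius_bounds[of n] by unfold_locales
  define d where "d n = Cauchy_polydisc.Cauchy_coeff f (radius n)" for n
  have d: "((\<lambda>\<alpha>. d n \<alpha> * mpow z \<alpha>) has_sum f z) UNIV" if "\<And>i. norm (z $ i) < radius n" for n and z :: "complex ^ 'd"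
    unfolding d_def using that by (rule Cauchy_polydisc.has_sum_Cauchy_coeff[OF loc])
  have mono: "radius 0 \<le> radius n" for n
    by (rule lift_Suc_mono_le[of radius 0 n]) (rule radius_bounds(3), simp)
  have sc: "has_coeffs (\<lambda>z. f (radius 0 *\<^sub>R z)) (\<lambda>\<alpha>. d n \<alpha> * of_real (rpow (radius 0) \<alpha>))" for n
    unfolding has_coeffs_def
  proof
    fix z :: "complex ^ 'd" assume z: "z \<in> polydisc"
    have "norm ((radius 0 *\<^sub>R z) $ i) < radius n" for i
    proof -
      have "norm ((radius 0 *\<^sub>R z) $ i) < radius 0"
        using z radius_bounds(1)[of 0] by (simp add: polydisc_def)
      then show ?thesis using mono[of n] by linarith
    qed
    from d[OF this] show "((\<lambda>\<alpha>. d n \<alpha> * of_real (rpow (radius 0) \<alpha>) * mpow z \<alpha>) has_sum f (radius 0 *\<^sub>R z)) UNIV"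
      by (simp add: mpow_scaleR mult.assoc)
  qed
  have eq: "d n = d 0" for n
  proof
    fix \<alpha>
    show "d n \<alpha> = d 0 \<alpha>"
      using fun_cong[OF has_coeffs_unique[OF sc[of n] sc[of 0]], of \<alpha>] rpow_pos[OF radius_bounds(1)[of 0], of \<alpha>]
      by simp
  qed
  have "has_coeffs f (d 0)"
    unfolding has_coeffs_def
  proof
    fix z :: "complex ^ 'd" assume "z \<in> polydisc"
    then obtain \<rho> where "0 < \<rho>" and \<rho>: "\<rho> < 1" "\<And>i. norm (z $ i) < \<rho>"
      by (rule norm_polydisc_obtain_radius) (rule that)
    obtain n where n: "\<rho> < radius n" using radius_eventually_gt[OF \<rho>(1)] by (rule exE)
    have "norm (z $ i) < radius n" for i using \<rho>(2)[of i] n by linarith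
    from d[OF this] show "((\<lambda>\<alpha>. d 0 \<alpha> * mpow z \<alpha>) has_sum f z) UNIV" by (simp only: eq[of n])
  qed
  then show ?thesis by (rule that)
qed

section \<open>Composition operators as matrices\<close>

text \<open>The Cauchy product: the double series is absolutely summable and may be regrouped along
  \<nu> = \<alpha> + \<alpha>'.\<close>

lemma has_coeffs_mult:
  fixes f g :: "complex ^ 'd::finite \<Rightarrow> complex"
  assumes f: "has_coeffs f c" and g: "has_coeffs g d"
  shows "has_coeffs (\<lambda>z. f z * g z) (\<lambda>\<nu>. \<Sum>\<beta>\<in>{..\<nu>}. c \<beta> * d (\<nu> - \<beta>))"
  unfolding has_coeffs_def
proof
  fix z :: "complex ^ 'd" assume z: "z \<in> polydisc"
  let ?a = "\<lambda>\<alpha>. c \<alpha> * mpow z \<alpha>" and ?b = "\<lambda>\<alpha>. d \<alpha> * mpow z \<alpha>"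
  have a: "(?a has_sum f z) UNIV" and b: "(?b has_sum g z) UNIV"
    using f g z by (simp_all add: has_coeffs_def)
  have as: "(\<lambda>\<alpha>. norm (?a \<alpha>)) summable_on UNIV" and bs: "(\<lambda>\<alpha>. norm (?b \<alpha>)) summable_on UNIV"
    using a b has_sum_imp_summable summable_on_iff_abs_summable_on_complex by metis+
  let ?p = "\<lambda>(\<alpha>, \<alpha>'). ?a \<alpha> * ?b \<alpha>'"
  have "(\<lambda>x. norm (?p x)) summable_on (UNIV \<times> UNIV)"
  proof (rule Infinite_Sum.abs_summable_on_Sigma_iff[where f = ?p and A = UNIV and B = "\<lambda>_. UNIV", THEN iffD2], intro conjI ballI)
    fix \<alpha>
    show "(\<lambda>y. norm (?p (\<alpha>, y))) summable_on UNIV"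
      using bs by (simp add: norm_mult summable_on_cmult_right mult.assoc)
  next
    have "(\<Sum>\<^sub>\<infinity>y. norm (?p (\<alpha>, y))) = norm (?a \<alpha>) * (\<Sum>\<^sub>\<infinity>y. norm (?b y))" for \<alpha>
      by (simp only: prod.case norm_mult[of "?a \<alpha>"]) (rule infsum_cmult_right[OF bs])
    moreover have "(\<lambda>\<alpha>. norm (norm (?a \<alpha>) * K)) summable_on UNIV" for K :: real
    proof -
      have "(\<lambda>\<alpha>. norm (?a \<alpha>) * \<bar>K\<bar>) summable_on UNIV" by (rule summable_on_cmult_left[OF as])
      moreover have "norm (norm (?a \<alpha>) * K) = norm (?a \<alpha>) * \<bar>K\<bar>" for \<alpha>
        by (simp only: real_norm_def abs_mult abs_norm_cancel)
      ultimately show ?thesis by (simp only:)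
    qed
    ultimately show "(\<lambda>x. norm (\<Sum>\<^sub>\<infinity>y. norm (?p (x, y)))) summable_on UNIV" by (simp only:)
  qed
  then have ps: "?p summable_on (UNIV \<times> UNIV)" by (rule abs_summable_summable)
  have "(?p has_sum (f z * g z)) (UNIV \<times> UNIV)"
  proof (rule has_sum_SigmaI[OF _ _ ps])
    show "((\<lambda>y. ?p (\<alpha>, y)) has_sum (?a \<alpha> * g z)) UNIV" for \<alpha>
      using has_sum_cmult_right[OF b, of "?a \<alpha>"] by simp
    show "((\<lambda>\<alpha>. ?a \<alpha> * g z) has_sum (f z * g z)) UNIV"
      by (rule has_sum_cmult_left[OF a])
  qed
  also have "(?p has_sum (f z * g z)) (UNIV \<times> UNIV) \<longleftrightarrow>
     ((\<lambda>(\<nu>, \<beta>). c \<beta> * d (\<nu> - \<beta>) * mpow z \<nu>) has_sum (f z * g z)) (Sigma UNIV atMost)"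
  proof (rule has_sum_reindex_bij_witness[where j = "\<lambda>(\<alpha>, \<alpha>'). (\<lambda>i. \<alpha> i + \<alpha>' i, \<alpha>)" and i = "\<lambda>(\<nu>, \<beta>). (\<beta>, \<nu> - \<beta>)"])
    fix x :: "'d multiindex \<times> 'd multiindex"
    obtain \<alpha> \<alpha>' where x: "x = (\<alpha>, \<alpha>')" by (cases x)
    have "(\<lambda>i. \<alpha> i + \<alpha>' i) - \<alpha> = \<alpha>'" by (simp add: fun_eq_iff)
    moreover have "mpow z (\<lambda>i. \<alpha> i + \<alpha>' i) = mpow z \<alpha> * mpow z \<alpha>'"
      by (simp add: mpow_def power_add prod.distrib)
    ultimately show "(case case x of (\<alpha>, \<alpha>') \<Rightarrow> (\<lambda>i. \<alpha> i + \<alpha>' i, \<alpha>) of (\<nu>, \<beta>) \<Rightarrow> c \<beta> * d (\<nu> - \<beta>) * mpow z \<nu>) = ?p x"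
      by (simp add: x mult_ac)
  qed (auto simp: fun_eq_iff le_fun_def)
  finally have "((\<lambda>(\<nu>, \<beta>). c \<beta> * d (\<nu> - \<beta>) * mpow z \<nu>) has_sum (f z * g z)) (Sigma UNIV atMost)" .
  then show "((\<lambda>\<nu>. (\<Sum>\<beta>\<in>{..\<nu>}. c \<beta> * d (\<nu> - \<beta>)) * mpow z \<nu>) has_sum (f z * g z)) UNIV"
    by (rule has_sum_SigmaD) (simp add: sum_distrib_right has_sum_finite)
qed

lemma has_coeffs_zero: "has_coeffs (\<lambda>_. 0) (\<lambda>_. 0)"
  by (simp add: has_coeffs_def)

lemma has_coeffs_add:
  assumes "has_coeffs f c" "has_coeffs g d"
  shows "has_coeffs (\<lambda>z. f z + g z) (\<lambda>\<alpha>. c \<alpha> + d \<alpha>)"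
  using assms unfolding has_coeffs_def distrib_right by (intro ballI has_sum_add) auto

lemma has_coeffs_cmult:
  assumes "has_coeffs f c"
  shows "has_coeffs (\<lambda>z. f z * k) (\<lambda>\<alpha>. c \<alpha> * k)"
  unfolding has_coeffs_def
proof
  fix z :: "complex ^ 'a" assume "z \<in> polydisc"
  then have "((\<lambda>\<alpha>. c \<alpha> * mpow z \<alpha>) has_sum f z) UNIV" using assms by (simp add: has_coeffs_def)
  from has_sum_cmult_left[OF this, of k]
  show "((\<lambda>\<alpha>. c \<alpha> * k * mpow z \<alpha>) has_sum f z * k) UNIV" by (simp add: mult_ac)
qed

lemma has_coeffs_sum:
  assumes "finite S" "\<And>a. a \<in> S \<Longrightarrow> has_coeffs (f a) (c a)"
  shows "has_coeffs (\<lambda>z. \<Sum>a\<in>S. f a z) (\<lambda>\<alpha>. \<Sum>a\<in>S. c a \<alpha>)"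
  using assms by (induction rule: finite_induct) (auto simp: has_coeffs_zero intro: has_coeffs_add)

lemma has_coeffs_polynomial:
  assumes "finite S"
  shows "has_coeffs (\<lambda>z. \<Sum>a\<in>S. x a * mpow z a) (\<lambda>\<alpha>. if \<alpha> \<in> S then x \<alpha> else 0)"
  unfolding has_coeffs_def
proof
  fix z :: "complex ^ 'a"
  show "((\<lambda>\<alpha>. (if \<alpha> \<in> S then x \<alpha> else 0) * mpow z \<alpha>) has_sum (\<Sum>a\<in>S. x a * mpow z a)) UNIV"
    by (rule has_sum_finite_neutralI[OF assms]) auto
qed

definition coeffs_of :: "(complex ^ 'd::finite \<Rightarrow> complex) \<Rightarrow> 'd multiindex \<Rightarrow> complex" where
  "coeffs_of f = (SOME c. has_coeffs f c)"

lemma has_coeffs_coeffs_of: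
  assumes "holomorphic_polydisc f"
  shows "has_coeffs f (coeffs_of f)"
proof -
  obtain c where "has_coeffs f c" using holomorphic_imp_has_coeffs[OF assms] .
  then show ?thesis unfolding coeffs_of_def by (rule someI[of "has_coeffs f"])
qed

lemma bergman_space_iff:
  assumes "\<beta> \<ge> -1" "has_coeffs f c"
  shows "f \<in> bergman_space \<beta> \<longleftrightarrow> coeff_norm (bergman_weight \<beta>) c < \<infinity>"
  using bergman_sqnorm_eq_coeff_norm[OF assms has_coeffs_imp_holomorphic[OF assms(2)]]
    has_coeffs_imp_holomorphic[OF assms(2)] by (simp add: bergman_space_def)

lemma bergman_norm_eq:
  assumes "\<beta> \<ge> -1" "has_coeffs f c"
  shows "bergman_norm \<beta> f = sqrt (enn2real (coeff_norm (bergman_weight \<beta>) c))"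
  using bergman_sqnorm_eq_coeff_norm[OF assms has_coeffs_imp_holomorphic[OF assms(2)]]
  by (simp add: bergman_norm_def)

lemma holomorphic_compose_self_map:
  fixes f :: "complex ^ 'd::finite \<Rightarrow> complex"
  assumes f: "holomorphic_polydisc f" and \<phi>: "holomorphic_self_map \<phi>"
  shows "holomorphic_polydisc (\<lambda>z. f (\<phi> z))"
  unfolding holomorphic_polydisc_def
proof
  fix z :: "complex ^ 'd" assume z: "z \<in> polydisc"
  then have "\<forall>i. \<exists>a :: complex ^ 'd. ((\<lambda>z. \<phi> z $ i) has_derivative (\<lambda>h. \<Sum>j\<in>UNIV. a $ j * h $ j)) (at z)"
    using \<phi> unfolding holomorphic_self_map_def holomorphic_polydisc_def by simp
  then obtain A where A: "\<forall>i. ((\<lambda>z. \<phi> z $ i) has_derivative (\<lambda>h. \<Sum>j\<in>UNIV. (A i :: complex ^ 'd) $ j * h $ j)) (at z)"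
    by (rule choice[THEN exE])
  have \<phi>d: "(\<phi> has_derivative (\<lambda>h. \<chi> i. \<Sum>j\<in>UNIV. A i $ j * h $ j)) (at z)"
  proof (subst has_derivative_componentwise_within, rule ballI)
    fix b :: "complex ^ 'd" assume "b \<in> Basis"
    then obtain i u where b: "b = axis i u" by (auto simp: Basis_vec_def)
    have "((\<lambda>z. \<phi> z $ i \<bullet> u) has_derivative (\<lambda>h. (\<Sum>j\<in>UNIV. A i $ j * h $ j) \<bullet> u)) (at z)"
      by (rule has_derivative_inner_left) (use A in simp)
    then show "((\<lambda>z. \<phi> z \<bullet> b) has_derivative (\<lambda>h. (\<chi> i. \<Sum>j\<in>UNIV. A i $ j * h $ j) \<bullet> b)) (at z)"
      by (simp add: b inner_axis)
  qed
  have "\<phi> z \<in> polydisc" using z \<phi> by (auto simp: holomorphic_self_map_def)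
  with f have "\<exists>B :: complex ^ 'd. (f has_derivative (\<lambda>h. \<Sum>j\<in>UNIV. B $ j * h $ j)) (at (\<phi> z))"
    unfolding holomorphic_polydisc_def by simp
  then obtain B :: "complex ^ 'd" where B: "(f has_derivative (\<lambda>h. \<Sum>j\<in>UNIV. B $ j * h $ j)) (at (\<phi> z))"
    by (rule exE)
  have "((\<lambda>z. f (\<phi> z)) has_derivative (\<lambda>h. \<Sum>i\<in>UNIV. B $ i * (\<Sum>j\<in>UNIV. A i $ j * h $ j))) (at z)"
    using has_derivative_compose[OF \<phi>d B] by simp
  moreover have "(\<Sum>i\<in>UNIV. B $ i * (\<Sum>j\<in>UNIV. A i $ j * h $ j)) = (\<Sum>j\<in>UNIV. (\<chi> j. \<Sum>i\<in>UNIV. B $ i * A i $ j) $ j * h $ j)"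
    for h :: "complex ^ 'd"
  proof -
    have "(\<Sum>i\<in>UNIV. B $ i * (\<Sum>j\<in>UNIV. A i $ j * h $ j)) = (\<Sum>i\<in>UNIV. \<Sum>j\<in>UNIV. B $ i * A i $ j * h $ j)"
      by (simp only: sum_distrib_left mult.assoc)
    also have "\<dots> = (\<Sum>j\<in>UNIV. \<Sum>i\<in>UNIV. B $ i * A i $ j * h $ j)" by (rule sum.swap)
    finally show ?thesis by (simp add: sum_distrib_right)
  qed
  ultimately have "((\<lambda>z. f (\<phi> z)) has_derivative (\<lambda>h. \<Sum>j\<in>UNIV. (\<chi> j. \<Sum>i\<in>UNIV. B $ i * A i $ j) $ j * h $ j)) (at z)"
    by (simp only:)
  then show "\<exists>a :: complex ^ 'd. ((\<lambda>z. f (\<phi> z)) has_derivative (\<lambda>h. \<Sum>j\<in>UNIV. a $ j * h $ j)) (at z)"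
    by (rule exI)
qed

text \<open>The matrix of the composition operator in the monomial basis: column \<mu> holds the
  coefficients of the image of z^\<mu>.\<close>

definition comp_matrix :: "(complex ^ 'd::finite \<Rightarrow> complex ^ 'd) \<Rightarrow> 'd multiindex \<Rightarrow> 'd multiindex \<Rightarrow> complex" where
  "comp_matrix \<phi> \<nu> \<mu> = coeffs_of (\<lambda>z. mpow (\<phi> z) \<mu>) \<nu>"

lemma holomorphic_mpow: "holomorphic_polydisc (\<lambda>z. mpow z \<mu>)"
  by (rule has_coeffs_imp_holomorphic) (use has_coeffs_polynomial[of "{\<mu>}" "\<lambda>_. 1"] in simp)

lemma has_coeffs_comp_matrix:
  assumes "holomorphic_self_map \<phi>"
  shows "has_coeffs (\<lambda>z. mpow (\<phi> z) \<mu>) (\<lambda>\<nu>. comp_matrix \<phi> \<nu> \<mu>)"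
  unfolding comp_matrix_def
  by (rule has_coeffs_coeffs_of[OF holomorphic_compose_self_map[OF holomorphic_mpow assms]])

text \<open>Composition is multiplicative: the image of z^\<mu> is the product of the images of
  z^\<alpha> and z^(\<mu> - \<alpha>), and coefficients of products are convolutions. This is the
  hypothesis on \<open>t\<close> in \<open>mat_bound_square\<close>.\<close>

lemma comp_matrix_split:
  assumes \<phi>: "holomorphic_self_map \<phi>" and "\<alpha> \<le> \<mu>"
  shows "comp_matrix \<phi> \<nu> \<mu> = (\<Sum>\<beta>\<in>{..\<nu>}. comp_matrix \<phi> \<beta> \<alpha> * comp_matrix \<phi> (\<nu> - \<beta>) (\<mu> - \<alpha>))"
proof -
  have "mpow z \<alpha> * mpow z (\<mu> - \<alpha>) = mpow z \<mu>" for z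
    using assms(2) by (simp add: mpow_def prod.distrib[symmetric] power_add[symmetric] le_fun_def)
  then have "has_coeffs (\<lambda>z. mpow (\<phi> z) \<mu>) (\<lambda>\<nu>. \<Sum>\<beta>\<in>{..\<nu>}. comp_matrix \<phi> \<beta> \<alpha> * comp_matrix \<phi> (\<nu> - \<beta>) (\<mu> - \<alpha>))"
    using has_coeffs_mult[OF has_coeffs_comp_matrix[OF \<phi>, of \<alpha>] has_coeffs_comp_matrix[OF \<phi>, of "\<mu> - \<alpha>"]]
    by (simp only:)
  from has_coeffs_unique[OF has_coeffs_comp_matrix[OF \<phi>] this]
  show ?thesis by (rule fun_cong)
qed

lemma has_coeffs_comp_polynomial:
  assumes "holomorphic_self_map \<phi>" "finite S"
  shows "has_coeffs (\<lambda>z. \<Sum>a\<in>S. x a * mpow (\<phi> z) a) (\<lambda>\<nu>. \<Sum>a\<in>S. comp_matrix \<phi> \<nu> a * x a)"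
proof -
  have "has_coeffs (\<lambda>z. \<Sum>a\<in>S. mpow (\<phi> z) a * x a) (\<lambda>\<nu>. \<Sum>a\<in>S. comp_matrix \<phi> \<nu> a * x a)"
    by (rule has_coeffs_sum[OF assms(2)], rule has_coeffs_cmult, rule has_coeffs_comp_matrix[OF assms(1)])
  then show ?thesis by (simp only: mult.commute)
qed

section \<open>Estimates in weighted coefficient norms and pointwise bounds\<close>

lemma coeff_norm_ge:
  "ennreal (w \<alpha> * (norm (c \<alpha>))\<^sup>2) \<le> coeff_norm w c"
proof -
  have "ennreal (w \<alpha> * (norm (c \<alpha>))\<^sup>2) = (\<integral>\<^sup>+\<beta>. ennreal (w \<beta> * (norm (c \<beta>))\<^sup>2) * indicator {\<alpha>} \<beta> \<partial>count_space UNIV)"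
    by (subst nn_integral_count_space_indicator[symmetric]) (simp_all add: nn_integral_count_space_finite)
  also have "\<dots> \<le> coeff_norm w c"
    unfolding coeff_norm_def by (intro nn_integral_mono) (auto simp: indicator_def)
  finally show ?thesis .
qed

lemma coeff_norm_mono: "(\<And>\<alpha>. u \<alpha> \<le> w \<alpha>) \<Longrightarrow> coeff_norm u c \<le> coeff_norm w c"
  unfolding coeff_norm_def by (intro nn_integral_mono ennreal_leI mult_right_mono) auto

lemma coeff_norm_add_le:
  assumes "\<And>\<alpha>. w \<alpha> \<ge> 0"
  shows "coeff_norm w (\<lambda>\<alpha>. c \<alpha> + d \<alpha>) \<le> 2 * coeff_norm w c + 2 * coeff_norm w d"
proof -
  have "w \<alpha> * (norm (c \<alpha> + d \<alpha>))\<^sup>2 \<le> 2 * (w \<alpha> * (norm (c \<alpha>))\<^sup>2) + 2 * (w \<alpha> * (norm (d \<alpha>))\<^sup>2)" for \<alpha>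
  proof -
    have "(norm (c \<alpha> + d \<alpha>))\<^sup>2 \<le> (norm (c \<alpha>) + norm (d \<alpha>))\<^sup>2"
      by (intro power_mono norm_triangle_ineq) auto
    also have "\<dots> \<le> 2 * (norm (c \<alpha>))\<^sup>2 + 2 * (norm (d \<alpha>))\<^sup>2"
      using sum_squares_bound[of "norm (c \<alpha>)" "norm (d \<alpha>)"] by (simp add: power2_sum)
    finally have "w \<alpha> * (norm (c \<alpha> + d \<alpha>))\<^sup>2 \<le> w \<alpha> * (2 * (norm (c \<alpha>))\<^sup>2 + 2 * (norm (d \<alpha>))\<^sup>2)"
      using assms by (rule mult_left_mono)
    then show ?thesis by (simp add: algebra_simps)
  qed
  then have "coeff_norm w (\<lambda>\<alpha>. c \<alpha> + d \<alpha>) \<le> (\<integral>\<^sup>+\<alpha>. 2 * ennreal (w \<alpha> * (norm (c \<alpha>))\<^sup>2) + 2 * ennreal (w \<alpha> * (norm (d \<alpha>))\<^sup>2) \<partial>count_space UNIV)"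
    unfolding coeff_norm_def using assms
    by (intro nn_integral_mono) (auto simp: ennreal_mult'[symmetric] ennreal_plus[symmetric] ennreal_numeral[symmetric] simp del: ennreal_plus ennreal_numeral intro!: ennreal_leI)
  also have "\<dots> = 2 * coeff_norm w c + 2 * coeff_norm w d"
    unfolding coeff_norm_def by (simp add: nn_integral_add nn_integral_cmult)
  finally show ?thesis .
qed

lemma coeff_norm_diff_le:
  assumes "\<And>\<alpha>. w \<alpha> \<ge> 0"
  shows "coeff_norm w (\<lambda>\<alpha>. c \<alpha> - d \<alpha>) \<le> 2 * coeff_norm w c + 2 * coeff_norm w d"
  using coeff_norm_add_le[where w = w and c = c and d = "\<lambda>\<alpha>. - d \<alpha>", OF assms] by (simp add: coeff_norm_def)

lemma coeff_norm_diff_le_square: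
  assumes w: "\<And>\<alpha>. w \<alpha> \<ge> 0" and c: "coeff_norm w c \<le> ennreal (C\<^sup>2)" and d: "coeff_norm w d \<le> ennreal (C\<^sup>2)"
  shows "coeff_norm w (\<lambda>\<alpha>. c \<alpha> - d \<alpha>) \<le> ennreal ((2 * C)\<^sup>2)"
proof -
  have "coeff_norm w (\<lambda>\<alpha>. c \<alpha> - d \<alpha>) \<le> 2 * coeff_norm w c + 2 * coeff_norm w d"
    by (rule coeff_norm_diff_le) (rule w)
  also have "\<dots> \<le> 2 * ennreal (C\<^sup>2) + 2 * ennreal (C\<^sup>2)" by (intro add_mono mult_left_mono c d) auto
  also have "\<dots> = ennreal ((2 * C)\<^sup>2)"
    by (simp add: ennreal_plus[symmetric] ennreal_mult'[symmetric] power_mult_distrib ennreal_numeral[symmetric] del: ennreal_plus ennreal_numeral)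
  finally show ?thesis .
qed

lemma coeff_norm_Fatou:
  assumes lim: "\<And>\<alpha>. (\<lambda>n. c n \<alpha>) \<longlonglongrightarrow> d \<alpha>" and b: "\<And>n. coeff_norm w (c n) \<le> C"
  shows "coeff_norm w d \<le> C"
proof -
  have "coeff_norm w d = (\<integral>\<^sup>+\<alpha>. liminf (\<lambda>n. ennreal (w \<alpha> * (norm (c n \<alpha>))\<^sup>2)) \<partial>count_space UNIV)"
    unfolding coeff_norm_def
  proof (rule nn_integral_cong)
    fix \<alpha>
    have "(\<lambda>n. ennreal (w \<alpha> * (norm (c n \<alpha>))\<^sup>2)) \<longlonglongrightarrow> ennreal (w \<alpha> * (norm (d \<alpha>))\<^sup>2)"
      by (intro tendsto_intros tendsto_ennrealI lim)
    then show "ennreal (w \<alpha> * (norm (d \<alpha>))\<^sup>2) = liminf (\<lambda>n. ennreal (w \<alpha> * (norm (c n \<alpha>))\<^sup>2))"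
      by (intro lim_imp_Liminf[symmetric]) auto
  qed
  also have "\<dots> \<le> liminf (\<lambda>n. coeff_norm w (c n))"
    unfolding coeff_norm_def by (rule nn_integral_liminf) simp
  also have "\<dots> \<le> liminf (\<lambda>n. C)" by (intro Liminf_mono always_eventually allI b)
  finally show ?thesis by (simp add: Liminf_const)
qed

lemma coeff_norm_truncate:
  "coeff_norm w (\<lambda>\<alpha>. if \<alpha> \<in> box_index N then c \<alpha> else 0) = (\<Sum>\<alpha>\<in>box_index N. ennreal (w \<alpha> * (norm (c \<alpha>))\<^sup>2))"
proof -
  have "coeff_norm w (\<lambda>\<alpha>. if \<alpha> \<in> box_index N then c \<alpha> else 0)
    = (\<integral>\<^sup>+\<alpha>. ennreal (w \<alpha> * (norm (c \<alpha>))\<^sup>2) * indicator (box_index N) \<alpha> \<partial>count_space UNIV)"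
    unfolding coeff_norm_def by (intro nn_integral_cong) (auto simp: indicator_def)
  also have "\<dots> = (\<Sum>\<alpha>\<in>box_index N. ennreal (w \<alpha> * (norm (c \<alpha>))\<^sup>2))"
    by (subst nn_integral_count_space_indicator[symmetric]) (simp_all add: nn_integral_count_space_finite)
  finally show ?thesis .
qed

lemma coeff_norm_truncate_le: "coeff_norm w (\<lambda>\<alpha>. if \<alpha> \<in> box_index N then c \<alpha> else 0) \<le> coeff_norm w c"
  unfolding coeff_norm_def by (intro nn_integral_mono) auto

lemma coefficient_bound:
  assumes b: "\<beta> \<ge> -1" and C: "C \<ge> 0" and c: "coeff_norm (bergman_weight \<beta>) c \<le> ennreal (C\<^sup>2)"
  shows "norm (c \<alpha>) \<le> C / sqrt (bergman_weight \<beta> \<alpha>)"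
proof -
  have p: "bergman_weight \<beta> \<alpha> > 0" using b by simp
  have "ennreal (bergman_weight \<beta> \<alpha> * (norm (c \<alpha>))\<^sup>2) \<le> ennreal (C\<^sup>2)"
    using coeff_norm_ge c by (rule order_trans)
  then have "bergman_weight \<beta> \<alpha> * (norm (c \<alpha>))\<^sup>2 \<le> C\<^sup>2" by (simp add: ennreal_le_iff)
  then have "(sqrt (bergman_weight \<beta> \<alpha>) * norm (c \<alpha>))\<^sup>2 \<le> C\<^sup>2"
    using p by (simp add: power_mult_distrib)
  then have "sqrt (bergman_weight \<beta> \<alpha>) * norm (c \<alpha>) \<le> C" using C by (rule power2_le_imp_le)
  then show ?thesis using p by (simp add: field_simps)
qed

lemma summable_rpow_over_weight:
  assumes "\<beta> \<ge> -1" "0 \<le> \<rho>" "\<rho> < 1"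
  shows "(\<lambda>\<alpha>::'d::finite multiindex. C / sqrt (bergman_weight \<beta> \<alpha>) * rpow \<rho> \<alpha>) summable_on UNIV"
proof -
  have "(\<lambda>\<alpha>::'d multiindex. \<Prod>i\<in>UNIV. \<rho> ^ \<alpha> i / sqrt (bergman_weight1 \<beta> (\<alpha> i))) summable_on UNIV"
    using summable_power_over_weight1[OF assms] assms
    by (intro summable_on_prod_multiindex) (auto simp: less_imp_le)
  moreover have "sqrt (\<Prod>i\<in>A. f i) = (\<Prod>i\<in>A. sqrt (f i))" for f :: "'d \<Rightarrow> real" and A
    by (induction A rule: infinite_finite_induct) (auto simp: real_sqrt_mult)
  ultimately have "(\<lambda>\<alpha>::'d multiindex. rpow \<rho> \<alpha> / sqrt (bergman_weight \<beta> \<alpha>)) summable_on UNIV"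
    by (simp add: rpow_def bergman_weight_def prod_dividef)
  from summable_on_cmult_right[OF this, of C] show ?thesis by simp
qed

text \<open>A finite norm bounds each coefficient by
  \<open>C / sqrt (bergman_weight \<beta> \<alpha>)\<close>, and this still gives absolute
  convergence inside the polydisc. The limit function in the compactness proof is built this way
  from its coefficients.\<close>

lemma has_coeffs_of_coeff_norm:
  fixes c :: "'d::finite multiindex \<Rightarrow> complex"
  assumes b: "\<beta> \<ge> -1" and C: "C \<ge> 0" and c: "coeff_norm (bergman_weight \<beta>) c \<le> ennreal (C\<^sup>2)"
  shows "has_coeffs (\<lambda>z. \<Sum>\<^sub>\<infinity>\<alpha>. c \<alpha> * mpow z \<alpha>) c"
  unfolding has_coeffs_def
proof
  fix z :: "complex ^ 'd" assume "z \<in> polydisc"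
  then obtain \<rho> where \<rho>: "0 < \<rho>" "\<rho> < 1" "\<And>i. norm (z $ i) < \<rho>"
    by (rule norm_polydisc_obtain_radius) (rule that)
  have "(\<lambda>\<alpha>. norm (c \<alpha> * mpow z \<alpha>)) summable_on UNIV"
  proof (rule summable_on_comparison_test)
    show "(\<lambda>\<alpha>::'d multiindex. C / sqrt (bergman_weight \<beta> \<alpha>) * rpow \<rho> \<alpha>) summable_on UNIV"
      using b \<rho> by (intro summable_rpow_over_weight) auto
    show "norm (c \<alpha> * mpow z \<alpha>) \<le> C / sqrt (bergman_weight \<beta> \<alpha>) * rpow \<rho> \<alpha>" for \<alpha>
      unfolding norm_mult rpow_def using b C \<rho>
      by (intro mult_mono coefficient_bound[OF b C c] norm_mpow_le) (auto simp: less_imp_le)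
  qed auto
  then show "((\<lambda>\<alpha>. c \<alpha> * mpow z \<alpha>) has_sum (\<Sum>\<^sub>\<infinity>\<alpha>. c \<alpha> * mpow z \<alpha>)) UNIV"
    by (rule has_sum_infsum[OF abs_summable_summable])
qed

lemma nn_integral_count_space_summable:
  fixes f :: "'d::finite multiindex \<Rightarrow> real"
  assumes "f summable_on UNIV" "\<And>\<alpha>. f \<alpha> \<ge> 0"
  shows "(\<integral>\<^sup>+\<alpha>. ennreal (f \<alpha>) \<partial>count_space UNIV) < \<infinity>"
proof -
  have "(\<integral>\<^sup>+\<alpha>. ennreal (f \<alpha>) \<partial>count_space UNIV) \<le> ennreal (infsum f UNIV)"
    unfolding nn_integral_box_index
  proof (rule SUP_least)
    fix N
    have "sum f (box_index N) \<le> infsum f UNIV" using assms by (intro finite_sum_le_infsum) auto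
    then show "(\<Sum>\<alpha>\<in>box_index N. ennreal (f \<alpha>)) \<le> ennreal (infsum f UNIV)"
      using assms by (simp add: sum_ennreal ennreal_leI)
  qed
  then show ?thesis by (rule order_le_less_trans) simp
qed

lemma has_coeffs_norm_le:
  fixes w :: "complex ^ 'd::finite"
  assumes h: "has_coeffs h c" and \<rho>: "\<rho> < 1" and w: "\<And>i. norm (w $ i) \<le> \<rho>"
  shows "ennreal (norm (h w)) \<le> (\<integral>\<^sup>+\<alpha>. ennreal (norm (c \<alpha>) * rpow \<rho> \<alpha>) \<partial>count_space UNIV)"
proof -
  have \<rho>0: "\<rho> \<ge> 0" by (rule order_trans[OF norm_ge_zero w])
  have "w \<in> polydisc" using w \<rho> by (auto simp: polydisc_def intro: le_less_trans)
  then have "((\<lambda>\<alpha>. c \<alpha> * mpow w \<alpha>) has_sum h w) UNIV" using h by (simp add: has_coeffs_def)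
  from tendsto_ennrealI[OF tendsto_norm[OF has_sum_imp_box_index[OF this]]]
  show ?thesis
  proof (rule LIMSEQ_le_const2, intro exI allI impI)
    fix N
    have "norm (\<Sum>\<alpha>\<in>box_index N. c \<alpha> * mpow w \<alpha>) \<le> (\<Sum>\<alpha>\<in>box_index N. norm (c \<alpha>) * rpow \<rho> \<alpha>)"
    proof (rule sum_norm_le)
      show "norm (c \<alpha> * mpow w \<alpha>) \<le> norm (c \<alpha>) * rpow \<rho> \<alpha>" for \<alpha>
        unfolding norm_mult rpow_def by (intro mult_left_mono norm_mpow_le w) simp
    qed
    then have "ennreal (norm (\<Sum>\<alpha>\<in>box_index N. c \<alpha> * mpow w \<alpha>)) \<le> (\<Sum>\<alpha>\<in>box_index N. ennreal (norm (c \<alpha>) * rpow \<rho> \<alpha>))"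
      using \<rho>0 by (simp add: sum_ennreal ennreal_leI)
    also have "\<dots> \<le> (\<integral>\<^sup>+\<alpha>. ennreal (norm (c \<alpha>) * rpow \<rho> \<alpha>) \<partial>count_space UNIV)"
      unfolding nn_integral_box_index by (rule SUP_upper) simp
    finally show "ennreal (norm (\<Sum>\<alpha>\<in>box_index N. c \<alpha> * mpow w \<alpha>)) \<le> (\<integral>\<^sup>+\<alpha>. ennreal (norm (c \<alpha>) * rpow \<rho> \<alpha>) \<partial>count_space UNIV)" .
  qed
qed

text \<open>The coordinates of \<phi> are continuous on a compact polydisc, so their moduli attain
  maxima, each below 1, and there are finitely many of them.\<close>

lemma self_map_radius:
  fixes \<phi> :: "complex ^ 'd::finite \<Rightarrow> complex ^ 'd"
  assumes \<phi>: "holomorphic_self_map \<phi>" and r: "0 \<le> r" "r < 1"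
  obtains \<rho> where "\<rho> < 1" "\<And>z i. (\<forall>i. norm (z $ i) \<le> r) \<Longrightarrow> norm (\<phi> z $ i) \<le> \<rho>"
proof -
  let ?K = "{z :: complex ^ 'd. \<forall>i. norm (z $ i) \<le> r}"
  have sub: "?K \<subseteq> polydisc" using r by (auto simp: polydisc_def intro: le_less_trans)
  have ne: "?K \<noteq> {}" using r by (auto intro!: exI[of _ 0])
  have "\<forall>i. \<exists>x<1. \<forall>z\<in>?K. norm (\<phi> z $ i) \<le> x"
  proof
    fix i
    have "continuous_on ?K (\<lambda>z. norm (\<phi> z $ i))"
      using \<phi> by (intro continuous_on_norm continuous_on_subset[OF _ sub] holomorphic_polydisc_continuous)
        (simp add: holomorphic_self_map_def)
    from continuous_attains_sup[OF compact_polydisc_radius ne this]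
    obtain z0 where z0: "z0 \<in> ?K" "\<forall>z\<in>?K. norm (\<phi> z $ i) \<le> norm (\<phi> z0 $ i)"
      by (rule bexE)
    have "\<phi> z0 \<in> polydisc" using \<phi> subsetD[OF sub z0(1)] by (auto simp: holomorphic_self_map_def)
    then have "norm (\<phi> z0 $ i) < 1" by (simp add: polydisc_def)
    then show "\<exists>x<1. \<forall>z\<in>?K. norm (\<phi> z $ i) \<le> x" using z0(2) by (intro exI[of _ "norm (\<phi> z0 $ i)"]) simp
  qed
  then obtain x where x: "\<forall>i. x i < 1 \<and> (\<forall>z\<in>?K. norm (\<phi> z $ i) \<le> x i)"
    by (rule choice[THEN exE])
  show ?thesis
  proof (rule that[of "Max (range x)"])
    show "Max (range x) < 1" using x by simp
    fix z :: "complex ^ 'd" and i assume "\<forall>i. norm (z $ i) \<le> r"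
    then have "norm (\<phi> z $ i) \<le> x i" using x by simp
    also have "x i \<le> Max (range x)" by simp
    finally show "norm (\<phi> z $ i) \<le> Max (range x)" .
  qed
qed

text \<open>Bounded sequences whose coefficients tend to 0 tend to 0 uniformly on compact sets, and by
  Parseval's identity on a small torus so do the coefficients of their compositions with \<open>\<phi>\<close>.\<close>

lemma comp_coeffs_tendsto_0:
  fixes \<phi> :: "complex ^ 'd::finite \<Rightarrow> complex ^ 'd"
  assumes \<phi>: "holomorphic_self_map \<phi>" and b: "\<beta> \<ge> -1" and C: "C \<ge> 0"
    and h: "\<And>n. has_coeffs (h n) (c n)" and e: "\<And>n. has_coeffs (\<lambda>z. h n (\<phi> z)) (e n)"
    and bd: "\<And>n. coeff_norm (bergman_weight \<beta>) (c n) \<le> ennreal (C\<^sup>2)"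
    and lim: "\<And>\<alpha>. (\<lambda>n. c n \<alpha>) \<longlonglongrightarrow> 0"
  shows "(\<lambda>n. e n \<nu>) \<longlonglongrightarrow> 0"
proof -
  define r where "r = (1 / 2 :: real)"
  have r: "0 < r" "r < 1" by (auto simp: r_def)
  obtain \<rho> where \<rho>: "\<rho> < 1" "\<And>z i. (\<forall>i. norm (z $ i) \<le> r) \<Longrightarrow> norm (\<phi> z $ i) \<le> \<rho>"
    by (rule self_map_radius[OF \<phi> less_imp_le[OF r(1)] r(2)]) (rule that)
  have "norm (\<phi> 0 $ undefined) \<le> \<rho>" using r by (intro \<rho>(2)) simp
  then have \<rho>0: "\<rho> \<ge> 0" by (rule order_trans[OF norm_ge_zero])
  \<comment> \<open>By \<open>has_coeffs_norm_le\<close>, \<open>s n\<close> bounds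
    \<open>h n\<close> on a polydisc that contains the \<phi>-image of the torus of radius
    \<open>r\<close>. It tends to 0 by dominated convergence: every coefficient does, and the norm
    bound supplies the majorant.\<close>
  define s where "s n = (\<integral>\<^sup>+\<alpha>. ennreal (norm (c n \<alpha>) * rpow \<rho> \<alpha>) \<partial>count_space UNIV)" for n
  have "s \<longlonglongrightarrow> (\<integral>\<^sup>+(\<alpha>::'d multiindex). 0 \<partial>count_space UNIV)"
    unfolding s_def
  proof (rule nn_integral_dominated_convergence[where w = "\<lambda>\<alpha>. ennreal (C / sqrt (bergman_weight \<beta> \<alpha>) * rpow \<rho> \<alpha>)"])
    show "(\<integral>\<^sup>+(\<alpha>::'d multiindex). ennreal (C / sqrt (bergman_weight \<beta> \<alpha>) * rpow \<rho> \<alpha>) \<partial>count_space UNIV) < \<infinity>"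
      using b \<rho> \<rho>0 C by (intro nn_integral_count_space_summable summable_rpow_over_weight) (auto simp: less_imp_le)
    show "AE \<alpha> in count_space UNIV. ennreal (norm (c n \<alpha>) * rpow \<rho> \<alpha>) \<le> ennreal (C / sqrt (bergman_weight \<beta> \<alpha>) * rpow \<rho> \<alpha>)" for n
      using \<rho>0 by (intro AE_I2 ennreal_leI mult_right_mono coefficient_bound[OF b C bd]) auto
    show "AE \<alpha> in count_space UNIV. (\<lambda>n. ennreal (norm (c n \<alpha>) * rpow \<rho> \<alpha>)) \<longlonglongrightarrow> 0"
    proof (rule AE_I2)
      fix \<alpha>
      have "(\<lambda>n. ennreal (norm (c n \<alpha>) * rpow \<rho> \<alpha>)) \<longlonglongrightarrow> ennreal (norm (0::complex) * rpow \<rho> \<alpha>)"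
        by (intro tendsto_ennrealI tendsto_mult tendsto_norm lim tendsto_const)
      then show "(\<lambda>n. ennreal (norm (c n \<alpha>) * rpow \<rho> \<alpha>)) \<longlonglongrightarrow> 0" by simp
    qed
  qed auto
  then have s0: "s \<longlonglongrightarrow> 0" by simp
  \<comment> \<open>A single term of Parseval's sum on the torus of radius \<open>r\<close> is at
    most the mean square of the composed function there, hence at most
    \<open>(s n)\<^sup>2\<close>.\<close>
  have le: "ennreal (rpow r \<nu> * norm (e n \<nu>)) \<le> s n" for n
  proof -
    let ?M = "product_measure circle_measure :: (complex ^ 'd) measure"
    have Mprob: "emeasure ?M (space ?M) = 1"
      unfolding product_measure_def
      by (rule prob_space.emeasure_space_1, rule prob_space.prob_space_distr, rule prob_space_PiM, rule prob_space_circle_measure,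
          rule measurable_vec_lambda_PiM, rule sets_circle_measure)
    have "ennreal ((rpow r \<nu>)\<^sup>2 * (norm (e n \<nu>))\<^sup>2) \<le> coeff_norm (\<lambda>\<alpha>. (rpow r \<alpha>)\<^sup>2) (e n)"
      by (rule coeff_norm_ge)
    also have "\<dots> = (\<integral>\<^sup>+\<zeta>\<in>torus. ennreal ((norm (h n (\<phi> (r *\<^sub>R \<zeta>))))\<^sup>2) \<partial>?M)"
      by (rule hardy_Parseval[OF e r, symmetric])
    also have "\<dots> \<le> (\<integral>\<^sup>+\<zeta>. (s n)\<^sup>2 \<partial>?M)"
    proof (rule nn_integral_mono)
      fix \<zeta> :: "complex ^ 'd"
      show "ennreal ((norm (h n (\<phi> (r *\<^sub>R \<zeta>))))\<^sup>2) * indicator torus \<zeta> \<le> (s n)\<^sup>2"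
      proof (cases "\<zeta> \<in> torus")
        case True
        then have "\<forall>i. norm ((r *\<^sub>R \<zeta>) $ i) \<le> r" using r by (simp add: torus_def)
        then have "ennreal (norm (h n (\<phi> (r *\<^sub>R \<zeta>)))) \<le> s n"
          unfolding s_def using h \<rho> by (intro has_coeffs_norm_le) auto
        then have "(ennreal (norm (h n (\<phi> (r *\<^sub>R \<zeta>)))))\<^sup>2 \<le> (s n)\<^sup>2" by (rule power_mono) simp
        then show ?thesis using True by (simp add: ennreal_power)
      qed simp
    qed
    also have "\<dots> = (s n)\<^sup>2" by (simp add: Mprob)
    finally have sq: "(ennreal (rpow r \<nu> * norm (e n \<nu>)))\<^sup>2 \<le> (s n)\<^sup>2"
      using r by (simp add: ennreal_power power_mult_distrib)
    show ?thesis
    proof (rule ccontr)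
      assume "\<not> ennreal (rpow r \<nu> * norm (e n \<nu>)) \<le> s n"
      then have lt: "s n < ennreal (rpow r \<nu> * norm (e n \<nu>))" (is "_ < ?a") by simp
      then have "0 < ?a" by (rule le_less_trans[rotated]) simp
      then have "s n * ?a < ?a * ?a" using lt by (intro ennreal_mult_strict_right_mono) auto
      moreover have "s n * s n \<le> s n * ?a" using lt by (intro mult_left_mono) auto
      ultimately have "(s n)\<^sup>2 < ?a\<^sup>2" unfolding power2_eq_square by (rule le_less_trans[rotated])
      with sq show False by simp
    qed
  qed
  have "(\<lambda>n. ennreal (rpow r \<nu> * norm (e n \<nu>))) \<longlonglongrightarrow> 0"
    by (rule tendsto_sandwich[OF _ _ tendsto_const s0]) (auto simp: le)
  then have "(\<lambda>n. ennreal (rpow r \<nu> * norm (e n \<nu>))) \<longlonglongrightarrow> ennreal 0" by simp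
  then have "(\<lambda>n. rpow r \<nu> * norm (e n \<nu>)) \<longlonglongrightarrow> 0"
    by (subst (asm) tendsto_ennreal_iff) (use r in auto)
  from tendsto_mult[OF tendsto_const[of "1 / rpow r \<nu>"] this]
  have "(\<lambda>n. norm (e n \<nu>)) \<longlonglongrightarrow> 0" using rpow_pos[OF r(1), of \<nu>] by simp
  then show ?thesis by (rule tendsto_norm_zero_cancel)
qed

section \<open>Compactness\<close>

lemma coeff_norm_weights_tendsto_0:
  assumes u: "\<And>n \<alpha>. 0 \<le> u n \<alpha>" "\<And>n \<alpha>. u n \<alpha> \<le> w \<alpha>" "\<And>\<alpha>. (\<lambda>n. u n \<alpha>) \<longlonglongrightarrow> 0"
    and fin: "coeff_norm w c < \<infinity>"
  shows "(\<lambda>n. coeff_norm (u n) c) \<longlonglongrightarrow> 0"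
proof -
  have "(\<lambda>n. coeff_norm (u n) c) \<longlonglongrightarrow> (\<integral>\<^sup>+(\<alpha>::'a multiindex). 0 \<partial>count_space UNIV)"
    unfolding coeff_norm_def
  proof (rule nn_integral_dominated_convergence[where w = "\<lambda>\<alpha>. ennreal (w \<alpha> * (norm (c \<alpha>))\<^sup>2)"])
    show "(\<integral>\<^sup>+\<alpha>. ennreal (w \<alpha> * (norm (c \<alpha>))\<^sup>2) \<partial>count_space UNIV) < \<infinity>"
      using fin by (simp add: coeff_norm_def)
    show "AE \<alpha> in count_space UNIV. ennreal (u n \<alpha> * (norm (c \<alpha>))\<^sup>2) \<le> ennreal (w \<alpha> * (norm (c \<alpha>))\<^sup>2)" for n
      using u(2) by (intro AE_I2 ennreal_leI mult_right_mono) auto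
    show "AE \<alpha> in count_space UNIV. (\<lambda>n. ennreal (u n \<alpha> * (norm (c \<alpha>))\<^sup>2)) \<longlonglongrightarrow> 0"
    proof (rule AE_I2)
      fix \<alpha>
      have "(\<lambda>n. ennreal (u n \<alpha> * (norm (c \<alpha>))\<^sup>2)) \<longlonglongrightarrow> ennreal (0 * (norm (c \<alpha>))\<^sup>2)"
        by (intro tendsto_ennrealI tendsto_mult u(3) tendsto_const)
      then show "(\<lambda>n. ennreal (u n \<alpha> * (norm (c \<alpha>))\<^sup>2)) \<longlonglongrightarrow> 0" by simp
    qed
  qed auto
  then show ?thesis by simp
qed

lemma ennreal_tendsto_0_sqrt:
  fixes x :: "nat \<Rightarrow> ennreal"
  assumes "\<And>n. x n < \<infinity>"
  shows "(\<lambda>n. sqrt (enn2real (x n))) \<longlonglongrightarrow> 0 \<longleftrightarrow> x \<longlonglongrightarrow> 0"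
proof -
  have x: "x n = ennreal (enn2real (x n))" for n using assms[of n] by (simp add: ennreal_enn2real_if less_top)
  have "x \<longlonglongrightarrow> 0 \<longleftrightarrow> (\<lambda>n. ennreal (enn2real (x n))) \<longlonglongrightarrow> ennreal 0"
    by (subst x[abs_def]) simp
  also have "\<dots> \<longleftrightarrow> (\<lambda>n. enn2real (x n)) \<longlonglongrightarrow> 0"
    by (subst tendsto_ennreal_iff) auto
  also have "\<dots> \<longleftrightarrow> (\<lambda>n. sqrt (enn2real (x n))) \<longlonglongrightarrow> 0"
  proof
    assume "(\<lambda>n. enn2real (x n)) \<longlonglongrightarrow> 0"
    from tendsto_real_sqrt[OF this] show "(\<lambda>n. sqrt (enn2real (x n))) \<longlonglongrightarrow> 0" by simp
  next
    assume "(\<lambda>n. sqrt (enn2real (x n))) \<longlonglongrightarrow> 0"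
    from tendsto_power[OF this, of 2] show "(\<lambda>n. enn2real (x n)) \<longlonglongrightarrow> 0" by simp
  qed
  finally show ?thesis by simp
qed

text \<open>With \<open>u n\<close> a small multiple of the weight this gives boundedness, with \<open>u n\<close> the weight cut off
  to the indices outside a large box it gives the tail estimate that characterizes compactness.\<close>

lemma maps_compactly_imp_mat_bound:
  fixes \<phi> :: "complex ^ 'd::finite \<Rightarrow> complex ^ 'd"
  assumes \<phi>: "holomorphic_self_map \<phi>" and b: "\<beta> \<ge> -1" and g: "\<gamma> \<ge> -1"
    and mc: "maps_compactly (comp_operator \<phi>) \<beta> \<gamma>"
    and u: "\<And>n \<alpha>. 0 \<le> u n \<alpha>" "\<And>n \<alpha>. u n \<alpha> \<le> bergman_weight \<gamma> \<alpha>" "\<And>\<alpha>. (\<lambda>n. u n \<alpha>) \<longlonglongrightarrow> 0"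
    and \<epsilon>: "\<epsilon> > 0"
  shows "\<exists>n. mat_bound (comp_matrix \<phi>) (bergman_weight \<beta>) (u n) \<epsilon>"
proof (rule ccontr)
  assume "\<nexists>n. mat_bound (comp_matrix \<phi>) (bergman_weight \<beta>) (u n) \<epsilon>"
  \<comment> \<open>For every \<open>n\<close> some polynomial violates the bound. The strict
    inequality makes its image nonzero, so it can be normalised; the normalised polynomials
    \<open>F n\<close> form a bounded sequence to which compactness applies.\<close>
  then have "\<forall>n. \<exists>S x. finite S \<and> ennreal (\<epsilon> * (\<Sum>a\<in>S. bergman_weight \<beta> a * (norm (x a))\<^sup>2))
      < coeff_norm (u n) (\<lambda>\<nu>. \<Sum>a\<in>S. comp_matrix \<phi> \<nu> a * x a)"
    unfolding mat_bound_def coeff_norm_def by (simp add: not_le)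
  then have "\<exists>S. \<forall>n. \<exists>x. finite (S n) \<and> ennreal (\<epsilon> * (\<Sum>a\<in>S n. bergman_weight \<beta> a * (norm (x a))\<^sup>2))
      < coeff_norm (u n) (\<lambda>\<nu>. \<Sum>a\<in>S n. comp_matrix \<phi> \<nu> a * x a)"
    by (rule choice)
  then obtain S where "\<forall>n. \<exists>x. finite (S n) \<and> ennreal (\<epsilon> * (\<Sum>a\<in>S n. bergman_weight \<beta> a * (norm (x a))\<^sup>2))
      < coeff_norm (u n) (\<lambda>\<nu>. \<Sum>a\<in>S n. comp_matrix \<phi> \<nu> a * x a)"
    by (rule exE)
  then have "\<exists>x. \<forall>n. finite (S n) \<and> ennreal (\<epsilon> * (\<Sum>a\<in>S n. bergman_weight \<beta> a * (norm (x n a))\<^sup>2))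
      < coeff_norm (u n) (\<lambda>\<nu>. \<Sum>a\<in>S n. comp_matrix \<phi> \<nu> a * x n a)"
    by (rule choice)
  then obtain x where Sx: "\<forall>n. finite (S n) \<and> ennreal (\<epsilon> * (\<Sum>a\<in>S n. bergman_weight \<beta> a * (norm (x n a))\<^sup>2))
      < coeff_norm (u n) (\<lambda>\<nu>. \<Sum>a\<in>S n. comp_matrix \<phi> \<nu> a * x n a)"
    by (rule exE)
  have S: "finite (S n)" and big: "ennreal (\<epsilon> * (\<Sum>a\<in>S n. bergman_weight \<beta> a * (norm (x n a))\<^sup>2))
      < coeff_norm (u n) (\<lambda>\<nu>. \<Sum>a\<in>S n. comp_matrix \<phi> \<nu> a * x n a)" for n
    using Sx by simp_all
  define P where "P n = (\<Sum>a\<in>S n. bergman_weight \<beta> a * (norm (x n a))\<^sup>2)" for n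
  have P0: "P n > 0" for n
  proof -
    have "P n \<ge> 0" unfolding P_def using b by (intro sum_nonneg) (auto simp: less_imp_le)
    moreover have "P n \<noteq> 0"
    proof
      assume "P n = 0"
      then have "\<forall>a\<in>S n. bergman_weight \<beta> a * (norm (x n a))\<^sup>2 = 0"
        unfolding P_def using b S[of n] by (subst (asm) sum_nonneg_eq_0_iff) (auto simp: less_imp_le)
      moreover have "bergman_weight \<beta> a \<noteq> 0" for a :: "'d multiindex" using bergman_weight_pos[OF b, of a] by simp
      ultimately have "\<forall>a\<in>S n. x n a = 0" by simp
      then have "(\<lambda>\<nu>. \<Sum>a\<in>S n. comp_matrix \<phi> \<nu> a * x n a) = (\<lambda>_. 0)" by simp
      then show False using big[of n] by (simp add: coeff_norm_def)
    qed
    ultimately show ?thesis by simp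
  qed
  define k where "k n = complex_of_real (1 / sqrt (P n))" for n
  have k2: "(norm (k n))\<^sup>2 = 1 / P n" for n
    using P0[of n] by (simp add: k_def norm_divide power_divide)
  define c where "c n \<alpha> = (if \<alpha> \<in> S n then x n \<alpha> else 0) * k n" for n \<alpha>
  define e where "e n \<nu> = (\<Sum>a\<in>S n. comp_matrix \<phi> \<nu> a * x n a) * k n" for n \<nu>
  define F where "F n z = (\<Sum>a\<in>S n. x n a * mpow z a) * k n" for n and z :: "complex ^ 'd"
  have Fc: "has_coeffs (F n) (c n)" for n
    unfolding F_def[abs_def] c_def[abs_def] by (intro has_coeffs_cmult has_coeffs_polynomial S)
  have Fe: "has_coeffs (\<lambda>z. F n (\<phi> z)) (e n)" for n
    unfolding F_def e_def[abs_def] by (intro has_coeffs_cmult has_coeffs_comp_polynomial \<phi> S)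
  have norm_k: "coeff_norm w (\<lambda>\<alpha>. d \<alpha> * k n) = ennreal (1 / P n) * coeff_norm w d" for w and d :: "'d multiindex \<Rightarrow> complex" and n
    unfolding coeff_norm_def using P0[of n]
    by (subst nn_integral_cmult[symmetric]) (auto simp: norm_mult power_mult_distrib k2 ennreal_mult'[symmetric] mult_ac intro!: nn_integral_cong)
  have "coeff_norm (bergman_weight \<beta>) (\<lambda>\<alpha>. if \<alpha> \<in> S n then x n \<alpha> else 0) = ennreal (P n)" for n
  proof -
    have "coeff_norm (bergman_weight \<beta>) (\<lambda>\<alpha>. if \<alpha> \<in> S n then x n \<alpha> else 0)
      = (\<integral>\<^sup>+\<alpha>. ennreal (bergman_weight \<beta> \<alpha> * (norm (x n \<alpha>))\<^sup>2) * indicator (S n) \<alpha> \<partial>count_space UNIV)"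
      unfolding coeff_norm_def by (intro nn_integral_cong) (auto simp: indicator_def)
    also have "\<dots> = ennreal (P n)"
      unfolding P_def using b S[of n]
      by (subst nn_integral_count_space_indicator[symmetric])
         (simp_all add: nn_integral_count_space_finite sum_ennreal less_imp_le)
    finally show ?thesis .
  qed
  then have c1: "coeff_norm (bergman_weight \<beta>) (c n) = 1" for n
    unfolding c_def[abs_def] norm_k using P0[of n] by (simp add: ennreal_mult'[symmetric])
  have e\<epsilon>: "ennreal \<epsilon> < coeff_norm (u n) (e n)" for n
  proof -
    have "ennreal (1 / P n) * ennreal (\<epsilon> * P n) < ennreal (1 / P n) * coeff_norm (u n) (\<lambda>\<nu>. \<Sum>a\<in>S n. comp_matrix \<phi> \<nu> a * x n a)"
      using big[of n] P0[of n] by (intro ennreal_mult_strict_left_mono) (auto simp: P_def)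
    then show ?thesis
      unfolding e_def[abs_def] norm_k using P0[of n] by (simp add: ennreal_mult'[symmetric])
  qed
  have FB: "\<forall>n. F n \<in> bergman_space \<beta>" using bergman_space_iff[OF b Fc] c1 by simp
  have Fn: "\<forall>n. bergman_norm \<beta> (F n) \<le> 1" using bergman_norm_eq[OF b Fc] c1 by simp
  have "\<exists>G\<in>bergman_space \<gamma>. \<exists>r. strict_mono r \<and> (\<lambda>n. bergman_norm \<gamma> (\<lambda>z. comp_operator \<phi> (F (r n)) z - G z)) \<longlonglongrightarrow> 0"
    by (rule conjunct2[OF mc[unfolded maps_compactly_def], THEN spec, THEN mp]) (intro conjI FB exI[of _ 1] Fn)
  then obtain G where G1: "G \<in> bergman_space \<gamma>"
      "\<exists>r. strict_mono r \<and> (\<lambda>n. bergman_norm \<gamma> (\<lambda>z. comp_operator \<phi> (F (r n)) z - G z)) \<longlonglongrightarrow> 0"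
    by (rule bexE)
  from G1(2) obtain r where r: "strict_mono r \<and> (\<lambda>n. bergman_norm \<gamma> (\<lambda>z. comp_operator \<phi> (F (r n)) z - G z)) \<longlonglongrightarrow> 0"
    by (rule exE)
  note G = G1(1) conjunct1[OF r] conjunct2[OF r]
  have "holomorphic_polydisc G" using G(1) by (simp add: bergman_space_def)
  then obtain d where d: "has_coeffs G d" by (rule holomorphic_imp_has_coeffs)
  have dfin: "coeff_norm (bergman_weight \<gamma>) d < \<infinity>" using G(1) bergman_space_iff[OF g d] by simp
  have efin: "coeff_norm (bergman_weight \<gamma>) (e n) < \<infinity>" for n
  proof -
    have "comp_operator \<phi> (F n) \<in> bergman_space \<gamma>" using FB mc by (simp add: maps_compactly_def)
    then show ?thesis using bergman_space_iff[OF g Fe] by (simp add: comp_operator_def o_def)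
  qed
  have w0: "bergman_weight \<gamma> \<alpha> \<ge> 0" for \<alpha> :: "'d multiindex" using g by (simp add: less_imp_le)
  define y where "y n = coeff_norm (bergman_weight \<gamma>) (\<lambda>\<alpha>. e (r n) \<alpha> - d \<alpha>)" for n
  have yfin: "y n < \<infinity>" for n
    unfolding y_def
    by (rule le_less_trans[OF coeff_norm_diff_le[OF w0]])
      (use efin[of "r n"] dfin in \<open>simp add: ennreal_mult_less_top\<close>)
  have "bergman_norm \<gamma> (\<lambda>z. comp_operator \<phi> (F (r n)) z - G z) = sqrt (enn2real (y n))" for n
    using bergman_norm_eq[OF g has_coeffs_diff[OF Fe d]] by (simp add: y_def comp_operator_def)
  with G(3) have "(\<lambda>n. sqrt (enn2real (y n))) \<longlonglongrightarrow> 0" by simp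
  then have y0: "y \<longlonglongrightarrow> 0" using ennreal_tendsto_0_sqrt[of y] yfin by simp
  \<comment> \<open>The limit \<open>G\<close> is one fixed function, so weights that tend to 0 at
    every index annihilate its norm in the limit. The images are close to \<open>G\<close> in the
    larger norm, so their \<open>u\<close>-norms tend to 0 along the subsequence, against the lower
    bound \<epsilon>.\<close>
  have "(\<lambda>n. coeff_norm (u n) d) \<longlonglongrightarrow> 0"
    by (rule coeff_norm_weights_tendsto_0[OF u dfin])
  then have v0: "(\<lambda>n. coeff_norm (u (r n)) d) \<longlonglongrightarrow> 0"
    using LIMSEQ_subseq_LIMSEQ[OF _ G(2)] by (simp add: o_def)
  have le: "coeff_norm (u (r n)) (e (r n)) \<le> 2 * y n + 2 * coeff_norm (u (r n)) d" for n
  proof -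
    have "coeff_norm (u (r n)) (\<lambda>\<alpha>. (e (r n) \<alpha> - d \<alpha>) + d \<alpha>)
       \<le> 2 * coeff_norm (u (r n)) (\<lambda>\<alpha>. e (r n) \<alpha> - d \<alpha>) + 2 * coeff_norm (u (r n)) d"
      by (rule coeff_norm_add_le) (rule u(1))
    also have "\<dots> \<le> 2 * y n + 2 * coeff_norm (u (r n)) d"
      unfolding y_def by (intro add_mono mult_left_mono coeff_norm_mono u(2)) auto
    finally show ?thesis by simp
  qed
  have "(\<lambda>n. 2 * y n + 2 * coeff_norm (u (r n)) d) \<longlonglongrightarrow> 2 * 0 + 2 * 0"
    by (intro tendsto_add ennreal_tendsto_cmult y0 v0) auto
  then have "\<forall>\<^sub>F n in sequentially. 2 * y n + 2 * coeff_norm (u (r n)) d < ennreal \<epsilon>"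
    by (rule order_tendstoD(2)) (use \<epsilon> in simp)
  then obtain n where "2 * y n + 2 * coeff_norm (u (r n)) d < ennreal \<epsilon>"
    by (auto simp: eventually_sequentially)
  then show False using le[of n] e\<epsilon>[of "r n"] by simp
qed

text \<open>The matrix bound governs the images of the truncations of \<open>f\<close>. By
  \<open>comp_coeffs_tendsto_0\<close> they converge coefficient by coefficient to the image of
  \<open>f\<close>, and Fatou's lemma carries the bound over. The target weight is left free, so
  that full and cut-off weights can be inserted.\<close>

lemma comp_coeff_norm_le:
  fixes \<phi> :: "complex ^ 'd::finite \<Rightarrow> complex ^ 'd"
  assumes \<phi>: "holomorphic_self_map \<phi>" and b: "\<beta> \<ge> -1"
    and mb: "mat_bound (comp_matrix \<phi>) (bergman_weight \<beta>) w M" and M: "M \<ge> 0"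
    and f: "has_coeffs f c" and e: "has_coeffs (\<lambda>z. f (\<phi> z)) e"
    and C: "C \<ge> 0" and fin: "coeff_norm (bergman_weight \<beta>) c \<le> ennreal (C\<^sup>2)"
  shows "coeff_norm w e \<le> ennreal (M * C\<^sup>2)"
proof -
  define cN where "cN N \<alpha> = (if \<alpha> \<in> box_index N then c \<alpha> else 0)" for N \<alpha>
  define p where "p N z = (\<Sum>a\<in>box_index N. c a * mpow z a)" for N and z :: "complex ^ 'd"
  define eN where "eN N \<nu> = (\<Sum>a\<in>box_index N. comp_matrix \<phi> \<nu> a * c a)" for N \<nu>
  have pc: "has_coeffs (p N) (cN N)" for N
    unfolding p_def[abs_def] cN_def[abs_def] by (intro has_coeffs_polynomial) simp
  have pe: "has_coeffs (\<lambda>z. p N (\<phi> z)) (eN N)" for N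
    unfolding p_def eN_def[abs_def] by (intro has_coeffs_comp_polynomial \<phi>) simp
  have w0: "bergman_weight \<beta> \<alpha> \<ge> 0" for \<alpha> :: "'d multiindex" using b by (simp add: less_imp_le)
  have tr: "coeff_norm (bergman_weight \<beta>) (cN N) \<le> ennreal (C\<^sup>2)" for N
    unfolding cN_def[abs_def] by (rule order_trans[OF coeff_norm_truncate_le fin])
  have "(\<lambda>N. eN N \<nu> - e \<nu>) \<longlonglongrightarrow> 0" for \<nu>
  proof (rule comp_coeffs_tendsto_0[OF \<phi> b, where C = "2 * C"])
    show "has_coeffs (\<lambda>z. p N z - f z) (\<lambda>\<alpha>. cN N \<alpha> - c \<alpha>)" for N by (rule has_coeffs_diff[OF pc f])
    show "has_coeffs (\<lambda>z. p N (\<phi> z) - f (\<phi> z)) (\<lambda>\<alpha>. eN N \<alpha> - e \<alpha>)" for N by (rule has_coeffs_diff[OF pe e])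
    show "coeff_norm (bergman_weight \<beta>) (\<lambda>\<alpha>. cN N \<alpha> - c \<alpha>) \<le> ennreal ((2 * C)\<^sup>2)" for N
      by (rule coeff_norm_diff_le_square[OF w0 tr fin])
    show "(\<lambda>N. cN N \<alpha> - c \<alpha>) \<longlonglongrightarrow> 0" for \<alpha>
      by (rule tendsto_eventually, rule eventually_mono[OF eventually_in_box_index[of \<alpha>]]) (simp add: cN_def)
  qed (use C in auto)
  then have lim: "(\<lambda>N. eN N \<nu>) \<longlonglongrightarrow> e \<nu>" for \<nu> by (simp add: LIM_zero_cancel)
  show ?thesis
  proof (rule coeff_norm_Fatou[OF lim])
    fix N
    have "coeff_norm w (eN N) \<le> ennreal (M * (\<Sum>a\<in>box_index N. bergman_weight \<beta> a * (norm (c a))\<^sup>2))"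
      using mb unfolding mat_bound_def coeff_norm_def eN_def by simp
    also have "\<dots> \<le> ennreal (M * C\<^sup>2)"
    proof (intro ennreal_leI mult_left_mono M)
      have "ennreal (\<Sum>a\<in>box_index N. bergman_weight \<beta> a * (norm (c a))\<^sup>2) = coeff_norm (bergman_weight \<beta>) (cN N)"
        unfolding cN_def[abs_def] coeff_norm_truncate using w0 by (simp add: sum_ennreal)
      also have "\<dots> \<le> ennreal (C\<^sup>2)" by (rule tr)
      finally show "(\<Sum>a\<in>box_index N. bergman_weight \<beta> a * (norm (c a))\<^sup>2) \<le> C\<^sup>2" by (simp add: ennreal_le_iff)
    qed
    finally show "coeff_norm w (eN N) \<le> ennreal (M * C\<^sup>2)" .
  qed
qed

definition tail_weight :: "real \<Rightarrow> nat \<Rightarrow> 'd::finite multiindex \<Rightarrow> real" where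
  "tail_weight \<gamma> N \<alpha> = (if \<alpha> \<in> box_index N then 0 else bergman_weight \<gamma> \<alpha>)"

lemma coeff_norm_split_box:
  "coeff_norm (bergman_weight \<gamma>) c
    = (\<Sum>\<alpha>\<in>box_index N. ennreal (bergman_weight \<gamma> \<alpha> * (norm (c \<alpha>))\<^sup>2)) + coeff_norm (tail_weight \<gamma> N) c"
proof -
  have "(\<Sum>\<alpha>\<in>box_index N. ennreal (bergman_weight \<gamma> \<alpha> * (norm (c \<alpha>))\<^sup>2)) + coeff_norm (tail_weight \<gamma> N) c
     = (\<integral>\<^sup>+\<alpha>. ennreal (bergman_weight \<gamma> \<alpha> * (norm (if \<alpha> \<in> box_index N then c \<alpha> else 0))\<^sup>2)
        + ennreal (tail_weight \<gamma> N \<alpha> * (norm (c \<alpha>))\<^sup>2) \<partial>count_space UNIV)"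
    unfolding coeff_norm_truncate[symmetric] coeff_norm_def by (rule nn_integral_add[symmetric]) auto
  also have "\<dots> = coeff_norm (bergman_weight \<gamma>) c"
    unfolding coeff_norm_def by (intro nn_integral_cong) (simp add: tail_weight_def)
  finally show ?thesis by simp
qed

lemma mat_bound_mono:
  fixes t :: "'b \<Rightarrow> 'a \<Rightarrow> complex"
  assumes mb: "mat_bound t w w' M" and M: "M \<ge> 0" and C: "C1 \<ge> 0" "C2 \<ge> 0"
    and w: "\<And>a. w a \<le> C1 * v a" and w': "\<And>b. v' b \<le> C2 * w' b"
  shows "mat_bound t v v' (C1 * C2 * M)"
  unfolding mat_bound_def
proof (intro allI impI)
  fix S :: "'a set" and x assume S: "finite S"
  define y where "y b = (\<Sum>a\<in>S. t b a * x a)" for b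
  have "(\<integral>\<^sup>+b. ennreal (v' b * (norm (y b))\<^sup>2) \<partial>count_space UNIV)
    \<le> (\<integral>\<^sup>+b. ennreal C2 * ennreal (w' b * (norm (y b))\<^sup>2) \<partial>count_space UNIV)"
  proof (rule nn_integral_mono)
    fix b
    have "v' b * (norm (y b))\<^sup>2 \<le> C2 * w' b * (norm (y b))\<^sup>2" using w' by (rule mult_right_mono) simp
    then show "ennreal (v' b * (norm (y b))\<^sup>2) \<le> ennreal C2 * ennreal (w' b * (norm (y b))\<^sup>2)"
      using C by (simp add: ennreal_mult'[symmetric] ennreal_leI mult.assoc)
  qed
  also have "\<dots> = ennreal C2 * (\<integral>\<^sup>+b. ennreal (w' b * (norm (y b))\<^sup>2) \<partial>count_space UNIV)"
    by (rule nn_integral_cmult) simp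
  also have "\<dots> \<le> ennreal C2 * ennreal (M * (\<Sum>a\<in>S. w a * (norm (x a))\<^sup>2))"
    using mb S unfolding mat_bound_def y_def by (intro mult_left_mono) auto
  also have "\<dots> = ennreal (C2 * (M * (\<Sum>a\<in>S. w a * (norm (x a))\<^sup>2)))"
    using C by (simp add: ennreal_mult')
  also have "\<dots> \<le> ennreal (C1 * C2 * M * (\<Sum>a\<in>S. v a * (norm (x a))\<^sup>2))"
  proof (rule ennreal_leI)
    have "(\<Sum>a\<in>S. w a * (norm (x a))\<^sup>2) \<le> (\<Sum>a\<in>S. C1 * v a * (norm (x a))\<^sup>2)"
      by (intro sum_mono mult_right_mono w) simp
    also have "\<dots> = C1 * (\<Sum>a\<in>S. v a * (norm (x a))\<^sup>2)" by (simp add: sum_distrib_left mult.assoc)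
    finally have "C2 * M * (\<Sum>a\<in>S. w a * (norm (x a))\<^sup>2) \<le> C2 * M * (C1 * (\<Sum>a\<in>S. v a * (norm (x a))\<^sup>2))"
      using C M by (intro mult_left_mono) auto
    then show "C2 * (M * (\<Sum>a\<in>S. w a * (norm (x a))\<^sup>2)) \<le> C1 * C2 * M * (\<Sum>a\<in>S. v a * (norm (x a))\<^sup>2)"
      by (simp add: mult_ac)
  qed
  finally show "(\<integral>\<^sup>+b. ennreal (v' b * (norm (\<Sum>a\<in>S. t b a * x a))\<^sup>2) \<partial>count_space UNIV)
     \<le> ennreal (C1 * C2 * M * (\<Sum>a\<in>S. v a * (norm (x a))\<^sup>2))" by (simp add: y_def)
qed

lemma ennreal_tendsto_0I:
  fixes y :: "nat \<Rightarrow> ennreal"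
  assumes "\<And>\<epsilon>. \<epsilon> > 0 \<Longrightarrow> \<forall>\<^sub>F n in sequentially. y n \<le> ennreal \<epsilon>"
  shows "y \<longlonglongrightarrow> 0"
proof (rule order_tendstoI)
  fix a :: ennreal assume "0 < a"
  then obtain b where b: "0 < b" "b < a" using dense by blast
  have bt: "b < top" by (rule less_le_trans[OF b(2) top_greatest])
  then have "b = ennreal (enn2real b)" by (simp add: ennreal_enn2real)
  moreover have "enn2real b > 0" using b(1) bt by (simp add: enn2real_positive_iff)
  ultimately have "\<forall>\<^sub>F n in sequentially. y n \<le> b" using assms[of "enn2real b"] by simp
  then show "\<forall>\<^sub>F n in sequentially. y n < a"
    by eventually_elim (use b in \<open>simp add: le_less_trans\<close>)
qed simp

text \<open>The converse of the tail criterion. A subsequence converges coefficient by coefficient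
  to a function \<open>G\<close> with the same norm bound, and after composition the differences
  tend to 0 in every coefficient. The finitely many coefficients in a cube contribute little for
  large \<open>n\<close>; the tail bound controls the rest uniformly.\<close>

lemma mat_bound_imp_maps_compactly:
  fixes \<phi> :: "complex ^ 'd::finite \<Rightarrow> complex ^ 'd"
  assumes \<phi>: "holomorphic_self_map \<phi>" and b: "\<beta> \<ge> -1" and g: "\<gamma> \<ge> -1"
    and mb: "mat_bound (comp_matrix \<phi>) (bergman_weight \<beta>) (bergman_weight \<gamma>) M" and M: "M \<ge> 0"
    and tail: "\<And>\<epsilon>. \<epsilon> > 0 \<Longrightarrow> \<exists>N. mat_bound (comp_matrix \<phi>) (bergman_weight \<beta>) (tail_weight \<gamma> N) \<epsilon>"
  shows "maps_compactly (comp_operator \<phi>) \<beta> \<gamma>"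
proof -
  have comp: "holomorphic_polydisc (\<lambda>z. f (\<phi> z))" if "holomorphic_polydisc f" for f
    by (rule holomorphic_compose_self_map[OF that \<phi>])
  have bounded: "comp_operator \<phi> f \<in> bergman_space \<gamma>" if f: "f \<in> bergman_space \<beta>" for f
  proof -
    have hf: "holomorphic_polydisc f" using f by (simp add: bergman_space_def)
    note c = has_coeffs_coeffs_of[OF hf] and e = has_coeffs_coeffs_of[OF comp[OF hf]]
    have "coeff_norm (bergman_weight \<beta>) (coeffs_of f) < \<infinity>" using f bergman_space_iff[OF b c] by simp
    then have "coeff_norm (bergman_weight \<beta>) (coeffs_of f)
        \<le> ennreal ((sqrt (enn2real (coeff_norm (bergman_weight \<beta>) (coeffs_of f))))\<^sup>2)"
      by (simp add: ennreal_enn2real_if less_top)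
    from comp_coeff_norm_le[OF \<phi> b mb M c e _ this]
    have "coeff_norm (bergman_weight \<gamma>) (coeffs_of (\<lambda>z. f (\<phi> z)))
        \<le> ennreal (M * (sqrt (enn2real (coeff_norm (bergman_weight \<beta>) (coeffs_of f))))\<^sup>2)" by simp
    then have "coeff_norm (bergman_weight \<gamma>) (coeffs_of (\<lambda>z. f (\<phi> z))) < \<infinity>"
      by (rule le_less_trans) simp
    then show ?thesis using bergman_space_iff[OF g e] by (simp add: comp_operator_def o_def)
  qed
  have "\<exists>G\<in>bergman_space \<gamma>. \<exists>r. strict_mono r \<and> (\<lambda>n. bergman_norm \<gamma> (\<lambda>z. comp_operator \<phi> (F (r n)) z - G z)) \<longlonglongrightarrow> 0"
    if F: "\<forall>n. F n \<in> bergman_space \<beta>" and Fb: "\<forall>n. bergman_norm \<beta> (F n) \<le> C0" for F :: "nat \<Rightarrow> complex ^ 'd \<Rightarrow> complex" and C0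
  proof -
    define C where "C = max C0 0"
    have C: "C \<ge> 0" by (simp add: C_def)
    define c where "c n = coeffs_of (F n)" for n
    have hF: "holomorphic_polydisc (F n)" for n using F by (simp add: bergman_space_def)
    have Fc: "has_coeffs (F n) (c n)" for n unfolding c_def by (rule has_coeffs_coeffs_of[OF hF])
    have cb: "coeff_norm (bergman_weight \<beta>) (c n) \<le> ennreal (C\<^sup>2)" for n
    proof -
      let ?X = "coeff_norm (bergman_weight \<beta>) (c n)"
      have fin: "?X < \<infinity>" using F bergman_space_iff[OF b Fc] by simp
      have "sqrt (enn2real ?X) \<le> C"
        using Fb[rule_format, of n] bergman_norm_eq[OF b Fc, of n] by (simp add: C_def)
      then have "(sqrt (enn2real ?X))\<^sup>2 \<le> C\<^sup>2" by (intro power_mono) auto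
      then have "enn2real ?X \<le> C\<^sup>2" by simp
      then have "ennreal (enn2real ?X) \<le> ennreal (C\<^sup>2)" by (rule ennreal_leI)
      moreover have "ennreal (enn2real ?X) = ?X" using fin by (intro ennreal_enn2real) simp
      ultimately show ?thesis by (simp only:)
    qed
    have wp: "bergman_weight \<beta> \<alpha> > 0" for \<alpha> :: "'d multiindex" using b by simp
    \<comment> \<open>The square root of the weight makes the bound independent of \<alpha>, as the
      diagonal selection of a subsequence demands.\<close>
    have nb: "norm (complex_of_real (sqrt (bergman_weight \<beta> \<alpha>)) * c n \<alpha>) \<le> C" for n \<alpha>
    proof -
      have "sqrt (bergman_weight \<beta> \<alpha>) * norm (c n \<alpha>) \<le> sqrt (bergman_weight \<beta> \<alpha>) * (C / sqrt (bergman_weight \<beta> \<alpha>))"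
        using wp[of \<alpha>] by (intro mult_left_mono coefficient_bound[OF b C cb]) (auto simp: less_imp_le)
      also have "\<dots> = C" using wp[of \<alpha>] by simp
      finally show ?thesis using wp[of \<alpha>] by (simp add: norm_mult)
    qed
    obtain k where k: "strict_mono k" and "\<And>\<alpha>. \<alpha> \<in> UNIV \<Longrightarrow> \<exists>l. (\<lambda>n. complex_of_real (sqrt (bergman_weight \<beta> \<alpha>)) * c (k n) \<alpha>) \<longlonglongrightarrow> l"
      by (rule function_convergent_subsequence[OF countableI_type[of "UNIV :: 'd multiindex set"],
            of "\<lambda>n \<alpha>. complex_of_real (sqrt (bergman_weight \<beta> \<alpha>)) * c n \<alpha>", OF nb]) (rule that)
    then have "\<forall>\<alpha>. \<exists>l. (\<lambda>n. complex_of_real (sqrt (bergman_weight \<beta> \<alpha>)) * c (k n) \<alpha>) \<longlonglongrightarrow> l" by simp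
    then obtain l where l: "\<forall>\<alpha>. (\<lambda>n. complex_of_real (sqrt (bergman_weight \<beta> \<alpha>)) * c (k n) \<alpha>) \<longlonglongrightarrow> l \<alpha>"
      by (rule choice[THEN exE])
    define d where "d \<alpha> = l \<alpha> / complex_of_real (sqrt (bergman_weight \<beta> \<alpha>))" for \<alpha>
    have lim: "(\<lambda>n. c (k n) \<alpha>) \<longlonglongrightarrow> d \<alpha>" for \<alpha>
    proof -
      have nz: "complex_of_real (sqrt (bergman_weight \<beta> \<alpha>)) \<noteq> 0" using wp[of \<alpha>] by simp
      from tendsto_divide[OF l[rule_format, of \<alpha>] tendsto_const nz] show ?thesis
        unfolding d_def using nz by simp
    qed
    have db: "coeff_norm (bergman_weight \<beta>) d \<le> ennreal (C\<^sup>2)"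
      by (rule coeff_norm_Fatou[OF lim cb])
    define G where "G z = (\<Sum>\<^sub>\<infinity>\<alpha>. d \<alpha> * mpow z \<alpha>)" for z :: "complex ^ 'd"
    have Gd: "has_coeffs G d" unfolding G_def[abs_def] by (rule has_coeffs_of_coeff_norm[OF b C db])
    have hG: "holomorphic_polydisc G" by (rule has_coeffs_imp_holomorphic[OF Gd])
    have GB: "G \<in> bergman_space \<beta>" using bergman_space_iff[OF b Gd] db by (auto intro: le_less_trans)
    define h where "h n z = F (k n) z - G z" for n z
    have hc: "has_coeffs (h n) (\<lambda>\<alpha>. c (k n) \<alpha> - d \<alpha>)" for n
      unfolding h_def[abs_def] by (rule has_coeffs_diff[OF Fc Gd])
    define e where "e n = coeffs_of (\<lambda>z. h n (\<phi> z))" for n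
    have he: "has_coeffs (\<lambda>z. h n (\<phi> z)) (e n)" for n
      unfolding e_def by (rule has_coeffs_coeffs_of[OF comp[OF has_coeffs_imp_holomorphic[OF hc]]])
    have w0: "bergman_weight \<beta> \<alpha> \<ge> 0" for \<alpha> :: "'d multiindex" using wp[of \<alpha>] by simp
    have hb: "coeff_norm (bergman_weight \<beta>) (\<lambda>\<alpha>. c (k n) \<alpha> - d \<alpha>) \<le> ennreal ((2 * C)\<^sup>2)" for n
      by (rule coeff_norm_diff_le_square[OF w0 cb db])
    have C2: "2 * C \<ge> 0" using C by simp
    have e0: "(\<lambda>n. e n \<nu>) \<longlonglongrightarrow> 0" for \<nu>
    proof (rule comp_coeffs_tendsto_0[OF \<phi> b C2 hc he hb])
      show "(\<lambda>n. c (k n) \<alpha> - d \<alpha>) \<longlonglongrightarrow> 0" for \<alpha> using lim by (simp add: LIM_zero)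
    qed
    define y where "y n = coeff_norm (bergman_weight \<gamma>) (e n)" for n
    have yfin: "y n < \<infinity>" for n
      using comp_coeff_norm_le[OF \<phi> b mb M hc he C2 hb] unfolding y_def by (rule le_less_trans) simp
    have y0: "y \<longlonglongrightarrow> 0"
    proof (rule ennreal_tendsto_0I)
      fix \<epsilon> :: real assume \<epsilon>: "\<epsilon> > 0"
      \<comment> \<open>The summand 1 keeps \<open>D\<close> positive when \<open>C = 0\<close>.
        Then \<delta> is chosen so that the tail contributes at most \<epsilon> / 2, the other half
        being left to the cube.\<close>
      define D where "D = (2 * C)\<^sup>2 + 1"
      have D: "D > 0" "(2 * C)\<^sup>2 \<le> D" by (auto simp: D_def add_nonneg_pos)
      define \<delta> where "\<delta> = \<epsilon> / 2 / D"
      have \<delta>: "\<delta> > 0" using \<epsilon> D by (simp add: \<delta>_def)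
      have "\<delta> * (2 * C)\<^sup>2 \<le> \<delta> * D" using \<delta> D by (intro mult_left_mono) auto
      also have "\<dots> = \<epsilon> / 2" using D(1) by (simp add: \<delta>_def)
      finally have \<delta>C: "\<delta> * (2 * C)\<^sup>2 \<le> \<epsilon> / 2" .
      obtain N where N: "mat_bound (comp_matrix \<phi>) (bergman_weight \<beta>) (tail_weight \<gamma> N) \<delta>"
        using tail[OF \<delta>] by (rule exE)
      have t: "coeff_norm (tail_weight \<gamma> N) (e n) \<le> ennreal (\<epsilon> / 2)" for n
        using comp_coeff_norm_le[OF \<phi> b N less_imp_le[OF \<delta>] hc he C2 hb] ennreal_leI[OF \<delta>C] by (rule order_trans)
      have "(\<lambda>n. \<Sum>\<alpha>\<in>box_index N. ennreal (bergman_weight \<gamma> \<alpha> * (norm (e n \<alpha>))\<^sup>2)) \<longlonglongrightarrow>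
          (\<Sum>\<alpha>\<in>box_index N. ennreal (bergman_weight \<gamma> (\<alpha> :: 'd multiindex) * (norm (0::complex))\<^sup>2))"
        by (intro tendsto_sum tendsto_ennrealI tendsto_mult tendsto_power tendsto_norm tendsto_const e0)
      then have "\<forall>\<^sub>F n in sequentially. (\<Sum>\<alpha>\<in>box_index N. ennreal (bergman_weight \<gamma> \<alpha> * (norm (e n \<alpha>))\<^sup>2)) < ennreal (\<epsilon> / 2)"
        by (rule order_tendstoD(2)) (use \<epsilon> in simp)
      then show "\<forall>\<^sub>F n in sequentially. y n \<le> ennreal \<epsilon>"
      proof eventually_elim
        case (elim n)
        have "y n \<le> ennreal (\<epsilon> / 2) + ennreal (\<epsilon> / 2)"
          unfolding y_def coeff_norm_split_box[of \<gamma> _ N] using elim t[of n] by (intro add_mono) auto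
        also have "\<dots> = ennreal \<epsilon>" using \<epsilon> by (subst ennreal_plus[symmetric]) auto
        finally show ?case .
      qed
    qed
    have "bergman_norm \<gamma> (\<lambda>z. comp_operator \<phi> (F (k n)) z - comp_operator \<phi> G z) = sqrt (enn2real (y n))" for n
      using bergman_norm_eq[OF g he, of n] by (simp add: y_def comp_operator_def h_def)
    then have "(\<lambda>n. bergman_norm \<gamma> (\<lambda>z. comp_operator \<phi> (F (k n)) z - comp_operator \<phi> G z)) \<longlonglongrightarrow> 0"
      using ennreal_tendsto_0_sqrt[of y] yfin y0 by simp
    then show ?thesis using bounded[OF GB] k by (intro bexI[of _ "comp_operator \<phi> G"] exI[of _ k] conjI)
  qed
  then show ?thesis unfolding maps_compactly_def using bounded by blast
qed

text \<open>Interpolation between \<beta> and 2 \<beta> + 2: at the first parameter compactness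
  gives a bound and small tails, at the second the tensor square gives a bound. The weight at
  \<theta> is that of the parameter whose shift by 2 is (1 + \<theta>) (\<beta> + 2).\<close>

lemma maps_compactly_step:
  fixes \<phi> :: "complex ^ 'd::finite \<Rightarrow> complex ^ 'd"
  assumes \<phi>: "holomorphic_self_map \<phi>" and b: "\<beta> \<ge> -1" and g: "\<gamma> \<ge> -1"
    and mc: "maps_compactly (comp_operator \<phi>) \<beta> \<gamma>"
    and \<theta>: "0 < \<theta>" "\<theta> < 1" and b': "\<beta>' + 2 = (1 + \<theta>) * (\<beta> + 2)" and g': "\<gamma>' + 2 = (1 + \<theta>) * (\<gamma> + 2)"
  shows "maps_compactly (comp_operator \<phi>) \<beta>' \<gamma>'"
proof -
  have "0 \<le> \<theta> * (\<beta> + 2)" "0 \<le> \<theta> * (\<gamma> + 2)" using b g \<theta> by simp_all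
  then have b'1: "\<beta>' \<ge> -1" and g'1: "\<gamma>' \<ge> -1" using b g b' g' by (auto simp: algebra_simps)
  have b2: "2 * \<beta> + 2 \<ge> -1" and g2: "2 * \<gamma> + 2 \<ge> -1" using b g by auto
  let ?t = "comp_matrix \<phi>"
  have w0: "bergman_weight \<gamma> \<alpha> \<ge> 0" for \<alpha> :: "'d multiindex" using g by (simp add: less_imp_le)
  \<comment> \<open>Boundedness is drawn from the general criterion with the full weight divided by
    n + 1, which tends to 0 at each index; undoing the division gives the bound n + 1.\<close>
  have "\<exists>n. mat_bound ?t (bergman_weight \<beta>) (\<lambda>\<alpha>. bergman_weight \<gamma> \<alpha> / (real n + 1)) 1"
  proof (rule maps_compactly_imp_mat_bound[OF \<phi> b g mc])
    show "bergman_weight \<gamma> \<alpha> / (real n + 1) \<le> bergman_weight \<gamma> \<alpha>" for n and \<alpha> :: "'d multiindex"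
      using w0[of \<alpha>] by (simp add: divide_le_eq mult_left_mono[of 1, simplified] ring_distribs)
    have "(\<lambda>n. x / (real n + 1)) \<longlonglongrightarrow> 0" for x :: real by real_asymp
    then show "(\<lambda>n. bergman_weight \<gamma> \<alpha> / (real n + 1)) \<longlonglongrightarrow> 0" for \<alpha> :: "'d multiindex" .
  qed (use w0 in auto)
  then obtain n where "mat_bound ?t (bergman_weight \<beta>) (\<lambda>\<alpha>. bergman_weight \<gamma> \<alpha> / (real n + 1)) 1" by (rule exE)
  then have "mat_bound ?t (bergman_weight \<beta>) (bergman_weight \<gamma>) (1 * (real n + 1) * 1)"
    by (rule mat_bound_mono) auto
  then obtain M where M: "M > 0" and mb: "mat_bound ?t (bergman_weight \<beta>) (bergman_weight \<gamma>) M"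
    by (rule that[rotated]) simp
  have tail: "\<exists>N. mat_bound ?t (bergman_weight \<beta>) (tail_weight \<gamma> N) \<epsilon>" if "\<epsilon> > 0" for \<epsilon>
  proof (rule maps_compactly_imp_mat_bound[OF \<phi> b g mc _ _ _ that])
    show "(\<lambda>N. tail_weight \<gamma> N \<alpha>) \<longlonglongrightarrow> 0" for \<alpha> :: "'d multiindex"
      by (rule tendsto_eventually, rule eventually_mono[OF eventually_in_box_index[of \<alpha>]]) (simp add: tail_weight_def)
  qed (use w0 in \<open>auto simp: tail_weight_def\<close>)
  have sq: "mat_bound ?t (bergman_weight (2 * \<beta> + 2)) (bergman_weight (2 * \<gamma> + 2)) (M\<^sup>2)"
    by (rule mat_bound_square[OF mb less_imp_le[OF M] bergman_weight_pos[OF b] bergman_weight_pos[OF g]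
        bergman_weight_Vandermonde bergman_weight_Vandermonde comp_matrix_split[OF \<phi>]])
  obtain A where A: "A > 0"
    "\<And>\<alpha>::'d multiindex. bergman_weight \<beta> \<alpha> powr (1 - \<theta>) * bergman_weight (2 * \<beta> + 2) \<alpha> powr \<theta> \<le> A * bergman_weight \<beta>' \<alpha>"
    by (rule bergman_weight_interpolate[OF b \<theta> b', where 'd = 'd]) (rule that)
  obtain B where B: "B > 0"
    "\<And>\<alpha>::'d multiindex. bergman_weight \<gamma>' \<alpha> \<le> B * (bergman_weight \<gamma> \<alpha> powr (1 - \<theta>) * bergman_weight (2 * \<gamma> + 2) \<alpha> powr \<theta>)"
    by (rule bergman_weight_interpolate[OF g \<theta> g', where 'd = 'd]) (rule that)
  have M2: "M\<^sup>2 > 0" using M by simp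
  define K where "K = A * B * (M\<^sup>2) powr \<theta>"
  have K: "K > 0" using A B M by (simp add: K_def)
  \<comment> \<open>At the first end \<open>w\<close> will be either the full weight or a tail; at
    the other end the full weight always stands. The bound \<open>m\<close> of the first end enters
    as \<open>m powr (1 - \<theta>)\<close> and keeps its smallness.\<close>
  have interp: "mat_bound ?t (bergman_weight \<beta>') v (K * m powr (1 - \<theta>))"
    if mb0: "mat_bound ?t (bergman_weight \<beta>) w m" and m: "m > 0" and wn: "\<And>\<alpha>. w \<alpha> \<ge> 0"
      and v: "\<And>\<alpha>. v \<alpha> \<le> B * (w \<alpha> powr (1 - \<theta>) * bergman_weight (2 * \<gamma> + 2) \<alpha> powr \<theta>)" for w v m
  proof -
    have "mat_bound ?t (\<lambda>\<alpha>. bergman_weight \<beta> \<alpha> powr (1 - \<theta>) * bergman_weight (2 * \<beta> + 2) \<alpha> powr \<theta>)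
       (\<lambda>\<alpha>. w \<alpha> powr (1 - \<theta>) * bergman_weight (2 * \<gamma> + 2) \<alpha> powr \<theta>) (m powr (1 - \<theta>) * (M\<^sup>2) powr \<theta>)"
      by (rule mat_bound_interpolate[OF mb0 sq bergman_weight_pos[OF b] bergman_weight_pos[OF b2] wn
          less_imp_le[OF bergman_weight_pos[OF g2]] m M2 \<theta>])
    then have "mat_bound ?t (bergman_weight \<beta>') v (A * B * (m powr (1 - \<theta>) * (M\<^sup>2) powr \<theta>))"
      by (rule mat_bound_mono) (use A B v in auto)
    then show ?thesis by (simp add: K_def mult_ac)
  qed
  show ?thesis
  proof (rule mat_bound_imp_maps_compactly[OF \<phi> b'1 g'1])
    show "mat_bound ?t (bergman_weight \<beta>') (bergman_weight \<gamma>') (K * M powr (1 - \<theta>))"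
      by (rule interp[OF mb M w0 B(2)])
    show "0 \<le> K * M powr (1 - \<theta>)" using K by simp
    fix \<epsilon> :: real assume \<epsilon>: "\<epsilon> > 0"
    \<comment> \<open>The solution of \<open>K * \<delta> powr (1 - \<theta>) = \<epsilon>\<close>,
      available because \<theta> < 1.\<close>
    define \<delta> where "\<delta> = (\<epsilon> / K) powr (1 / (1 - \<theta>))"
    have \<delta>: "\<delta> > 0" using \<epsilon> K by (simp add: \<delta>_def)
    have "K * \<delta> powr (1 - \<theta>) = \<epsilon>" using \<epsilon> K \<theta> by (simp add: \<delta>_def powr_powr)
    moreover obtain N where N: "mat_bound ?t (bergman_weight \<beta>) (tail_weight \<gamma> N) \<delta>" using tail[OF \<delta>] by (rule exE)
    have "mat_bound ?t (bergman_weight \<beta>') (tail_weight \<gamma>' N) (K * \<delta> powr (1 - \<theta>))"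
    proof (rule interp[OF N \<delta>])
      show "tail_weight \<gamma> N \<alpha> \<ge> 0" for \<alpha> :: "'d multiindex" using w0 by (simp add: tail_weight_def)
      show "tail_weight \<gamma>' N \<alpha> \<le> B * (tail_weight \<gamma> N \<alpha> powr (1 - \<theta>) * bergman_weight (2 * \<gamma> + 2) \<alpha> powr \<theta>)" for \<alpha> :: "'d multiindex"
        using B(2)[of \<alpha>] by (simp add: tail_weight_def)
    qed
    ultimately show "\<exists>N. mat_bound ?t (bergman_weight \<beta>') (tail_weight \<gamma>' N) \<epsilon>" by (intro exI[of _ N]) simp
  qed
qed

lemma maps_compactly_scale:
  fixes \<phi> :: "complex ^ 'd::finite \<Rightarrow> complex ^ 'd"
  assumes \<phi>: "holomorphic_self_map \<phi>" and b: "\<beta> \<ge> -1" and g: "\<gamma> \<ge> -1"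
    and mc: "maps_compactly (comp_operator \<phi>) \<beta> \<gamma>" and s: "s \<ge> 1"
  shows "maps_compactly (comp_operator \<phi>) (s * (\<beta> + 2) - 2) (s * (\<gamma> + 2) - 2)"
proof -
  \<comment> \<open>The exponent is so large that the k-th root \<open>a\<close> of \<open>s\<close>
    is below 2; multiplication by \<open>a\<close> is then one interpolation step with \<theta> = a
    - 1. The value a = 1, where \<theta> would be 0, is treated apart.\<close>
  obtain k :: nat where k: "s < 2 ^ k" using real_arch_pow[of 2 s] by auto
  have k0: "k > 0" using k s by (cases k) auto
  define a where "a = s powr (1 / real k)"
  have a1: "a \<ge> 1" using s by (simp add: a_def ge_one_powr_ge_zero)
  have ak: "a ^ k = s" using s k0 by (simp add: a_def powr_realpow[symmetric] powr_powr)
  have a2: "a < 2"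
  proof (rule ccontr)
    assume "\<not> a < 2"
    then have "2 ^ k \<le> a ^ k" by (intro power_mono) auto
    then show False using ak k by simp
  qed
  have "maps_compactly (comp_operator \<phi>) (a ^ n * (\<beta> + 2) - 2) (a ^ n * (\<gamma> + 2) - 2)" for n
  proof (induction n)
    case 0
    then show ?case using mc by simp
  next
    case (Suc n)
    show ?case
    proof (cases "a = 1")
      case True
      then show ?thesis using mc by simp
    next
      case False
      have an: "a ^ n \<ge> 1" using a1 by simp
      have ge: "a ^ n * (x + 2) - 2 \<ge> -1" if "x \<ge> -1" for x
        using mult_mono[of 1 "a ^ n" 1 "x + 2"] an that by simp
      show ?thesis
        by (rule maps_compactly_step[OF \<phi> ge[OF b] ge[OF g] Suc, of "a - 1"])
          (use a1 a2 False in \<open>auto simp: mult_ac\<close>)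
    qed
  qed
  from this[of k] show ?thesis by (simp add: ak)
qed

theorem theorem2p11:
  fixes \<phi> :: "complex ^ 'd \<Rightarrow> complex ^ 'd" and \<beta>1 \<beta>2 :: real
  assumes "holomorphic_self_map \<phi>"
    and "C1_closed_polydisc \<phi>"
    and "\<beta>1 \<ge> -1" and "\<beta>2 \<ge> -1"
  shows "(maps_compactly (comp_operator \<phi>) \<beta>1 \<beta>2 \<longrightarrow>
            (\<forall>\<beta>1' \<ge> \<beta>1. maps_compactly (comp_operator \<phi>) \<beta>1'
               ((\<beta>1' * (\<beta>2 + 2) + 2 * (\<beta>2 - \<beta>1)) / (\<beta>1 + 2))))
       \<and> (maps_compactly (comp_operator \<phi>) \<beta>1 \<beta>1 \<longrightarrow>
            (\<forall>\<beta>1' \<ge> \<beta>1. maps_compactly (comp_operator \<phi>) \<beta>1' \<beta>1'))"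
proof -
  have main: "maps_compactly (comp_operator \<phi>) \<beta>1' ((\<beta>1' * (\<gamma> + 2) + 2 * (\<gamma> - \<beta>1)) / (\<beta>1 + 2))"
    if "maps_compactly (comp_operator \<phi>) \<beta>1 \<gamma>" "\<beta>1' \<ge> \<beta>1" "\<gamma> \<ge> -1" for \<beta>1' \<gamma>
  proof -
    \<comment> \<open>The formula for the target parameter says precisely that source and target
      parameters, both shifted by 2, are multiplied by the same factor \<open>s\<close>.\<close>
    define s where "s = (\<beta>1' + 2) / (\<beta>1 + 2)"
    have p: "\<beta>1 + 2 > 0" using assms(3) by simp
    have s1: "s \<ge> 1" using that(2) p by (simp add: s_def)
    have s\<beta>: "s * (\<beta>1 + 2) - 2 = \<beta>1'" using p by (simp add: s_def)
    have s\<gamma>: "s * (\<gamma> + 2) - 2 = (\<beta>1' * (\<gamma> + 2) + 2 * (\<gamma> - \<beta>1)) / (\<beta>1 + 2)"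
      using p by (simp add: s_def field_simps)
    show ?thesis
      using maps_compactly_scale[OF assms(1,3) that(3,1) s1] by (simp only: s\<beta> s\<gamma>)
  qed
  \<comment> \<open>With equal source and target parameters the formula returns the new source
    parameter, which gives the second claim.\<close>
  have "(\<beta>1' * (\<beta>1 + 2) + 2 * (\<beta>1 - \<beta>1)) / (\<beta>1 + 2) = \<beta>1'" for \<beta>1'
    using assms(3) by simp
  then show ?thesis
    using main[of \<beta>2] main[of \<beta>1] assms(3,4) by metis
qed

end
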